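(* Let $A$, $B$ be $C^{k,\alpha}$ convex bodies in $\mathbb{R}^n$, where $k\ge 2$ is an integer, $\infty$ or $\omega$, and $\alpha\in[0,1]$. If either $Z_A$ or $Z_B$ is countable, then the set of rotations $R\in SO(n)$ such that $R(A)+B$ is $C^{k,\alpha}$ is comeager in $SO(n)$ (i.e. $R(A)+B$ is $C^{k,\alpha}$ for generic $R\in SO(n)$).
   Context: A convex body in $\mathbb{R}^n$ is a compact convex set with non-empty interior; it is $C^{k,\alpha}$ if its boundary is a $C^{k,\alpha}$ submanifold of $\mathbb{R}^n$ ($C^\omega$ = real analytic; $C^{k,\alpha}$ means $k$th derivatives continuous for $\alpha=0$, Lipschitz for $\alpha=1$, $\alpha$-Hölder for $0<\alpha<1$). $R(A)+B$ is the Minkowski sum $\{x+y: x\in R(A), y\in B\}$. For a $C^2$ convex body $C$ with Gauss map $\nu_C\colon\partial C\to S^{n-1}$ (unit outer normal) and Gaussian curvature $G_C$, set $Z_C=\{\nu_C(x): x\in\partial C,\ G_C(x)=0\}$. A subset of $SO(n)$ is comeager if it contains a countable intersection of open dense subsets. *)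

theory Defs
  imports "HOL-Analysis.Analysis"
begin

datatype regularity = Fin nat | Infty | Omega

definition convex_body :: "(real^'n) set \<Rightarrow> bool" where
  "convex_body C \<longleftrightarrow> compact C \<and> convex C \<and> interior C \<noteq> {}"

text \<open>Iterated Frechet derivatives on an open set U, given as a family D where
  D j x [h1,...,hj] is the j-th derivative at x applied to h1,...,hj.
  The function F is C^k on U with k-th derivative locally alpha-Hoelder.\<close>
definition higher_derivs :: "nat \<Rightarrow> (real^'n) set \<Rightarrow> ((real^'n) \<Rightarrow> real)
    \<Rightarrow> (nat \<Rightarrow> real^'n \<Rightarrow> (real^'n) list \<Rightarrow> real) \<Rightarrow> bool" where
  "higher_derivs k U F D \<longleftrightarrow>
     (\<forall>x\<in>U. D 0 x [] = F x) \<and>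
     (\<forall>j<k. \<forall>hs. length hs = j \<longrightarrow> (\<forall>x\<in>U.
         ((\<lambda>y. D j y hs) has_derivative (\<lambda>h. D (Suc j) x (h # hs))) (at x))) \<and>
     (\<forall>j\<le>k. \<forall>hs. length hs = j \<longrightarrow> continuous_on U (\<lambda>y. D j y hs))"

definition Ck_on :: "nat \<Rightarrow> (real^'n) set \<Rightarrow> ((real^'n) \<Rightarrow> real) \<Rightarrow> bool" where
  "Ck_on k U F \<longleftrightarrow> (\<exists>D. higher_derivs k U F D)"

definition Ck_alpha_on :: "nat \<Rightarrow> real \<Rightarrow> (real^'n) set \<Rightarrow> ((real^'n) \<Rightarrow> real) \<Rightarrow> bool" where
  "Ck_alpha_on k \<alpha> U F \<longleftrightarrow> (\<exists>D. higher_derivs k U F D \<and>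
     (\<forall>p\<in>U. \<exists>r>0. \<exists>M. \<forall>x\<in>U \<inter> ball p r. \<forall>y\<in>U \<inter> ball p r. \<forall>hs.
        length hs = k \<and> (\<forall>h\<in>set hs. norm h \<le> 1) \<longrightarrow>
        \<bar>D k x hs - D k y hs\<bar> \<le> M * dist x y powr \<alpha>))"

definition real_analytic_on :: "(real^'n) set \<Rightarrow> ((real^'n) \<Rightarrow> real) \<Rightarrow> bool" where
  "real_analytic_on U F \<longleftrightarrow> (\<forall>p\<in>U. \<exists>r>0. \<exists>c :: ('n \<Rightarrow> nat) \<Rightarrow> real.
     \<forall>x\<in>ball p r \<inter> U. ((\<lambda>a. c a * (\<Prod>i\<in>UNIV. (x $ i - p $ i) ^ a i)) has_sum F x) UNIV)"

definition reg_fun :: "regularity \<Rightarrow> real \<Rightarrow> (real^'n) set \<Rightarrow> ((real^'n) \<Rightarrow> real) \<Rightarrow> bool" where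
  "reg_fun r \<alpha> U F = (case r of
       Fin k \<Rightarrow> Ck_alpha_on k \<alpha> U F
     | Infty \<Rightarrow> (\<forall>k. Ck_on k U F)
     | Omega \<Rightarrow> real_analytic_on U F)"

text \<open>A convex body whose boundary is a C^{k,alpha} hypersurface, described locally
  as the regular zero set of a C^{k,alpha} function.\<close>
definition reg_body :: "regularity \<Rightarrow> real \<Rightarrow> (real^'n) set \<Rightarrow> bool" where
  "reg_body r \<alpha> C \<longleftrightarrow> convex_body C \<and>
     (\<forall>p\<in>frontier C. \<exists>U F. open U \<and> p \<in> U \<and> reg_fun r \<alpha> U F \<and>
        (\<forall>x\<in>U. \<exists>L. (F has_derivative L) (at x) \<and> L \<noteq> (\<lambda>_. 0)) \<and>
        frontier C \<inter> U = {x\<in>U. F x = 0})"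

definition gauss_map :: "(real^'n) set \<Rightarrow> real^'n \<Rightarrow> real^'n" where
  "gauss_map C x = (THE u. norm u = 1 \<and> (\<forall>y\<in>C. inner (y - x) u \<le> 0))"

text \<open>Gaussian curvature: determinant of the differential of the Gauss map
  (along the boundary) on the tangent space nu(x)^perp; it is computed as the
  determinant of the extension acting as identity on the normal line.\<close>
definition gauss_curv :: "(real^'n) set \<Rightarrow> real^'n \<Rightarrow> real" where
  "gauss_curv C x = (let \<nu> = gauss_map C x;
       L = (SOME L. (gauss_map C has_derivative L) (at x within frontier C))
     in det (matrix (\<lambda>v. L (v - inner v \<nu> *\<^sub>R \<nu>) + inner v \<nu> *\<^sub>R \<nu>)))"

definition Zset :: "(real^'n) set \<Rightarrow> (real^'n) set" where
  "Zset C = {gauss_map C x | x. x \<in> frontier C \<and> gauss_curv C x = 0}"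

definition SO :: "(real^'n^'n) set" where
  "SO = {R. orthogonal_matrix R \<and> det R = 1}"

definition comeager_in :: "'a::topological_space set \<Rightarrow> 'a set \<Rightarrow> bool" where
  "comeager_in X S \<longleftrightarrow> (\<exists>\<U>. countable \<U> \<and>
     (\<forall>U\<in>\<U>. openin (top_of_set X) U \<and> (top_of_set X) closure_of U = X) \<and>
     X \<inter> \<Inter>\<U> \<subseteq> S)"

definition minkowski_sum :: "(real^'n) set \<Rightarrow> (real^'n) set \<Rightarrow> (real^'n) set" where
  "minkowski_sum A B = {x + y | x y. x \<in> A \<and> y \<in> B}"

end

theory Submission
  imports Defs
begin

text \<open>If \<open>A\<close> has positive curvature at \<open>a\<close>, its Gauss map has a local inverse \<open>\<xi>\<close> there. Let the
  boundary of \<open>B\<close> be the zero set of \<open>G\<close> near the point \<open>b\<close> with the same normal. Near \<open>a + b\<close> the boundary of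
  \<open>A + B\<close> is the image of that of \<open>B\<close> under \<open>\<Phi> y = y + \<xi> (\<nabla>G y)\<close>, with \<open>\<xi>\<close> extended homogeneously
  of degree 0. By monotonicity of the two Gauss maps \<open>\<Phi>\<close> is a local diffeomorphism, a priori one degree
  less regular than \<open>A\<close> and \<open>B\<close>. But \<open>\<xi>\<close> moves along the boundary of \<open>A\<close>, so the derivative of
  \<open>\<xi> (\<nabla>G y)\<close> is orthogonal to \<open>\<nabla>G y\<close>, and \<open>Q = G \<circ> \<Phi>\<inverse>\<close> has gradient \<open>\<nabla>G \<circ> \<Phi>\<inverse>\<close>. Hence
  \<open>Q\<close> has full regularity. So \<open>R(A) + B\<close> is regular as soon as \<open>R(Z\<^sub>A)\<close> and \<open>Z\<^sub>B\<close> are disjoint. Both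
  sets are compact with dense complement in the sphere: the farthest point of a body from a remote
  point has positive curvature and is alone in its supporting hyperplane. So for each fixed normal
  \<open>z\<close> the rotations with \<open>R z \<notin> Z\<^sub>B\<close> are open and dense, and countably many \<open>z\<close> have to be avoided.\<close>

section \<open>Functions with Hoelder continuous derivatives\<close>

text \<open>The derivative of \<open>\<Phi>\<close> is the identity plus a product of the
  derivatives of two monotone maps. Both factors are positive semidefinite on the tangent space, but
  their product is in general not symmetric, so a kernel vector z has to be treated directly: with w
  the derivative of the normal of B along z, monotonicity for B gives z \<bullet> w \<ge> 0 and
  monotonicity for A gives z \<bullet> w \<le> 0, and a symmetric semidefinite form that vanishes on
  z has z in its kernel. This is why the Hessian is shown to be symmetric. The extension of degree 0
  is realised by dividing a gradient by its product with the normal at the base point, so that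
  normals range over an affine hyperplane and only sums, products, quotients, composites and inverse
  maps occur. These closure properties are proved for each kind of regularity; \<open>lower\<close>
  and \<open>reg_fun_raise\<close> then let the geometry be done once for all of them. Countability
  enters only through the definition of comeager: each normal of the countable set contributes one
  open dense condition on the rotation.\<close>

definition loc_hoelder :: "real \<Rightarrow> (real^'n) set \<Rightarrow> (real^'n \<Rightarrow> real) \<Rightarrow> bool" where
  "loc_hoelder \<alpha> U f \<longleftrightarrow> continuous_on U f \<and>
     (\<forall>p\<in>U. \<exists>M. \<forall>\<^sub>F z in nhds p \<times>\<^sub>F nhds p.
        \<bar>f (fst z) - f (snd z)\<bar> \<le> M * dist (fst z) (snd z) powr \<alpha>)"

text \<open>A recursion over scalar partial derivatives in place of families of multilinear maps:
  the sum, product and chain rules become inductions on the order that never leave real-valued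
  functions. The agreement with the given notions is shown in \<open>Ck_alpha_on_iff_CK\<close> and
  \<open>Ck_on_iff_CK\<close>.\<close>

fun CK :: "nat \<Rightarrow> real \<Rightarrow> (real^'n) set \<Rightarrow> (real^'n \<Rightarrow> real) \<Rightarrow> bool" where
  "CK 0 \<alpha> U f = loc_hoelder \<alpha> U f"
| "CK (Suc k) \<alpha> U f = (\<exists>f'. (\<forall>x\<in>U. (f has_derivative f' x) (at x)) \<and>
      (\<forall>i. CK k \<alpha> U (\<lambda>x. f' x (axis i 1))))"

lemma CK_SucI:
  assumes "\<And>x. x \<in> U \<Longrightarrow> (f has_derivative f' x) (at x)" "\<And>i. CK k \<alpha> U (\<lambda>x. f' x (axis i 1))"
  shows "CK (Suc k) \<alpha> U f"
  using assms by (simp only: CK.simps) blast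

lemma eventually_prod_nhds_open:
  assumes "open U" "p \<in> U"
  shows "\<forall>\<^sub>F z in nhds p \<times>\<^sub>F nhds p. fst z \<in> U \<and> snd z \<in> U"
  using eventually_prodI[OF eventually_nhds_in_open[OF assms] eventually_nhds_in_open[OF assms]] by simp

text \<open>In the filter form finitely many local estimates combine without shrinking radii by
  hand. The ball form is the one that the mean value inequality and the given definition
  use.\<close>

lemma eventually_prod_nhds_metric:
  fixes p :: "'a::metric_space"
  shows "(\<forall>\<^sub>F z in nhds p \<times>\<^sub>F nhds p. P (fst z) (snd z)) \<longleftrightarrow> (\<exists>r>0. \<forall>x\<in>ball p r. \<forall>y\<in>ball p r. P x y)"
proof
  assume "\<forall>\<^sub>F z in nhds p \<times>\<^sub>F nhds p. P (fst z) (snd z)"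
  then obtain Q where Q: "eventually Q (nhds p)" "\<And>x y. Q x \<Longrightarrow> Q y \<Longrightarrow> P x y"
    unfolding eventually_prod_same by auto
  then obtain r where "r > 0" "\<And>x. dist x p < r \<Longrightarrow> Q x" unfolding eventually_nhds_metric by auto
  then show "\<exists>r>0. \<forall>x\<in>ball p r. \<forall>y\<in>ball p r. P x y"
    using Q by (auto simp: dist_commute intro!: exI[of _ r])
next
  assume "\<exists>r>0. \<forall>x\<in>ball p r. \<forall>y\<in>ball p r. P x y"
  then obtain r where r: "r > 0" "\<And>x y. x\<in>ball p r \<Longrightarrow> y\<in>ball p r \<Longrightarrow> P x y" by blast
  have "\<forall>\<^sub>F z in nhds p \<times>\<^sub>F nhds p. fst z \<in> ball p r \<and> snd z \<in> ball p r"
    using r by (intro eventually_prod_nhds_open) auto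
  then show "\<forall>\<^sub>F z in nhds p \<times>\<^sub>F nhds p. P (fst z) (snd z)"
    by eventually_elim (use r in auto)
qed

lemma loc_hoelder_cong:
  assumes "open U" "\<And>x. x \<in> U \<Longrightarrow> f x = g x" "loc_hoelder \<alpha> U f"
  shows "loc_hoelder \<alpha> U g"
  unfolding loc_hoelder_def
proof (intro conjI ballI)
  show "continuous_on U g"
    using assms continuous_on_cong[of U U f g] by (auto simp: loc_hoelder_def)
  fix p assume p: "p \<in> U"
  with assms obtain M where
    M: "\<forall>\<^sub>F z in nhds p \<times>\<^sub>F nhds p. \<bar>f (fst z) - f (snd z)\<bar> \<le> M * dist (fst z) (snd z) powr \<alpha>"
    by (auto simp: loc_hoelder_def)
  have "\<forall>\<^sub>F z in nhds p \<times>\<^sub>F nhds p. \<bar>g (fst z) - g (snd z)\<bar> \<le> M * dist (fst z) (snd z) powr \<alpha>"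
    using M eventually_prod_nhds_open[OF assms(1) p]
    by eventually_elim (simp add: assms(2)[symmetric])
  then show "\<exists>M. \<forall>\<^sub>F z in nhds p \<times>\<^sub>F nhds p. \<bar>g (fst z) - g (snd z)\<bar> \<le> M * dist (fst z) (snd z) powr \<alpha>" ..
qed

lemma CK_cong:
  assumes "open U" "\<And>x. x \<in> U \<Longrightarrow> f x = g x" "CK k \<alpha> U f"
  shows "CK k \<alpha> U g"
proof (cases k)
  case 0
  then show ?thesis using loc_hoelder_cong[OF assms(1,2)] assms(3) by simp
next
  case (Suc m)
  then obtain f' where f': "\<forall>x\<in>U. (f has_derivative f' x) (at x)"
    "\<forall>i. CK m \<alpha> U (\<lambda>x. f' x (axis i 1))" using assms by auto
  have "\<forall>x\<in>U. (g has_derivative f' x) (at x)"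
    using f' assms by (meson has_derivative_transform_within_open)
  then show ?thesis using f' Suc by auto
qed

lemma CK_subset: "CK k \<alpha> U f \<Longrightarrow> V \<subseteq> U \<Longrightarrow> CK k \<alpha> V f"
proof (induction k arbitrary: f)
  case 0
  then show ?case by (auto simp: loc_hoelder_def intro: continuous_on_subset)
next
  case (Suc k)
  then show ?case by auto blast
qed

lemma CK_const: "CK k \<alpha> U (\<lambda>x. c)"
proof (induction k arbitrary: c)
  case 0
  then show ?case by (auto simp: loc_hoelder_def intro!: exI[of _ 0])
next
  case (Suc k)
  have "\<forall>x\<in>U. ((\<lambda>x. c) has_derivative (\<lambda>h. 0)) (at x)" by simp
  show ?case by (rule CK_SucI[of _ _ "\<lambda>x h. 0"]) (use Suc in auto)
qed

lemma abs_eventually_bounded: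
  fixes f :: "'a::t2_space \<Rightarrow> real"
  assumes "continuous_on U f" "open U" "p \<in> U"
  shows "\<forall>\<^sub>F x in nhds p. \<bar>f x\<bar> \<le> \<bar>f p\<bar> + 1"
proof -
  have "(f \<longlongrightarrow> f p) (nhds p)"
    using assms by (metis continuous_on_eq_continuous_at isCont_def tendsto_at_iff_tendsto_nhds)
  then have "((\<lambda>x. \<bar>f x\<bar>) \<longlongrightarrow> \<bar>f p\<bar>) (nhds p)" by (rule tendsto_rabs)
  then have "\<forall>\<^sub>F x in nhds p. \<bar>f x\<bar> < \<bar>f p\<bar> + 1" by (rule order_tendstoD) simp
  then show ?thesis by eventually_elim simp
qed

lemma loc_hoelder_add:
  assumes "loc_hoelder \<alpha> U f" "loc_hoelder \<alpha> U g"
  shows "loc_hoelder \<alpha> U (\<lambda>x. f x + g x)"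
  unfolding loc_hoelder_def
proof (intro conjI ballI)
  show "continuous_on U (\<lambda>x. f x + g x)"
    using assms by (auto simp: loc_hoelder_def intro: continuous_intros)
  fix p assume p: "p \<in> U"
  with assms obtain M N where
    M: "\<forall>\<^sub>F z in nhds p \<times>\<^sub>F nhds p. \<bar>f (fst z) - f (snd z)\<bar> \<le> M * dist (fst z) (snd z) powr \<alpha>"
    and N: "\<forall>\<^sub>F z in nhds p \<times>\<^sub>F nhds p. \<bar>g (fst z) - g (snd z)\<bar> \<le> N * dist (fst z) (snd z) powr \<alpha>"
    unfolding loc_hoelder_def by blast
  have "\<forall>\<^sub>F z in nhds p \<times>\<^sub>F nhds p. \<bar>(f (fst z) + g (fst z)) - (f (snd z) + g (snd z))\<bar> \<le> (M + N) * dist (fst z) (snd z) powr \<alpha>"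
    using M N by eventually_elim (simp add: distrib_right)
  then show "\<exists>M. \<forall>\<^sub>F z in nhds p \<times>\<^sub>F nhds p. \<bar>(f (fst z) + g (fst z)) - (f (snd z) + g (snd z))\<bar> \<le> M * dist (fst z) (snd z) powr \<alpha>" ..
qed

lemma loc_hoelder_mult:
  assumes "open U" "loc_hoelder \<alpha> U f" "loc_hoelder \<alpha> U g"
  shows "loc_hoelder \<alpha> U (\<lambda>x. f x * g x)"
  unfolding loc_hoelder_def
proof (intro conjI ballI)
  show "continuous_on U (\<lambda>x. f x * g x)"
    using assms by (auto simp: loc_hoelder_def intro: continuous_intros)
  fix p assume p: "p \<in> U"
  with assms obtain M N where
    M: "\<forall>\<^sub>F z in nhds p \<times>\<^sub>F nhds p. \<bar>f (fst z) - f (snd z)\<bar> \<le> M * dist (fst z) (snd z) powr \<alpha>"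
    and N: "\<forall>\<^sub>F z in nhds p \<times>\<^sub>F nhds p. \<bar>g (fst z) - g (snd z)\<bar> \<le> N * dist (fst z) (snd z) powr \<alpha>"
    unfolding loc_hoelder_def by blast
  have f: "\<forall>\<^sub>F x in nhds p. \<bar>f x\<bar> \<le> \<bar>f p\<bar> + 1" and g: "\<forall>\<^sub>F x in nhds p. \<bar>g x\<bar> \<le> \<bar>g p\<bar> + 1"
    using abs_eventually_bounded assms p by (auto simp: loc_hoelder_def)
  have fg: "\<forall>\<^sub>F z in nhds p \<times>\<^sub>F nhds p. \<bar>f (fst z)\<bar> \<le> \<bar>f p\<bar> + 1 \<and> \<bar>g (snd z)\<bar> \<le> \<bar>g p\<bar> + 1"
    using eventually_prodI[OF f g] by simp
  show "\<exists>M. \<forall>\<^sub>F z in nhds p \<times>\<^sub>F nhds p. \<bar>(f (fst z) * g (fst z)) - (f (snd z) * g (snd z))\<bar> \<le> M * dist (fst z) (snd z) powr \<alpha>"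
    using M N fg
  proof (intro exI[of _ "(\<bar>f p\<bar> + 1) * N + (\<bar>g p\<bar> + 1) * M"], eventually_elim)
    case (elim z)
    define a b c d where "a = f (fst z)" "b = f (snd z)" "c = g (fst z)" "d = g (snd z)"
    define D where "D = dist (fst z) (snd z) powr \<alpha>"
    have "\<bar>a * c - b * d\<bar> = \<bar>a * (c - d) + d * (a - b)\<bar>" by (simp add: algebra_simps)
    also have "\<dots> \<le> \<bar>a\<bar> * \<bar>c - d\<bar> + \<bar>d\<bar> * \<bar>a - b\<bar>" by (metis abs_mult abs_triangle_ineq)
    also have "\<dots> \<le> (\<bar>f p\<bar> + 1) * (N * D) + (\<bar>g p\<bar> + 1) * (M * D)"
      using elim by (intro add_mono mult_mono) (auto simp: a_b_c_d_def D_def)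
    finally show ?case by (simp add: a_b_c_d_def D_def algebra_simps)
  qed
qed

lemma loc_hoelder_inverse:
  assumes "open U" "loc_hoelder \<alpha> U f" "\<And>x. x \<in> U \<Longrightarrow> f x \<noteq> 0"
  shows "loc_hoelder \<alpha> U (\<lambda>x. inverse (f x))"
  unfolding loc_hoelder_def
proof (intro conjI ballI)
  show c: "continuous_on U (\<lambda>x. inverse (f x))"
    using assms by (auto simp: loc_hoelder_def intro: continuous_intros)
  fix p assume p: "p \<in> U"
  with assms obtain M where
    M: "\<forall>\<^sub>F z in nhds p \<times>\<^sub>F nhds p. \<bar>f (fst z) - f (snd z)\<bar> \<le> M * dist (fst z) (snd z) powr \<alpha>"
    unfolding loc_hoelder_def by blast
  define K where "K = \<bar>inverse (f p)\<bar> + 1"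
  have b: "\<forall>\<^sub>F x in nhds p. \<bar>inverse (f x)\<bar> \<le> K" 
    using abs_eventually_bounded[OF c assms(1) p] by (simp add: K_def)
  have "K \<ge> 0" by (simp add: K_def)
  have fg: "\<forall>\<^sub>F z in nhds p \<times>\<^sub>F nhds p. \<bar>inverse (f (fst z))\<bar> \<le> K \<and> \<bar>inverse (f (snd z))\<bar> \<le> K"
    using eventually_prodI[OF b b] by simp
  show "\<exists>M. \<forall>\<^sub>F z in nhds p \<times>\<^sub>F nhds p. \<bar>inverse (f (fst z)) - inverse (f (snd z))\<bar> \<le> M * dist (fst z) (snd z) powr \<alpha>"
    using M fg eventually_prod_nhds_open[OF assms(1) p]
  proof (intro exI[of _ "K * K * M"], eventually_elim)
    case (elim z)
    have nz: "f (fst z) \<noteq> 0" "f (snd z) \<noteq> 0" using elim assms(3) by auto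
    define D where "D = dist (fst z) (snd z) powr \<alpha>"
    have "\<bar>inverse (f (fst z)) - inverse (f (snd z))\<bar>
        = \<bar>inverse (f (fst z))\<bar> * \<bar>inverse (f (snd z))\<bar> * \<bar>f (fst z) - f (snd z)\<bar>"
      using nz by (simp add: inverse_diff_inverse abs_mult abs_minus_commute)
    also have "\<dots> \<le> K * K * (M * D)"
      using elim \<open>K \<ge> 0\<close> by (intro mult_mono) (auto simp: D_def)
    finally show ?case by (simp add: D_def algebra_simps)
  qed
qed

lemma CK_imp_continuous_on: "open U \<Longrightarrow> CK k \<alpha> U f \<Longrightarrow> continuous_on U f"
  by (cases k) (auto simp: loc_hoelder_def continuous_on_eq_continuous_at intro: has_derivative_continuous)

lemma has_derivative_axis_expand:
  fixes f :: "real^'n \<Rightarrow> real"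
  assumes "linear f"
  shows "f h = (\<Sum>i\<in>UNIV. h $ i * f (axis i 1))"
proof -
  have "f h = f (\<Sum>i\<in>UNIV. h $ i *\<^sub>R axis i 1)"
    using basis_expansion[of h] by (simp add: scalar_mult_eq_scaleR)
  also have "\<dots> = (\<Sum>i\<in>UNIV. h $ i * f (axis i 1))"
    using assms by (simp add: linear_sum linear_scale)
  finally show ?thesis .
qed

text \<open>Near p each partial derivative is bounded by its absolute value at p plus 1. The sum of
  these bounds dominates the operator norm on a ball, and balls are convex, so the mean value
  inequality applies.\<close>

lemma continuous_derivative_loc_lipschitz:
  fixes f :: "real^'n \<Rightarrow> real"
  assumes U: "open U" and d: "\<And>x. x \<in> U \<Longrightarrow> (f has_derivative f' x) (at x)"
    and c: "\<And>i. continuous_on U (\<lambda>x. f' x (axis i 1))" and p: "p \<in> U"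
  shows "\<exists>M. \<forall>\<^sub>F z in nhds p \<times>\<^sub>F nhds p. \<bar>f (fst z) - f (snd z)\<bar> \<le> M * dist (fst z) (snd z)"
proof -
  define K where "K = (\<Sum>i\<in>UNIV. \<bar>f' p (axis i 1)\<bar> + 1)"
  have "\<forall>\<^sub>F x in nhds p. \<forall>i. \<bar>f' x (axis i 1)\<bar> \<le> \<bar>f' p (axis i 1)\<bar> + 1"
    using abs_eventually_bounded[OF c U p] by (intro eventually_all_finite) auto
  with eventually_nhds_in_open[OF U p]
  have "\<forall>\<^sub>F x in nhds p. x \<in> U \<and> (\<forall>i. \<bar>f' x (axis i 1)\<bar> \<le> \<bar>f' p (axis i 1)\<bar> + 1)"
    by eventually_elim auto
  then obtain r where r: "r > 0"
    "\<And>x. x \<in> ball p r \<Longrightarrow> x \<in> U \<and> (\<forall>i. \<bar>f' x (axis i 1)\<bar> \<le> \<bar>f' p (axis i 1)\<bar> + 1)"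
    unfolding eventually_nhds_metric by (auto simp: dist_commute)
  have on: "onorm (f' x) \<le> K" if "x \<in> ball p r" for x
  proof (rule onorm_le)
    fix h
    have lin: "linear (f' x)" using d r that has_derivative_linear by blast
    have "\<bar>f' x h\<bar> = \<bar>\<Sum>i\<in>UNIV. h $ i * f' x (axis i 1)\<bar>" 
      using has_derivative_axis_expand[OF lin, of h] by simp
    also have "\<dots> \<le> (\<Sum>i\<in>UNIV. \<bar>h $ i * f' x (axis i 1)\<bar>)" by (rule sum_abs)
    also have "\<dots> \<le> (\<Sum>i\<in>UNIV. norm h * (\<bar>f' p (axis i 1)\<bar> + 1))"
      using r(2)[OF that] by (intro sum_mono) (auto simp: abs_mult intro!: mult_mono component_le_norm_cart)
    finally show "norm (f' x h) \<le> K * norm h" by (simp add: K_def sum_distrib_left mult.commute)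
  qed
  have "\<bar>f x - f y\<bar> \<le> K * dist x y" if "x \<in> ball p r" "y \<in> ball p r" for x y
    using differentiable_bound[of "ball p r" f f' K x y] d r on that
    by (auto simp: dist_norm intro: has_derivative_at_withinI)
  then show ?thesis
    unfolding eventually_prod_nhds_metric[of "\<lambda>a b. \<bar>f a - f b\<bar> \<le> _ * dist a b"] using r(1) by blast
qed

lemma C1_imp_loc_hoelder:
  fixes f :: "real^'n \<Rightarrow> real"
  assumes U: "open U" and d: "\<And>x. x \<in> U \<Longrightarrow> (f has_derivative f' x) (at x)"
    and c: "\<And>i. continuous_on U (\<lambda>x. f' x (axis i 1))" and \<alpha>: "0 \<le> \<alpha>" "\<alpha> \<le> 1"
  shows "loc_hoelder \<alpha> U f"
  unfolding loc_hoelder_def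
proof (intro conjI ballI)
  show "continuous_on U f" using d U by (auto simp: continuous_on_eq_continuous_at intro: has_derivative_continuous)
  fix p assume p: "p \<in> U"
  obtain M where M: "\<forall>\<^sub>F z in nhds p \<times>\<^sub>F nhds p. \<bar>f (fst z) - f (snd z)\<bar> \<le> M * dist (fst z) (snd z)"
    using continuous_derivative_loc_lipschitz[OF U d c p] by blast
  have "\<forall>\<^sub>F z in nhds p \<times>\<^sub>F nhds p. fst z \<in> ball p (1/2) \<and> snd z \<in> ball p (1/2)"
    by (intro eventually_prod_nhds_open) auto
  with M have "\<forall>\<^sub>F z in nhds p \<times>\<^sub>F nhds p. \<bar>f (fst z) - f (snd z)\<bar> \<le> \<bar>M\<bar> * dist (fst z) (snd z) powr \<alpha>"
  proof eventually_elim
    case (elim z)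
    \<comment> \<open>Two points of a ball of radius 1/2 have distance d \<le> 1, and then d \<le> d
      powr \<alpha> because \<alpha> \<le> 1.\<close>
    have d1: "dist (fst z) (snd z) \<le> 1" using elim
      by (smt (verit) dist_triangle_half_l dist_commute mem_ball)
    have "dist (fst z) (snd z) \<le> dist (fst z) (snd z) powr \<alpha>"
    proof (cases "dist (fst z) (snd z) = 0")
      case False
      then have pos: "dist (fst z) (snd z) > 0" by simp
      show ?thesis using powr_mono'[OF \<alpha>(2), of "dist (fst z) (snd z)"] d1 pos by simp
    qed simp
    moreover have "\<bar>f (fst z) - f (snd z)\<bar> \<le> \<bar>M\<bar> * dist (fst z) (snd z)"
      using elim by (smt (verit) mult_right_mono zero_le_dist)
    ultimately show ?case by (smt (verit) abs_ge_zero mult_left_mono)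
  qed
  then show "\<exists>M. \<forall>\<^sub>F z in nhds p \<times>\<^sub>F nhds p. \<bar>f (fst z) - f (snd z)\<bar> \<le> M * dist (fst z) (snd z) powr \<alpha>"
    by blast
qed

text \<open>The base case carries the content: continuous partial derivatives make a function
  locally Lipschitz, hence \<alpha>-Hoelder for \<alpha> \<le> 1.\<close>

lemma CK_lower:
  fixes f :: "real^'n \<Rightarrow> real"
  assumes "open U" "0 \<le> \<alpha>" "\<alpha> \<le> 1" "CK (Suc k) \<alpha> U f"
  shows "CK k \<alpha> U f"
  using assms(4)
proof (induction k arbitrary: f)
  case 0
  then obtain f' where "\<forall>x\<in>U. (f has_derivative f' x) (at x)" "\<forall>i. loc_hoelder \<alpha> U (\<lambda>x. f' x (axis i 1))"
    by auto
  then show ?case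
    using C1_imp_loc_hoelder[of U f f' \<alpha>] assms by (auto simp: loc_hoelder_def)
next
  case (Suc k)
  then show ?case by (metis CK.simps(2))
qed

lemma CK_le:
  assumes "open U" "0 \<le> \<alpha>" "\<alpha> \<le> 1" "CK k \<alpha> U f" "j \<le> k"
  shows "CK j \<alpha> U f"
  using assms(5,4) by (induction rule: dec_induct) (use CK_lower assms in blast)+

text \<open>For \<alpha> = 0 the Hoelder estimate only says that f is locally bounded. This is why
  \<open>loc_hoelder\<close> demands continuity separately, and why \<open>CK k 0\<close> is the
  plain class of k times continuously differentiable functions.\<close>

lemma loc_hoelder_zero:
  assumes "open U" "continuous_on U f"
  shows "loc_hoelder 0 U f"
  unfolding loc_hoelder_def
proof (intro conjI ballI)
  fix p assume p: "p \<in> U"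
  note b = abs_eventually_bounded[OF assms(2,1) p]
  have fg: "\<forall>\<^sub>F z in nhds p \<times>\<^sub>F nhds p. \<bar>f (fst z)\<bar> \<le> \<bar>f p\<bar> + 1 \<and> \<bar>f (snd z)\<bar> \<le> \<bar>f p\<bar> + 1"
    using eventually_prodI[OF b b] by simp
  have "\<forall>\<^sub>F z in nhds p \<times>\<^sub>F nhds p. \<bar>f (fst z) - f (snd z)\<bar> \<le> (2 * (\<bar>f p\<bar> + 1)) * dist (fst z) (snd z) powr 0"
    using fg by eventually_elim auto
  then show "\<exists>M. \<forall>\<^sub>F z in nhds p \<times>\<^sub>F nhds p. \<bar>f (fst z) - f (snd z)\<bar> \<le> M * dist (fst z) (snd z) powr 0" ..
qed (use assms in auto)

lemma CK_weaken:
  assumes "open U" "CK k \<alpha> U f" shows "CK k 0 U f"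
  using assms(2)
proof (induction k arbitrary: f)
  case 0
  then show ?case using loc_hoelder_zero[OF assms(1)] by (auto simp: loc_hoelder_def)
qed auto

lemma has_derivative_cart_iff:
  "(g has_derivative g') (at x within S) \<longleftrightarrow> (\<forall>i. ((\<lambda>x. g x $ i) has_derivative (\<lambda>h. g' h $ i)) (at x within S))"
  for g :: "real^'m \<Rightarrow> real^'n"
proof
  assume "(g has_derivative g') (at x within S)"
  then show "\<forall>i. ((\<lambda>x. g x $ i) has_derivative (\<lambda>h. g' h $ i)) (at x within S)"
    using bounded_linear.has_derivative[OF bounded_linear_vec_nth] by blast
next
  assume a: "\<forall>i. ((\<lambda>x. g x $ i) has_derivative (\<lambda>h. g' h $ i)) (at x within S)"
  show "(g has_derivative g') (at x within S)"
    by (subst has_derivative_componentwise_within)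
      (use a in \<open>auto simp: Basis_vec_def inner_axis\<close>)
qed

section \<open>Closure of the classes under arithmetic and differentiation\<close>

context
  fixes \<alpha> :: real
  assumes \<alpha>: "0 \<le> \<alpha>" "\<alpha> \<le> 1"
begin

lemma CK_add:
  assumes "open U" "CK k \<alpha> U f" "CK k \<alpha> U g"
  shows "CK k \<alpha> U (\<lambda>x. f x + g x)"
  using assms(2,3)
proof (induction k arbitrary: f g)
  case 0
  then show ?case by (auto intro: loc_hoelder_add)
next
  case (Suc k)
  then obtain f' g' where "\<forall>x\<in>U. (f has_derivative f' x) (at x)" "\<forall>i. CK k \<alpha> U (\<lambda>x. f' x (axis i 1))"
    "\<forall>x\<in>U. (g has_derivative g' x) (at x)" "\<forall>i. CK k \<alpha> U (\<lambda>x. g' x (axis i 1))" by auto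
  then show ?case
    using Suc.IH by (intro CK_SucI[of _ _ "\<lambda>x h. f' x h + g' x h"]) (auto intro: has_derivative_add)
qed

lemma CK_mult:
  assumes "open U" "CK k \<alpha> U f" "CK k \<alpha> U g"
  shows "CK k \<alpha> U (\<lambda>x. f x * g x)"
  using assms(2,3)
proof (induction k arbitrary: f g)
  case 0
  then show ?case using assms(1) by (auto intro: loc_hoelder_mult)
next
  case (Suc k)
  then obtain f' g' where f': "\<forall>x\<in>U. (f has_derivative f' x) (at x)" "\<forall>i. CK k \<alpha> U (\<lambda>x. f' x (axis i 1))"
    and g': "\<forall>x\<in>U. (g has_derivative g' x) (at x)" "\<forall>i. CK k \<alpha> U (\<lambda>x. g' x (axis i 1))" by auto
  \<comment> \<open>The product rule multiplies partial derivatives of class k by the factors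
    themselves, so these are needed in class k as well.\<close>
  have "CK k \<alpha> U f" "CK k \<alpha> U g" using Suc.prems CK_lower \<alpha> assms(1) by blast+
  then have "CK k \<alpha> U (\<lambda>x. f x * g' x (axis i 1) + f' x (axis i 1) * g x)" for i
    using f' g' by (intro CK_add[OF assms(1)] Suc.IH) auto
  then show ?case
    by (rule CK_SucI[rotated]) (use f' g' in \<open>auto intro: has_derivative_mult\<close>)
qed

lemma CK_sum:
  assumes "open U" "finite I" "\<And>i. i \<in> I \<Longrightarrow> CK k \<alpha> U (f i)"
  shows "CK k \<alpha> U (\<lambda>x. \<Sum>i\<in>I. f i x)"
  using assms(2,3)
proof (induction I rule: finite_induct)
  case empty
  then show ?case by (simp add: CK_const)
next
  case (insert a I)
  then show ?case using CK_add[OF assms(1), of k "f a" "\<lambda>x. \<Sum>i\<in>I. f i x"] by simp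
qed

lemma CK_linear_func:
  fixes f :: "real^'n \<Rightarrow> real"
  assumes "open U" "linear f" shows "CK k \<alpha> U f"
proof -
  have d: "\<forall>x\<in>U. (f has_derivative f) (at x)" 
    using assms linear_imp_has_derivative by blast
  have "CK (Suc k) \<alpha> U f" using d CK_const by (intro CK_SucI[of _ _ "\<lambda>x. f"]) auto
  then show ?thesis using CK_lower \<alpha> assms by blast
qed

lemma CK_inverse:
  assumes "open U" "CK k \<alpha> U f" "\<And>x. x \<in> U \<Longrightarrow> f x \<noteq> 0"
  shows "CK k \<alpha> U (\<lambda>x. inverse (f x))"
  using assms(2)
proof (induction k)
  case 0
  then show ?case using assms loc_hoelder_inverse by auto
next
  case (Suc k)
  then obtain f' where f': "\<forall>x\<in>U. (f has_derivative f' x) (at x)" "\<forall>i. CK k \<alpha> U (\<lambda>x. f' x (axis i 1))" by auto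
  have IH: "CK k \<alpha> U (\<lambda>x. inverse (f x))" using Suc CK_lower \<alpha> assms(1) by blast
  have "CK k \<alpha> U (\<lambda>x. (-1) * (inverse (f x) * f' x (axis i 1) * inverse (f x)))" for i
    using IH f' assms(1) by (intro CK_mult CK_const) auto
  then have "CK k \<alpha> U (\<lambda>x. - (inverse (f x) * f' x (axis i 1) * inverse (f x)))" for i
    by simp
  then show ?case
    by (rule CK_SucI[rotated]) (use f' assms(3) in \<open>auto intro: Deriv.has_derivative_inverse\<close>)
qed

text \<open>The given derivative need not be the witness hidden in \<open>CK\<close>. Both agree on
  U by uniqueness of derivatives, and the direction h is expanded along the axes.\<close>

lemma CK_deriv:
  fixes f :: "real^'n \<Rightarrow> real"
  assumes "open U" "CK (Suc k) \<alpha> U f" "\<And>x. x \<in> U \<Longrightarrow> (f has_derivative f' x) (at x)"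
  shows "CK k \<alpha> U (\<lambda>x. f' x h)"
proof -
  obtain g' where g': "\<forall>x\<in>U. (f has_derivative g' x) (at x)" "\<forall>i. CK k \<alpha> U (\<lambda>x. g' x (axis i 1))" 
    using assms by auto
  have "CK k \<alpha> U (\<lambda>x. \<Sum>i\<in>UNIV. h $ i * g' x (axis i 1))"
    using assms g' by (intro CK_sum CK_mult CK_const) auto
  then show ?thesis
  proof (rule CK_cong[OF assms(1), rotated])
    fix x assume x: "x \<in> U"
    have "g' x = f' x" using g' assms x has_derivative_unique by blast
    then show "(\<Sum>i\<in>UNIV. h $ i * g' x (axis i 1)) = f' x h"
      using has_derivative_axis_expand[of "f' x" h] assms(3)[OF x] has_derivative_linear by metis
  qed
qed

end

section \<open>Composition, determinants and inverse maps\<close>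

declare CK.simps(2) [simp del]

text \<open>Under composition Hoelder exponents multiply. With g continuously differentiable, hence
  locally Lipschitz, distances are distorted by at most a factor K and the exponent \<alpha>
  survives.\<close>

lemma loc_hoelder_compose:
  fixes f :: "real^'n \<Rightarrow> real" and g :: "real^'m \<Rightarrow> real^'n"
  assumes U: "open U" and V: "open V" and g: "\<And>x. x \<in> U \<Longrightarrow> g x \<in> V"
    and \<alpha>: "0 \<le> \<alpha>"
    and lip: "\<And>i. CK 1 0 U (\<lambda>x. g x $ i)" and f: "loc_hoelder \<alpha> V f"
  shows "loc_hoelder \<alpha> U (\<lambda>x. f (g x))"
  unfolding loc_hoelder_def
proof (intro conjI ballI)
  have cg: "continuous_on U g"
    using continuous_on_vec_lambda[of U "\<lambda>i x. g x $ i"] CK_imp_continuous_on[OF U lip] by simp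
  show "continuous_on U (\<lambda>x. f (g x))"
    using f g by (intro continuous_on_compose2[OF _ cg]) (auto simp: loc_hoelder_def)
  fix p assume p: "p \<in> U"
  have "\<exists>L. \<forall>\<^sub>F z in nhds p \<times>\<^sub>F nhds p. \<bar>g (fst z) $ i - g (snd z) $ i\<bar> \<le> L * dist (fst z) (snd z)" for i
  proof -
    obtain h where h: "\<forall>x\<in>U. ((\<lambda>x. g x $ i) has_derivative h x) (at x)"
      "\<forall>j. loc_hoelder 0 U (\<lambda>x. h x (axis j 1))" using lip[of i] unfolding One_nat_def CK.simps by blast
    show ?thesis
      using continuous_derivative_loc_lipschitz[OF U _ _ p, of "\<lambda>x. g x $ i" h] h by (auto simp: loc_hoelder_def)
  qed
  then have "\<forall>i. \<exists>L. \<forall>\<^sub>F z in nhds p \<times>\<^sub>F nhds p. \<bar>g (fst z) $ i - g (snd z) $ i\<bar> \<le> L * dist (fst z) (snd z)" ..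
  from choice[OF this] obtain L where
    L: "\<And>i. \<forall>\<^sub>F z in nhds p \<times>\<^sub>F nhds p. \<bar>g (fst z) $ i - g (snd z) $ i\<bar> \<le> L i * dist (fst z) (snd z)"
    by blast
  define K where "K = (\<Sum>i\<in>UNIV. \<bar>L i\<bar>)"
  have "\<forall>\<^sub>F z in nhds p \<times>\<^sub>F nhds p. \<forall>i. \<bar>g (fst z) $ i - g (snd z) $ i\<bar> \<le> L i * dist (fst z) (snd z)"
    using L by (intro eventually_all_finite)
  then have gl: "\<forall>\<^sub>F z in nhds p \<times>\<^sub>F nhds p. dist (g (fst z)) (g (snd z)) \<le> K * dist (fst z) (snd z)"
  proof eventually_elim
    case (elim z)
    have "dist (g (fst z)) (g (snd z)) \<le> (\<Sum>i\<in>UNIV. \<bar>g (fst z) $ i - g (snd z) $ i\<bar>)"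
      unfolding dist_norm using norm_le_l1_cart[of "g (fst z) - g (snd z)"] by simp
    also have "\<dots> \<le> (\<Sum>i\<in>UNIV. \<bar>L i\<bar> * dist (fst z) (snd z))"
      using elim by (intro sum_mono) (smt (verit) mult_right_mono zero_le_dist)
    finally show ?case by (simp add: K_def sum_distrib_right)
  qed
  have "(g \<longlongrightarrow> g p) (nhds p)"
    using cg U p by (metis continuous_on_eq_continuous_at isCont_def tendsto_at_iff_tendsto_nhds)
  then have lim: "filterlim (\<lambda>z. (g (fst z), g (snd z))) (nhds (g p) \<times>\<^sub>F nhds (g p)) (nhds p \<times>\<^sub>F nhds p)"
    by (intro filterlim_Pair filterlim_compose[OF _ filterlim_fst] filterlim_compose[OF _ filterlim_snd])
  obtain M where M: "\<forall>\<^sub>F z in nhds (g p) \<times>\<^sub>F nhds (g p). \<bar>f (fst z) - f (snd z)\<bar> \<le> M * dist (fst z) (snd z) powr \<alpha>"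
    using f g p unfolding loc_hoelder_def by blast
  have "\<forall>\<^sub>F z in nhds p \<times>\<^sub>F nhds p. \<bar>f (g (fst z)) - f (g (snd z))\<bar> \<le> (\<bar>M\<bar> * K powr \<alpha>) * dist (fst z) (snd z) powr \<alpha>"
    using eventually_compose_filterlim[OF M lim] gl
  proof eventually_elim
    case (elim z)
    have "\<bar>f (g (fst z)) - f (g (snd z))\<bar> \<le> \<bar>M\<bar> * dist (g (fst z)) (g (snd z)) powr \<alpha>"
      using elim(1) by (simp) (smt (verit) mult_right_mono powr_ge_zero)
    also have "\<dots> \<le> \<bar>M\<bar> * (K * dist (fst z) (snd z)) powr \<alpha>"
      using elim \<alpha> by (intro mult_left_mono powr_mono2) auto
    also have "\<dots> = (\<bar>M\<bar> * K powr \<alpha>) * dist (fst z) (snd z) powr \<alpha>"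
      by (simp add: powr_mult K_def sum_nonneg)
    finally show ?case .
  qed
  then show "\<exists>M. \<forall>\<^sub>F z in nhds p \<times>\<^sub>F nhds p. \<bar>f (g (fst z)) - f (g (snd z))\<bar> \<le> M * dist (fst z) (snd z) powr \<alpha>" ..
qed

text \<open>The assumption \<open>CK 1 0\<close> on g stands beside the one in class k because for k
  = 0 the latter gives no Lipschitz bound. The chain rule leads to products of partial derivatives
  of g with composites of lower order, which the induction hypothesis covers.\<close>

lemma CK_compose:
  fixes f :: "real^'n \<Rightarrow> real" and g :: "real^'m \<Rightarrow> real^'n"
  assumes \<alpha>: "0 \<le> \<alpha>" "\<alpha> \<le> 1" and U: "open U" and V: "open V" and g: "\<And>x. x \<in> U \<Longrightarrow> g x \<in> V"
    and g1: "\<And>i. CK 1 0 U (\<lambda>x. g x $ i)" and gk: "\<And>i. CK k \<alpha> U (\<lambda>x. g x $ i)" and f: "CK k \<alpha> V f"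
  shows "CK k \<alpha> U (\<lambda>x. f (g x))"
  using gk f
proof (induction k arbitrary: f)
  case 0
  then show ?case using loc_hoelder_compose[OF U V g \<alpha>(1) g1] by simp
next
  case (Suc k)
  obtain f' where f': "\<forall>y\<in>V. (f has_derivative f' y) (at y)" "\<forall>i. CK k \<alpha> V (\<lambda>y. f' y (axis i 1))"
    using Suc.prems unfolding CK.simps(2) by blast
  have "\<forall>i. \<exists>h. (\<forall>x\<in>U. ((\<lambda>x. g x $ i) has_derivative h x) (at x)) \<and> (\<forall>j. CK k \<alpha> U (\<lambda>x. h x (axis j 1)))"
    using Suc.prems(1) unfolding CK.simps(2) by blast
  then obtain h where h: "\<And>i x. x \<in> U \<Longrightarrow> ((\<lambda>x. g x $ i) has_derivative h i x) (at x)"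
    "\<And>i j. CK k \<alpha> U (\<lambda>x. h i x (axis j 1))" by metis
  define g' where "g' x v = (\<chi> i. h i x v)" for x v
  have gd: "(g has_derivative g' x) (at x)" if "x \<in> U" for x
    using h(1)[OF that] by (subst has_derivative_cart_iff) (simp add: g'_def)
  have d: "((\<lambda>x. f (g x)) has_derivative (\<lambda>v. f' (g x) (g' x v))) (at x)" if "x \<in> U" for x
    using has_derivative_compose[OF gd[OF that], of f "f' (g x)"] f' g[OF that] by blast
  have gk': "CK k \<alpha> U (\<lambda>x. g x $ i)" for i using CK_lower[OF U \<alpha> Suc.prems(1)] .
  have "CK k \<alpha> U (\<lambda>x. f' (g x) (g' x (axis j 1)))" for j
  proof (rule CK_cong[OF U])
    show "CK k \<alpha> U (\<lambda>x. \<Sum>i\<in>UNIV. h i x (axis j 1) * f' (g x) (axis i 1))"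
      using h(2) Suc.IH[OF gk'] f'(2) by (intro CK_sum[OF \<alpha> U] CK_mult[OF \<alpha> U]) auto
    fix x assume x: "x \<in> U"
    have "linear (f' (g x))" using f' g[OF x] has_derivative_linear by blast
    from has_derivative_axis_expand[OF this, of "g' x (axis j 1)"]
    show "(\<Sum>i\<in>UNIV. h i x (axis j 1) * f' (g x) (axis i 1)) = f' (g x) (g' x (axis j 1))"
      by (simp add: g'_def)
  qed
  with d show ?case by (rule CK_SucI)
qed

lemma CK_prod:
  assumes \<alpha>: "0 \<le> \<alpha>" "\<alpha> \<le> 1" and "open U" "finite I" "\<And>i. i \<in> I \<Longrightarrow> CK k \<alpha> U (f i)"
  shows "CK k \<alpha> U (\<lambda>x. \<Prod>i\<in>I. f i x)"
  using assms(4,5)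
proof (induction I rule: finite_induct)
  case empty
  then show ?case by (simp add: CK_const)
next
  case (insert a I)
  then show ?case using CK_mult[OF \<alpha> assms(3), of k "f a" "\<lambda>x. \<Prod>i\<in>I. f i x"] by simp
qed

text \<open>Prepares Cramer's rule, which writes the entries of an inverse matrix as quotients of
  determinants.\<close>

lemma CK_det:
  fixes A :: "real^'m \<Rightarrow> real^'n^'n"
  assumes \<alpha>: "0 \<le> \<alpha>" "\<alpha> \<le> 1" and "open U" "\<And>i j. CK k \<alpha> U (\<lambda>x. A x $ i $ j)"
  shows "CK k \<alpha> U (\<lambda>x. det (A x))"
  unfolding det_def using assms
  by (intro CK_sum[OF \<alpha>] CK_mult[OF \<alpha>] CK_const CK_prod[OF \<alpha>]) (auto simp: finite_permutations)

text \<open>Bootstrapping: the partial derivatives of \<psi> are entries of the inverse Jacobian of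
  \<phi>, which are functions of class k, composed with \<psi>. Each degree of regularity gained for
  \<psi> therefore gives one more for its derivatives.\<close>

lemma CK_inverse_map:
  fixes \<phi> \<psi> :: "real^'n \<Rightarrow> real^'n"
  assumes \<alpha>: "0 \<le> \<alpha>" "\<alpha> \<le> 1" and U: "open U" and V: "open V"
    and \<psi>: "\<And>y. y \<in> V \<Longrightarrow> \<psi> y \<in> U"
    and d\<phi>: "\<And>x. x \<in> U \<Longrightarrow> (\<phi> has_derivative \<phi>' x) (at x)"
    and d\<psi>: "\<And>y. y \<in> V \<Longrightarrow> (\<psi> has_derivative \<psi>' y) (at y)"
    and inv: "\<And>y h. y \<in> V \<Longrightarrow> \<phi>' (\<psi> y) (\<psi>' y h) = h"
    and det: "\<And>x. x \<in> U \<Longrightarrow> det (matrix (\<phi>' x)) \<noteq> 0"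
    and CK: "\<And>i. CK (Suc k) \<alpha> U (\<lambda>x. \<phi> x $ i)"
  shows "CK (Suc k) \<alpha> V (\<lambda>y. \<psi> y $ i)"
proof -
  \<comment> \<open>Cramer's quotient: component l of the solution v of \<phi>' x v =
    \<open>axis i 1\<close>.\<close>
  define c where "c l i x = det (\<chi> a b. if b = l then (axis i 1 :: real^'n) $ a else matrix (\<phi>' x) $ a $ b)
     * inverse (det (matrix (\<phi>' x)))" for l i x
  have lin: "linear (\<phi>' x)" if "x \<in> U" for x using d\<phi>[OF that] has_derivative_linear by blast
  have \<psi>'c: "\<psi>' y (axis i 1) $ l = c l i (\<psi> y)" if "y \<in> V" for y l i
  proof -
    have "matrix (\<phi>' (\<psi> y)) *v \<psi>' y (axis i 1) = axis i 1"
      using inv[OF that] fun_cong[OF matrix_vector_mul(2)[OF lin[OF \<psi>[OF that]]]] by simp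
    then show ?thesis
      using cramer[OF det[OF \<psi>[OF that]], of "\<psi>' y (axis i 1)" "axis i 1"]
      by (simp add: c_def divide_inverse)
  qed
  have "CK k \<alpha> U (\<lambda>x. matrix (\<phi>' x) $ a $ b)" for a b
    unfolding matrix_def using CK_deriv[OF \<alpha> U CK, of a "\<lambda>x h. \<phi>' x h $ a" "axis b 1"] d\<phi>
    by (simp add: has_derivative_cart_iff[where g=\<phi>])
  note mat = this
  have "CK k \<alpha> U (\<lambda>x. (\<chi> a b. if b = l then (axis i 1 :: real^'n) $ a else matrix (\<phi>' x) $ a $ b) $ a $ b)" for l i a b
    by (cases "b = l") (simp_all add: CK_const mat)
  with mat have c: "CK k \<alpha> U (c l i)" for l i
    unfolding c_def using det
    by (intro CK_mult[OF \<alpha> U] CK_inverse[OF \<alpha> U] CK_det[OF \<alpha> U]) auto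
  have d\<psi>i: "\<forall>y\<in>V. ((\<lambda>y. \<psi> y $ l) has_derivative (\<lambda>h. \<psi>' y h $ l)) (at y)" for l
    using d\<psi> by (simp add: has_derivative_cart_iff[where g=\<psi>])
  have c\<psi>: "continuous_on V \<psi>"
    using d\<psi> V by (auto simp: continuous_on_eq_continuous_at intro: has_derivative_continuous)
  \<comment> \<open>Mere continuity of the partial derivatives comes first: it provides the C^1
    bound on \<psi> that the composition rules require.\<close>
  have "CK 0 0 V (\<lambda>y. \<psi>' y (axis i 1) $ l)" for i l
  proof (rule CK_cong[OF V])
    have "continuous_on V (\<lambda>y. c l i (\<psi> y))"
      using CK_imp_continuous_on[OF U c] c\<psi> \<psi> by (auto intro: continuous_on_compose2)
    then show "CK 0 0 V (\<lambda>y. c l i (\<psi> y))" using loc_hoelder_zero[OF V] by simp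
  qed (use \<psi>'c in auto)
  then have C1: "CK 1 0 V (\<lambda>y. \<psi> y $ l)" for l
    unfolding One_nat_def using d\<psi>i by (intro CK_SucI[of _ _ "\<lambda>y h. \<psi>' y h $ l"]) auto
  \<comment> \<open>The induction stops at k because the Cramer quotients are only of class
    k.\<close>
  have "m \<le> k \<Longrightarrow> \<forall>l. CK (Suc m) \<alpha> V (\<lambda>y. \<psi> y $ l)" for m
  proof (induction m)
    case 0
    have "CK 0 \<alpha> V (\<lambda>y. \<psi>' y (axis i 1) $ l)" for i l
    proof (rule CK_cong[OF V])
      show "CK 0 \<alpha> V (\<lambda>y. c l i (\<psi> y))"
        using loc_hoelder_compose[OF V U \<psi> \<alpha>(1) C1] CK_le[OF U \<alpha> c, of 0] by simp
    qed (use \<psi>'c in auto)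
    then have "CK (Suc 0) \<alpha> V (\<lambda>y. \<psi> y $ l)" for l
      using d\<psi>i by (rule_tac f' = "\<lambda>y h. \<psi>' y h $ l" in CK_SucI) blast+
    then show ?case by blast
  next
    case (Suc m)
    have "CK (Suc m) \<alpha> V (\<lambda>y. \<psi>' y (axis i 1) $ l)" for i l
    proof (rule CK_cong[OF V])
      show "CK (Suc m) \<alpha> V (\<lambda>y. c l i (\<psi> y))"
      proof (rule CK_compose[OF \<alpha> V U \<psi> C1])
        show "CK (Suc m) \<alpha> V (\<lambda>y. \<psi> y $ l)" for l using Suc by simp
        show "CK (Suc m) \<alpha> U (c l i)" using Suc.prems by (rule CK_le[OF U \<alpha> c])
      qed
    qed (use \<psi>'c in auto)
    then have "CK (Suc (Suc m)) \<alpha> V (\<lambda>y. \<psi> y $ l)" for l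
      using d\<psi>i by (rule_tac f' = "\<lambda>y h. \<psi>' y h $ l" in CK_SucI) blast+
    then show ?case by blast
  qed
  then show ?thesis by blast
qed

section \<open>Agreement with the given definitions of regularity\<close>

definition hoelder_derivs :: "nat \<Rightarrow> real \<Rightarrow> (real^'n) set \<Rightarrow> (nat \<Rightarrow> real^'n \<Rightarrow> (real^'n) list \<Rightarrow> real) \<Rightarrow> bool" where
  "hoelder_derivs k \<alpha> U D \<longleftrightarrow> (\<forall>p\<in>U. \<exists>M. \<forall>\<^sub>F z in nhds p \<times>\<^sub>F nhds p. \<forall>hs.
      length hs = k \<and> (\<forall>h\<in>set hs. norm h \<le> 1) \<longrightarrow>
        \<bar>D k (fst z) hs - D k (snd z) hs\<bar> \<le> M * dist (fst z) (snd z) powr \<alpha>)"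

text \<open>The given definition intersects balls with U. As U is open, a smaller ball lies inside
  it, and the estimate takes its filter form.\<close>

lemma Ck_alpha_on_hoelder_derivs:
  fixes U :: "(real^'n) set"
  assumes "open U"
  shows "Ck_alpha_on k \<alpha> U F \<longleftrightarrow> (\<exists>D. higher_derivs k U F D \<and> hoelder_derivs k \<alpha> U D)"
proof -
  have *: "(\<exists>r>0. \<exists>M. \<forall>x\<in>U \<inter> ball p r. \<forall>y\<in>U \<inter> ball p r. Q M x y)
     \<longleftrightarrow> (\<exists>M. \<forall>\<^sub>F z in nhds p \<times>\<^sub>F nhds p. Q M (fst z) (snd z))" if p: "p \<in> U" for p and Q :: "real \<Rightarrow> real^'n \<Rightarrow> real^'n \<Rightarrow> bool"
  proof -
    obtain e where e: "e > 0" "ball p e \<subseteq> U" using assms p openE by blast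
    have "(\<exists>r>0. \<forall>x\<in>U \<inter> ball p r. \<forall>y\<in>U \<inter> ball p r. Q M x y) \<longleftrightarrow> (\<exists>r>0. \<forall>x\<in>ball p r. \<forall>y\<in>ball p r. Q M x y)" for M
    proof
      assume "\<exists>r>0. \<forall>x\<in>U \<inter> ball p r. \<forall>y\<in>U \<inter> ball p r. Q M x y"
      then obtain r where "r > 0" "\<forall>x\<in>U \<inter> ball p r. \<forall>y\<in>U \<inter> ball p r. Q M x y" by blast
      then show "\<exists>r>0. \<forall>x\<in>ball p r. \<forall>y\<in>ball p r. Q M x y"
        using e by (intro exI[of _ "min r e"]) (auto simp: subset_iff)
    qed auto
    then show ?thesis unfolding eventually_prod_nhds_metric[of "Q _" p] by blast
  qed
  show ?thesis unfolding Ck_alpha_on_def hoelder_derivs_def using * by simp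
qed

text \<open>New directions are put at the front of the list, so the last entry is the direction of
  the first differentiation. Fixing it as v leaves a family of derivatives for the derivative of F
  along v.\<close>

lemma higher_derivs_shift:
  fixes U :: "(real^'n) set"
  assumes "higher_derivs (Suc k) U F D"
  shows "higher_derivs k U (\<lambda>x. D (Suc 0) x [v]) (\<lambda>j x hs. D (Suc j) x (hs @ [v]))"
proof -
  have h: "((\<lambda>y. D j y hs) has_derivative (\<lambda>h. D (Suc j) x (h # hs))) (at x)"
    if "j < Suc k" "length hs = j" "x \<in> U" for j hs x
    using assms that unfolding higher_derivs_def by blast
  have c: "continuous_on U (\<lambda>y. D j y hs)" if "j \<le> Suc k" "length hs = j" for j hs
    using assms that unfolding higher_derivs_def by blast
  show ?thesis
    unfolding higher_derivs_def
  proof (intro conjI allI impI ballI)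
    fix j x and hs :: "(real^'n) list" assume "j < k" "length hs = j" "x \<in> U"
    then show "((\<lambda>y. D (Suc j) y (hs @ [v])) has_derivative (\<lambda>h. D (Suc (Suc j)) x ((h # hs) @ [v]))) (at x)"
      using h[of "Suc j" "hs @ [v]" x] by simp
  next
    fix j and hs :: "(real^'n) list" assume "j \<le> k" "length hs = j"
    then show "continuous_on U (\<lambda>y. D (Suc j) y (hs @ [v]))"
      using c[of "Suc j" "hs @ [v]"] by simp
  qed simp
qed

lemma higher_derivs_imp_CK:
  assumes "higher_derivs k U F D" "hoelder_derivs k \<alpha> U D" "open U"
  shows "CK k \<alpha> U F"
  using assms(1,2)
proof (induction k arbitrary: F D)
  case 0
  have D: "\<And>x. x \<in> U \<Longrightarrow> D 0 x [] = F x" using 0 by (simp add: higher_derivs_def)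
  have "loc_hoelder \<alpha> U (\<lambda>x. D 0 x [])"
    using 0 by (auto simp: loc_hoelder_def higher_derivs_def hoelder_derivs_def)
  then show ?case using loc_hoelder_cong[OF assms(3) D] by simp
next
  case (Suc k)
  have D: "\<And>x. x \<in> U \<Longrightarrow> D 0 x [] = F x" using Suc by (simp add: higher_derivs_def)
  have "\<forall>x\<in>U. (F has_derivative (\<lambda>h. D (Suc 0) x [h])) (at x)"
  proof
    fix x assume x: "x \<in> U"
    have "((\<lambda>y. D 0 y []) has_derivative (\<lambda>h. D (Suc 0) x [h])) (at x)"
      using Suc x by (auto simp: higher_derivs_def)
    then show "(F has_derivative (\<lambda>h. D (Suc 0) x [h])) (at x)"
      by (rule has_derivative_transform_within_open[OF _ assms(3) x]) (simp add: D)
  qed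
  moreover have "CK k \<alpha> U (\<lambda>x. D (Suc 0) x [axis i 1])" for i
  proof (rule Suc.IH)
    show "higher_derivs k U (\<lambda>x. D (Suc 0) x [axis i 1]) (\<lambda>j x hs. D (Suc j) x (hs @ [axis i 1]))"
      using higher_derivs_shift[OF Suc.prems(1)] .
    show "hoelder_derivs k \<alpha> U (\<lambda>j x hs. D (Suc j) x (hs @ [axis i 1]))"
      unfolding hoelder_derivs_def
    proof
      fix p assume "p \<in> U"
      then obtain M where M: "\<forall>\<^sub>F z in nhds p \<times>\<^sub>F nhds p. \<forall>hs.
        length hs = Suc k \<and> (\<forall>h\<in>set hs. norm h \<le> 1) \<longrightarrow>
        \<bar>D (Suc k) (fst z) hs - D (Suc k) (snd z) hs\<bar> \<le> M * dist (fst z) (snd z) powr \<alpha>"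
        using Suc.prems(2) unfolding hoelder_derivs_def by blast
      then have "\<forall>\<^sub>F z in nhds p \<times>\<^sub>F nhds p. \<forall>hs.
        length hs = k \<and> (\<forall>h\<in>set hs. norm h \<le> 1) \<longrightarrow>
        \<bar>D (Suc k) (fst z) (hs @ [axis i 1]) - D (Suc k) (snd z) (hs @ [axis i 1])\<bar> \<le> M * dist (fst z) (snd z) powr \<alpha>"
        by eventually_elim (auto simp: norm_axis_1)
      then show "\<exists>M. \<forall>\<^sub>F z in nhds p \<times>\<^sub>F nhds p. \<forall>hs.
        length hs = k \<and> (\<forall>h\<in>set hs. norm h \<le> 1) \<longrightarrow>
        \<bar>D (Suc k) (fst z) (hs @ [axis i 1]) - D (Suc k) (snd z) (hs @ [axis i 1])\<bar> \<le> M * dist (fst z) (snd z) powr \<alpha>" ..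
    qed
  qed
  ultimately show ?case by (intro CK_SucI[of _ _ "\<lambda>x h. D (Suc 0) x [h]"]) auto
qed

lemma CK_imp_higher_derivs:
  fixes U :: "(real^'n) set"
  assumes "CK k \<alpha> U F" "open U"
  shows "\<exists>D. higher_derivs k U F D \<and> hoelder_derivs k \<alpha> U D"
  using assms(1)
proof (induction k arbitrary: F)
  case 0
  then show ?case
    by (intro exI[of _ "\<lambda>j x hs. F x"]) (auto simp: higher_derivs_def hoelder_derivs_def loc_hoelder_def)
next
  case (Suc k)
  obtain f' where f': "\<forall>x\<in>U. (F has_derivative f' x) (at x)" "\<forall>i. CK k \<alpha> U (\<lambda>x. f' x (axis i 1))"
    using Suc.prems unfolding CK.simps(2) by blast
  have "\<forall>i. \<exists>D. higher_derivs k U (\<lambda>x. f' x (axis i 1)) D \<and> hoelder_derivs k \<alpha> U D"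
    using Suc.IH f'(2) by blast
  then obtain E where E: "\<And>i. higher_derivs k U (\<lambda>x. f' x (axis i 1)) (E i)" "\<And>i. hoelder_derivs k \<alpha> U (E i)"
    by metis
  \<comment> \<open>The last entry of the list is the direction differentiated first: it is expanded
    along the axes, and the other entries are passed to the family \<open>E i\<close> of the i-th
    partial derivative.\<close>
  define D where "D j x hs = (case j of 0 \<Rightarrow> F x | Suc j' \<Rightarrow> \<Sum>i\<in>UNIV. last hs $ i * E i j' x (butlast hs))"
    for j and x :: "real^'n" and hs :: "(real^'n) list"
  have [simp]: "D 0 x hs = F x" "D (Suc j) x hs = (\<Sum>i\<in>UNIV. last hs $ i * E i j x (butlast hs))" for j x hs
    by (simp_all add: D_def)
  have "higher_derivs (Suc k) U F D"
    unfolding higher_derivs_def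
  proof (intro conjI allI impI ballI)
    fix j x and hs :: "(real^'n) list" assume j: "j < Suc k" "length hs = j" "x \<in> U"
    show "((\<lambda>y. D j y hs) has_derivative (\<lambda>h. D (Suc j) x (h # hs))) (at x)"
    proof (cases j)
      case 0
      have "E i 0 x [] = f' x (axis i 1)" for i using E(1) j by (auto simp: higher_derivs_def)
      moreover have "linear (f' x)" using f'(1) j has_derivative_linear by blast
      ultimately have "D (Suc j) x (h # hs) = f' x h" for h
        using 0 j has_derivative_axis_expand[of "f' x" h] by simp
      then have "(\<lambda>h. D (Suc j) x (h # hs)) = f' x" by blast
      moreover have "(\<lambda>y. D j y hs) = F" using 0 by simp
      ultimately show ?thesis using f'(1) j(3) by simp
    next
      case (Suc j')
      then have hs: "hs \<noteq> []" "length (butlast hs) = j'" "j' < k" using j by auto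
      have "((\<lambda>y. E i j' y (butlast hs)) has_derivative (\<lambda>h. E i (Suc j') x (h # butlast hs))) (at x)" for i
        using E(1)[of i] hs j(3) unfolding higher_derivs_def by blast
      then have "((\<lambda>y. \<Sum>i\<in>UNIV. last hs $ i * E i j' y (butlast hs)) has_derivative
          (\<lambda>h. \<Sum>i\<in>UNIV. last hs $ i * E i (Suc j') x (h # butlast hs))) (at x)"
        by (intro has_derivative_sum has_derivative_mult_right)
      then show ?thesis unfolding Suc using hs(1) by simp
    qed
  next
    fix j and hs :: "(real^'n) list" assume j: "j \<le> Suc k" "length hs = j"
    show "continuous_on U (\<lambda>y. D j y hs)"
    proof (cases j)
      case 0
      then show ?thesis using f' assms(2)
        by (auto simp: continuous_on_eq_continuous_at intro: has_derivative_continuous)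
    next
      case (Suc j')
      have "continuous_on U (\<lambda>y. E i j' y (butlast hs))" for i
        using E(1)[of i] j Suc unfolding higher_derivs_def by (metis Suc_le_mono diff_Suc_1 length_butlast)
      then have "continuous_on U (\<lambda>y. \<Sum>i\<in>UNIV. last hs $ i * E i j' y (butlast hs))"
        by (intro continuous_on_sum continuous_on_mult_left)
      then show ?thesis unfolding Suc by simp
    qed
  qed simp
  moreover have "hoelder_derivs (Suc k) \<alpha> U D"
    unfolding hoelder_derivs_def
  proof
    fix p assume p: "p \<in> U"
    have "\<forall>i. \<exists>M. \<forall>\<^sub>F z in nhds p \<times>\<^sub>F nhds p. \<forall>hs. length hs = k \<and> (\<forall>h\<in>set hs. norm h \<le> 1) \<longrightarrow>
        \<bar>E i k (fst z) hs - E i k (snd z) hs\<bar> \<le> M * dist (fst z) (snd z) powr \<alpha>"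
      using E(2) p unfolding hoelder_derivs_def by blast
    from choice[OF this] obtain M where M: "\<And>i. \<forall>\<^sub>F z in nhds p \<times>\<^sub>F nhds p. \<forall>hs. length hs = k \<and> (\<forall>h\<in>set hs. norm h \<le> 1) \<longrightarrow>
        \<bar>E i k (fst z) hs - E i k (snd z) hs\<bar> \<le> M i * dist (fst z) (snd z) powr \<alpha>"
      by blast
    then have "\<forall>\<^sub>F z in nhds p \<times>\<^sub>F nhds p. \<forall>i. \<forall>hs. length hs = k \<and> (\<forall>h\<in>set hs. norm h \<le> 1) \<longrightarrow>
        \<bar>E i k (fst z) hs - E i k (snd z) hs\<bar> \<le> M i * dist (fst z) (snd z) powr \<alpha>"
      by (intro eventually_all_finite)
    then have "\<forall>\<^sub>F z in nhds p \<times>\<^sub>F nhds p. \<forall>hs. length hs = Suc k \<and> (\<forall>h\<in>set hs. norm h \<le> 1) \<longrightarrow>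
        \<bar>D (Suc k) (fst z) hs - D (Suc k) (snd z) hs\<bar> \<le> (\<Sum>i\<in>UNIV. M i) * dist (fst z) (snd z) powr \<alpha>"
    proof eventually_elim
      case (elim z)
      show ?case
      proof (intro allI impI)
        fix hs :: "(real^'n) list" assume hs: "length hs = Suc k \<and> (\<forall>h\<in>set hs. norm h \<le> 1)"
        then have ne: "hs \<noteq> []" by auto
        have bl: "length (butlast hs) = k" "\<forall>h\<in>set (butlast hs). norm h \<le> 1"
          using hs by (auto dest: in_set_butlastD)
        have "norm (last hs) \<le> 1" using hs ne by simp
        \<comment> \<open>Directions in the unit ball have coordinates of absolute value at most 1,
          so the constants of the families \<open>E i\<close> simply add up.\<close>
        then have l1: "\<bar>last hs $ i\<bar> \<le> 1" for i using component_le_norm_cart[of "last hs" i] by linarith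
        have "\<bar>D (Suc k) (fst z) hs - D (Suc k) (snd z) hs\<bar>
          = \<bar>\<Sum>i\<in>UNIV. last hs $ i * (E i k (fst z) (butlast hs) - E i k (snd z) (butlast hs))\<bar>"
          by (simp add: sum_subtractf right_diff_distrib)
        also have "\<dots> \<le> (\<Sum>i\<in>UNIV. \<bar>last hs $ i\<bar> * \<bar>E i k (fst z) (butlast hs) - E i k (snd z) (butlast hs)\<bar>)"
          unfolding abs_mult[symmetric] by (rule sum_abs)
        also have "\<dots> \<le> (\<Sum>i\<in>UNIV. 1 * (M i * dist (fst z) (snd z) powr \<alpha>))"
          using elim bl l1 by (intro sum_mono mult_mono) auto
        finally show "\<bar>D (Suc k) (fst z) hs - D (Suc k) (snd z) hs\<bar> \<le> (\<Sum>i\<in>UNIV. M i) * dist (fst z) (snd z) powr \<alpha>"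
          by (simp add: sum_distrib_right)
      qed
    qed
    then show "\<exists>M. \<forall>\<^sub>F z in nhds p \<times>\<^sub>F nhds p. \<forall>hs. length hs = Suc k \<and> (\<forall>h\<in>set hs. norm h \<le> 1) \<longrightarrow>
        \<bar>D (Suc k) (fst z) hs - D (Suc k) (snd z) hs\<bar> \<le> M * dist (fst z) (snd z) powr \<alpha>" ..
  qed
  ultimately show ?case by blast
qed

theorem Ck_alpha_on_iff_CK: "open U \<Longrightarrow> Ck_alpha_on k \<alpha> U F \<longleftrightarrow> CK k \<alpha> U F"
  using Ck_alpha_on_hoelder_derivs higher_derivs_imp_CK CK_imp_higher_derivs by metis

text \<open>\<open>Ck_on\<close> carries no Hoelder bound, so only continuity of the top derivatives
  is available; the exponent 0 asks for nothing more.\<close>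

lemma higher_derivs_imp_CK_zero:
  assumes "higher_derivs k U F D" "open U"
  shows "CK k 0 U F"
  using assms(1)
proof (induction k arbitrary: F D)
  case 0
  then have "continuous_on U F"
    by (auto simp: higher_derivs_def cong: continuous_on_cong)
  then show ?case using loc_hoelder_zero[OF assms(2)] by simp
next
  case (Suc k)
  have D: "\<And>x. x \<in> U \<Longrightarrow> D 0 x [] = F x" using Suc by (simp add: higher_derivs_def)
  have "\<forall>x\<in>U. (F has_derivative (\<lambda>h. D (Suc 0) x [h])) (at x)"
  proof
    fix x assume x: "x \<in> U"
    have "((\<lambda>y. D 0 y []) has_derivative (\<lambda>h. D (Suc 0) x [h])) (at x)"
      using Suc x by (auto simp: higher_derivs_def)
    then show "(F has_derivative (\<lambda>h. D (Suc 0) x [h])) (at x)"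
      by (rule has_derivative_transform_within_open[OF _ assms(2) x]) (simp add: D)
  qed
  moreover have "CK k 0 U (\<lambda>x. D (Suc 0) x [axis i 1])" for i
  proof (rule Suc.IH)
    show "higher_derivs k U (\<lambda>x. D (Suc 0) x [axis i 1]) (\<lambda>j x hs. D (Suc j) x (hs @ [axis i 1]))"
      using higher_derivs_shift[OF Suc.prems(1)] .
  qed
  ultimately show ?case by (intro CK_SucI[of _ _ "\<lambda>x h. D (Suc 0) x [h]"]) auto
qed

theorem Ck_on_iff_CK: "open U \<Longrightarrow> Ck_on k U F \<longleftrightarrow> CK k 0 U F"
  using CK_imp_higher_derivs higher_derivs_imp_CK_zero unfolding Ck_on_def by metis

section \<open>Absolutely convergent power series\<close>

definition mon :: "('n::finite \<Rightarrow> nat) \<Rightarrow> real^'n \<Rightarrow> real" where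
  "mon a x = (\<Prod>i\<in>UNIV. x $ i ^ a i)"

definition deg :: "('n::finite \<Rightarrow> nat) \<Rightarrow> nat" where
  "deg a = (\<Sum>i\<in>UNIV. a i)"

definition cube :: "real \<Rightarrow> (real^'n) set" where
  "cube \<rho> = {x. \<forall>i. \<bar>x $ i\<bar> \<le> \<rho>}"

definition inc :: "'n \<Rightarrow> ('n \<Rightarrow> nat) \<Rightarrow> 'n \<Rightarrow> nat" where
  "inc i a = a(i := Suc (a i))"

text \<open>S is the weighted l^1 norm of the coefficients. On the closed cube every monomial is at
  most \<open>\<rho> ^ deg a\<close> in absolute value, so S dominates the series there.\<close>

definition has_ps :: "real \<Rightarrow> (('n::finite \<Rightarrow> nat) \<Rightarrow> real) \<Rightarrow> (real^'n \<Rightarrow> real) \<Rightarrow> real \<Rightarrow> bool" where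
  "has_ps \<rho> c f S \<longleftrightarrow> ((\<lambda>a. \<bar>c a\<bar> * \<rho> ^ deg a) has_sum S) UNIV \<and>
     (\<forall>x\<in>cube \<rho>. ((\<lambda>a. c a * mon a x) has_sum f x) UNIV)"

text \<open>This is membership in the ball of radius M of a Banach algebra: power series on
  \<open>cube \<rho>\<close> with the weighted l^1 norm of their coefficients. Submultiplicativity
  and completeness of this norm carry the later arguments.\<close>

definition ps_bound :: "real \<Rightarrow> (real^'n \<Rightarrow> real) \<Rightarrow> real \<Rightarrow> bool" where
  "ps_bound \<rho> f M \<longleftrightarrow> (\<exists>c S. has_ps \<rho> c f S \<and> S \<le> M)"

lemma has_psD1: "has_ps \<rho> c f S \<Longrightarrow> ((\<lambda>a. \<bar>c a\<bar> * \<rho> ^ deg a) has_sum S) UNIV"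
  unfolding has_ps_def by blast

lemma has_psD2: "has_ps \<rho> c f S \<Longrightarrow> x \<in> cube \<rho> \<Longrightarrow> ((\<lambda>a. c a * mon a x) has_sum f x) UNIV"
  unfolding has_ps_def by blast

lemma mon_inc: "mon (inc i a) x = x $ i * mon a x"
proof -
  have "mon (inc i a) x = (\<Prod>j\<in>UNIV. (if j = i then x $ i else 1) * x $ j ^ a j)"
    unfolding mon_def inc_def by (intro prod.cong) auto
  then show ?thesis by (simp add: prod.distrib mon_def)
qed

lemma deg_inc: "deg (inc i a) = Suc (deg a)"
proof -
  have "deg (inc i a) = (\<Sum>j\<in>UNIV. (if j = i then 1 else 0) + a j)"
    unfolding deg_def inc_def by (intro sum.cong) auto
  then show ?thesis by (simp add: sum.distrib deg_def)
qed

lemma deg_0 [simp]: "deg (\<lambda>_. 0) = 0" by (simp add: deg_def)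
lemma mon_0 [simp]: "mon (\<lambda>_. 0) x = 1" by (simp add: mon_def)
lemma deg_eq_0_iff: "deg a = 0 \<longleftrightarrow> a = (\<lambda>_. 0)" by (auto simp: deg_def)

lemma inj_inc: "inj (inc i)"
proof (rule injI)
  fix a b :: "'a \<Rightarrow> nat" assume "inc i a = inc i b"
  then have "inc i a j = inc i b j" for j by simp
  then show "a = b" by (intro ext) (metis fun_upd_apply inc_def nat.inject)
qed

lemma inc_pred: "a i \<noteq> 0 \<Longrightarrow> inc i (a(i := a i - 1)) = a"
  by (auto simp: inc_def)

text \<open>Every nonzero multi-index arises by \<open>inc\<close> from one of smaller degree, so
  statements about monomials follow by multiplying with one coordinate at a time.\<close>

lemma multiindex_induct:
  fixes a :: "'n::finite \<Rightarrow> nat"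
  assumes "P (\<lambda>_. 0)" "\<And>a i. P a \<Longrightarrow> P (inc i a)"
  shows "P a"
proof (induction "deg a" arbitrary: a)
  case 0
  then have "a = (\<lambda>_. 0)" by (simp flip: deg_eq_0_iff)
  then show ?case using assms(1) by simp
next
  case (Suc n)
  then obtain i where "a i \<noteq> 0" unfolding deg_def by (metis sum.neutral nat.distinct(1))
  then have e: "inc i (a(i := a i - 1)) = a" by (rule inc_pred)
  then have "deg (a(i := a i - 1)) = n" using Suc(2) deg_inc[of i "a(i := a i - 1)"] by simp
  from assms(2)[OF Suc(1)[OF this[symmetric]], of i] show ?case unfolding e .
qed

lemma mon_abs_le: "x \<in> cube \<rho> \<Longrightarrow> \<bar>mon a x\<bar> \<le> \<rho> ^ deg a"
  unfolding mon_def deg_def cube_def by (auto simp: power_sum abs_prod power_abs intro!: prod_mono power_mono)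

lemma abs_has_sum_le:
  fixes f g :: "'a \<Rightarrow> real"
  assumes "(f has_sum a) A" "(g has_sum b) A" "\<And>x. x \<in> A \<Longrightarrow> \<bar>f x\<bar> \<le> g x"
  shows "\<bar>a\<bar> \<le> b"
proof -
  have "a \<le> b" by (rule has_sum_mono[OF assms(1,2)]) (use assms(3) in force)
  moreover have "- a \<le> b"
    by (rule has_sum_mono[where f = "\<lambda>x. - f x" and A = A]) (use assms in \<open>force simp: has_sum_uminus\<close>)+
  ultimately show ?thesis by simp
qed

lemma has_psD_abs: "has_ps \<rho> c f S \<Longrightarrow> x \<in> cube \<rho> \<Longrightarrow> \<bar>f x\<bar> \<le> S"
  unfolding has_ps_def
  by (rule abs_has_sum_le[where f = "\<lambda>a. c a * mon a x" and A = UNIV and g = "\<lambda>a. \<bar>c a\<bar> * \<rho> ^ deg a"])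
     (auto simp: abs_mult intro!: mult_left_mono mon_abs_le)

lemma ps_bound_abs: "ps_bound \<rho> f M \<Longrightarrow> x \<in> cube \<rho> \<Longrightarrow> \<bar>f x\<bar> \<le> M"
  unfolding ps_bound_def using has_psD_abs by fastforce

lemma has_ps_nonneg: "has_ps \<rho> c f S \<Longrightarrow> 0 \<le> \<rho> \<Longrightarrow> 0 \<le> S"
  unfolding has_ps_def by (auto intro: has_sum_nonneg)

lemma ps_bound_nonneg: "ps_bound \<rho> f M \<Longrightarrow> 0 \<le> \<rho> \<Longrightarrow> 0 \<le> M"
  unfolding ps_bound_def using has_ps_nonneg by fastforce

lemma ps_bound_mono: "ps_bound \<rho> f M \<Longrightarrow> M \<le> N \<Longrightarrow> ps_bound \<rho> f N"
  unfolding ps_bound_def by (blast intro: order_trans)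

lemma ps_bound_cong: "(\<And>x. x \<in> cube \<rho> \<Longrightarrow> f x = g x) \<Longrightarrow> ps_bound \<rho> f M \<Longrightarrow> ps_bound \<rho> g M"
  unfolding ps_bound_def has_ps_def by auto

lemma has_ps_summable:
  fixes c :: "('n::finite \<Rightarrow> nat) \<Rightarrow> real"
  assumes "(\<lambda>a. \<bar>c a\<bar> * \<rho> ^ deg a) summable_on UNIV"
  shows "has_ps \<rho> c (\<lambda>x. \<Sum>\<^sub>\<infinity>a. c a * mon a x) (\<Sum>\<^sub>\<infinity>a. \<bar>c a\<bar> * \<rho> ^ deg a)"
  unfolding has_ps_def
proof (intro conjI ballI)
  fix x :: "real^'n" assume x: "x \<in> cube \<rho>"
  have "(\<lambda>a. norm (c a * mon a x)) summable_on UNIV"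
    by (rule Infinite_Sum.abs_summable_on_comparison_test'[OF assms])
      (use mon_abs_le[OF x] in \<open>auto simp: abs_mult intro!: mult_left_mono\<close>)
  then show "((\<lambda>a. c a * mon a x) has_sum (\<Sum>\<^sub>\<infinity>a. c a * mon a x)) UNIV"
    by (rule has_sum_infsum[OF Infinite_Sum.abs_summable_summable])
qed (use assms in auto)

text \<open>Completeness of the norm, in the form from which sums, products, composites, geometric
  series and limits of iterations are derived. The coefficients are summed over j, and absolute
  convergence of the double family allows the order of summation to be exchanged.\<close>

lemma ps_bound_has_sum:
  fixes f :: "'j \<Rightarrow> real^'n \<Rightarrow> real"
  assumes \<rho>: "\<rho> > 0" and f: "\<And>j. ps_bound \<rho> (f j) (M j)" and M: "(M has_sum T) UNIV"
    and F: "\<And>x. x \<in> cube \<rho> \<Longrightarrow> ((\<lambda>j. f j x) has_sum F x) UNIV"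
  shows "ps_bound \<rho> F T"
proof -
  have "\<forall>j. \<exists>c. \<exists>S. has_ps \<rho> c (f j) S \<and> S \<le> M j"
    using f unfolding ps_bound_def by blast
  from choice[OF this] obtain c where "\<forall>j. \<exists>S. has_ps \<rho> (c j) (f j) S \<and> S \<le> M j" by blast
  from choice[OF this] obtain S where cS: "\<And>j. has_ps \<rho> (c j) (f j) (S j)" "\<And>j. S j \<le> M j" by blast
  define N where "N j a = \<bar>c j a\<bar> * \<rho> ^ deg a" for j a
  have N0: "N j a \<ge> 0" for j a using \<rho> by (simp add: N_def)
  have NS: "(N j has_sum S j) UNIV" for j using cS(1)[of j] unfolding has_ps_def N_def by blast
  have S0: "S j \<ge> 0" for j using has_ps_nonneg[OF cS(1)] \<rho> by simp
  have Ms: "M summable_on UNIV" using M summable_on_def by blast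
  have Ss: "S summable_on UNIV" by (rule summable_on_comparison_test[OF Ms]) (use cS S0 in auto)
  have Nsum: "(\<lambda>(j,a). N j a) summable_on UNIV \<times> UNIV"
    by (rule summable_on_SigmaI[where g = S]) (use NS Ss N0 in auto)
  then have Nsum': "(\<lambda>(a,j). N j a) summable_on UNIV \<times> UNIV"
    by (subst summable_on_swap) simp
  have rows: "(\<lambda>j. N j a) summable_on UNIV" for a
    using summable_on_SigmaD1[OF Nsum', of a] by simp
  define S' where "S' a = (\<Sum>\<^sub>\<infinity>j. N j a)" for a
  have S'sum: "S' summable_on UNIV"
    unfolding S'_def using summable_on_Sigma_banach[OF Nsum'] by simp
  define C where "C a = (\<Sum>\<^sub>\<infinity>j. c j a)" for a
  have cs: "(\<lambda>j. norm (c j a)) summable_on UNIV" for a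
  proof -
    have "(\<lambda>j. N j a * inverse (\<rho> ^ deg a)) summable_on UNIV" using rows by (rule summable_on_cmult_left)
    moreover have "N j a * inverse (\<rho> ^ deg a) = norm (c j a)" for j using \<rho> by (simp add: N_def)
    ultimately show ?thesis by simp
  qed
  have C: "\<bar>C a\<bar> * \<rho> ^ deg a \<le> S' a" for a
  proof -
    have "\<bar>C a\<bar> \<le> (\<Sum>\<^sub>\<infinity>j. \<bar>c j a\<bar>)" unfolding C_def using norm_infsum_bound[OF cs] by simp
    then have "\<bar>C a\<bar> * \<rho> ^ deg a \<le> (\<Sum>\<^sub>\<infinity>j. \<bar>c j a\<bar>) * \<rho> ^ deg a" using \<rho> by (intro mult_right_mono) auto
    also have "\<dots> = S' a" unfolding S'_def N_def using cs by (subst infsum_cmult_left) auto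
    finally show ?thesis .
  qed
  have Csum: "(\<lambda>a. \<bar>C a\<bar> * \<rho> ^ deg a) summable_on UNIV"
    by (rule summable_on_comparison_test[OF S'sum]) (use C \<rho> in auto)
  have "(\<Sum>\<^sub>\<infinity>a. \<bar>C a\<bar> * \<rho> ^ deg a) \<le> (\<Sum>\<^sub>\<infinity>a. S' a)"
    by (rule infsum_mono[OF Csum S'sum]) (use C in auto)
  also have "\<dots> = (\<Sum>\<^sub>\<infinity>j. \<Sum>\<^sub>\<infinity>a. N j a)"
    unfolding S'_def using infsum_swap_banach[OF Nsum] by simp
  also have "\<dots> = (\<Sum>\<^sub>\<infinity>j. S j)" using NS infsumI by (intro infsum_cong) blast
  also have "\<dots> \<le> (\<Sum>\<^sub>\<infinity>j. M j)" by (rule infsum_mono[OF Ss Ms]) (use cS in auto)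
  also have "\<dots> = T" using M infsumI by blast
  finally have le: "(\<Sum>\<^sub>\<infinity>a. \<bar>C a\<bar> * \<rho> ^ deg a) \<le> T" .
  have "(\<Sum>\<^sub>\<infinity>a. C a * mon a x) = F x" if x: "x \<in> cube \<rho>" for x
  proof -
    \<comment> \<open>On the cube this family is dominated by \<open>N\<close>, whose double sum is
      finite.\<close>
    have "(\<lambda>ja. norm (case ja of (j,a) \<Rightarrow> c j a * mon a x)) summable_on UNIV \<times> UNIV"
      by (rule Infinite_Sum.abs_summable_on_comparison_test'[OF Nsum])
        (use mon_abs_le[OF x] in \<open>auto simp: abs_mult N_def intro!: mult_left_mono\<close>)
    then have G: "(\<lambda>(j,a). c j a * mon a x) summable_on UNIV \<times> UNIV" by (rule Infinite_Sum.abs_summable_summable)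
    have "(\<Sum>\<^sub>\<infinity>a. C a * mon a x) = (\<Sum>\<^sub>\<infinity>a. \<Sum>\<^sub>\<infinity>j. c j a * mon a x)"
      unfolding C_def by (intro infsum_cong infsum_cmult_left[symmetric] Infinite_Sum.abs_summable_summable[OF cs])
    also have "\<dots> = (\<Sum>\<^sub>\<infinity>j. \<Sum>\<^sub>\<infinity>a. c j a * mon a x)"
      using infsum_swap_banach[OF G] by simp
    also have "\<dots> = (\<Sum>\<^sub>\<infinity>j. f j x)"
      by (intro infsum_cong infsumI has_psD2[OF cS(1) x])
    also have "\<dots> = F x" using F[OF x] infsumI by blast
    finally show ?thesis .
  qed
  moreover have "ps_bound \<rho> (\<lambda>x. \<Sum>\<^sub>\<infinity>a. C a * mon a x) T"
    unfolding ps_bound_def by (intro exI conjI, rule has_ps_summable[OF Csum], rule le)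
  ultimately show ?thesis by (rule ps_bound_cong)
qed

lemma ps_bound_const: "ps_bound \<rho> (\<lambda>x. k) \<bar>k\<bar>"
proof -
  define c :: "('a \<Rightarrow> nat) \<Rightarrow> real" where "c a = (if a = (\<lambda>_. 0) then k else 0)" for a
  have "((\<lambda>a. c a * mon a x) has_sum k) UNIV" for x
    by (rule has_sum_finite_neutralI[of "{\<lambda>_. 0}"]) (auto simp: c_def)
  moreover have "((\<lambda>a. \<bar>c a\<bar> * \<rho> ^ deg a) has_sum \<bar>k\<bar>) UNIV"
    by (rule has_sum_finite_neutralI[of "{\<lambda>_. 0}"]) (auto simp: c_def)
  ultimately show ?thesis
    unfolding ps_bound_def has_ps_def by (intro exI[of _ c] exI[of _ "\<bar>k\<bar>"]) simp
qed

lemma ps_bound_cmult: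
  assumes "ps_bound \<rho> f M" shows "ps_bound \<rho> (\<lambda>x. k * f x) (\<bar>k\<bar> * M)"
proof -
  obtain c S where c: "has_ps \<rho> c f S" "S \<le> M" using assms unfolding ps_bound_def by blast
  have "has_ps \<rho> (\<lambda>a. k * c a) (\<lambda>x. k * f x) (\<bar>k\<bar> * S)"
    using c(1) unfolding has_ps_def
    by (auto simp: abs_mult mult.assoc intro!: has_sum_cmult_right)
  moreover have "\<bar>k\<bar> * S \<le> \<bar>k\<bar> * M" using c(2) by (intro mult_left_mono) auto
  ultimately show ?thesis unfolding ps_bound_def by blast
qed

text \<open>Two summands form a family indexed by \<open>bool\<close>, so this is an instance of
  \<open>ps_bound_has_sum\<close>.\<close>

lemma ps_bound_add:
  assumes "\<rho> > 0" "ps_bound \<rho> f M" "ps_bound \<rho> g N"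
  shows "ps_bound \<rho> (\<lambda>x. f x + g x) (M + N)"
proof (rule ps_bound_has_sum[OF assms(1)])
  show "ps_bound \<rho> (if b then f else g) (if b then M else N)" for b using assms by auto
  show "((\<lambda>b. if b then M else N) has_sum M + N) UNIV"
    by (rule has_sum_finiteI) (auto simp: UNIV_bool)
  show "((\<lambda>b. (if b then f else g) x) has_sum f x + g x) UNIV" for x
    by (rule has_sum_finiteI) (auto simp: UNIV_bool)
qed

lemma ps_bound_minus:
  assumes "\<rho> > 0" "ps_bound \<rho> f M" "ps_bound \<rho> g N"
  shows "ps_bound \<rho> (\<lambda>x. f x - g x) (M + N)"
  using ps_bound_add[OF assms(1,2) ps_bound_cmult[OF assms(3), of "-1"]] by simp

lemma ps_bound_times_coord:
  assumes "ps_bound \<rho> f M" "\<rho> > 0"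
  shows "ps_bound \<rho> (\<lambda>x. x $ i * f x) (\<rho> * M)"
proof -
  obtain c S where c: "has_ps \<rho> c f S" "S \<le> M" using assms unfolding ps_bound_def by blast
  \<comment> \<open>Multiplication by the i-th coordinate shifts multi-indices by
    \<open>inc i\<close>; those with exponent 0 at i are not reached.\<close>
  define c' where "c' a = (if a i = 0 then 0 else c (a(i := a i - 1)))" for a
  have c'i: "c' (inc i a) = c a" for a by (simp add: c'_def inc_def)
  have r: "a \<in> range (inc i)" if "a i \<noteq> 0" for a using inc_pred[of a i] that by (metis rangeI)
  have shift: "(g has_sum s) UNIV" if "((\<lambda>a. g (inc i a)) has_sum s) UNIV" "\<And>a. a i = 0 \<Longrightarrow> g a = 0" for g :: "_ \<Rightarrow> real" and s
  proof -
    have "(g has_sum s) (range (inc i))" using that(1) by (subst has_sum_reindex[OF inj_inc]) (simp add: o_def)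
    then show ?thesis using that(2) r by (subst has_sum_cong_neutral[of "range (inc i)" UNIV g g]) auto
  qed
  have "((\<lambda>a. \<rho> * (\<bar>c a\<bar> * \<rho> ^ deg a)) has_sum \<rho> * S) UNIV"
    by (rule has_sum_cmult_right[OF has_psD1[OF c(1)]])
  then have "((\<lambda>a. \<bar>c' (inc i a)\<bar> * \<rho> ^ deg (inc i a)) has_sum \<rho> * S) UNIV"
    by (simp add: c'i deg_inc mult_ac)
  then have 1: "((\<lambda>a. \<bar>c' a\<bar> * \<rho> ^ deg a) has_sum \<rho> * S) UNIV"
    by (rule shift) (simp add: c'_def)
  have 2: "((\<lambda>a. c' a * mon a x) has_sum x $ i * f x) UNIV" if x: "x \<in> cube \<rho>" for x
  proof (rule shift)
    have "((\<lambda>a. x $ i * (c a * mon a x)) has_sum x $ i * f x) UNIV"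
      by (rule has_sum_cmult_right[OF has_psD2[OF c(1) x]])
    then show "((\<lambda>a. c' (inc i a) * mon (inc i a) x) has_sum x $ i * f x) UNIV"
      by (simp add: c'i mon_inc mult_ac)
  qed (simp add: c'_def)
  from 1 2 have "has_ps \<rho> c' (\<lambda>x. x $ i * f x) (\<rho> * S)" unfolding has_ps_def by blast
  moreover have "\<rho> * S \<le> \<rho> * M" using c(2) assms by simp
  ultimately show ?thesis unfolding ps_bound_def by blast
qed

lemma ps_bound_coord: "\<rho> > 0 \<Longrightarrow> ps_bound \<rho> (\<lambda>x. x $ i) \<rho>"
  using ps_bound_times_coord[OF ps_bound_const[of \<rho> 1], of i] by simp

lemma ps_bound_times_mon:
  assumes "ps_bound \<rho> f M" "\<rho> > 0"
  shows "ps_bound \<rho> (\<lambda>x. mon a x * f x) (\<rho> ^ deg a * M)"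
proof (induction a rule: multiindex_induct)
  case 1
  then show ?case using assms by simp
next
  case (2 a i)
  show ?case using ps_bound_times_coord[OF 2 assms(2), of i] by (simp add: mon_inc deg_inc mult_ac)
qed

text \<open>Only f is expanded. Its term of index a times g has norm at most
  \<open>\<bar>c a\<bar> * \<rho> ^ deg a * N\<close>, and these bounds sum to the product of the
  norms.\<close>

lemma ps_bound_mult:
  fixes f g :: "real^'n \<Rightarrow> real"
  assumes "ps_bound \<rho> f M" "ps_bound \<rho> g N" "\<rho> > 0"
  shows "ps_bound \<rho> (\<lambda>x. f x * g x) (M * N)"
proof -
  obtain c S where c: "has_ps \<rho> c f S" "S \<le> M" using assms unfolding ps_bound_def by blast
  have "ps_bound \<rho> (\<lambda>x. f x * g x) (S * N)"
  proof (rule ps_bound_has_sum[OF assms(3)])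
    show "ps_bound \<rho> (\<lambda>x. c a * (mon a x * g x)) (\<bar>c a\<bar> * (\<rho> ^ deg a * N))" for a
      by (intro ps_bound_cmult ps_bound_times_mon assms)
    have "((\<lambda>a. \<bar>c a\<bar> * \<rho> ^ deg a * N) has_sum S * N) UNIV"
      by (rule has_sum_cmult_left[OF has_psD1[OF c(1)]])
    then show "((\<lambda>a. \<bar>c a\<bar> * (\<rho> ^ deg a * N)) has_sum S * N) UNIV" by (simp add: mult.assoc)
    fix x :: "real^'n" assume x: "x \<in> cube \<rho>"
    have "((\<lambda>a. c a * mon a x * g x) has_sum f x * g x) UNIV"
      by (rule has_sum_cmult_left[OF has_psD2[OF c(1) x]])
    then show "((\<lambda>a. c a * (mon a x * g x)) has_sum f x * g x) UNIV" by (simp add: mult.assoc)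
  qed
  moreover have "S * N \<le> M * N" using c(2) ps_bound_nonneg[OF assms(2)] assms(3) by (intro mult_right_mono) auto
  ultimately show ?thesis by (rule ps_bound_mono)
qed

lemma ps_bound_mon_compose:
  fixes g :: "real^'m \<Rightarrow> real^'n"
  assumes "\<rho> > 0" "\<And>i. ps_bound \<rho> (\<lambda>x. g x $ i) \<sigma>"
  shows "ps_bound \<rho> (\<lambda>x. mon a (g x)) (\<sigma> ^ deg a)"
proof (induction a rule: multiindex_induct)
  case 1
  then show ?case using ps_bound_const[of \<rho> 1] by simp
next
  case (2 a i)
  show ?case using ps_bound_mult[OF assms(2)[of i] 2 assms(1)] by (simp add: mon_inc deg_inc)
qed

text \<open>The norms of the components of g, not only their values, are at most \<sigma>. Hence a
  monomial of index a composed with g has norm at most \<open>\<sigma> ^ deg a\<close>, and g may be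
  substituted into f term by term.\<close>

lemma ps_bound_compose:
  fixes g :: "real^'m \<Rightarrow> real^'n"
  assumes \<rho>: "\<rho> > 0" and g: "\<And>i. ps_bound \<rho> (\<lambda>x. g x $ i) \<sigma>" and f: "ps_bound \<sigma> f M"
  shows "ps_bound \<rho> (\<lambda>x. f (g x)) M"
proof -
  obtain c S where c: "has_ps \<sigma> c f S" "S \<le> M" using f unfolding ps_bound_def by blast
  have "ps_bound \<rho> (\<lambda>x. f (g x)) S"
  proof (rule ps_bound_has_sum[OF \<rho>])
    show "ps_bound \<rho> (\<lambda>x. c a * mon a (g x)) (\<bar>c a\<bar> * \<sigma> ^ deg a)" for a
      by (intro ps_bound_cmult ps_bound_mon_compose \<rho> g)
    show "((\<lambda>a. \<bar>c a\<bar> * \<sigma> ^ deg a) has_sum S) UNIV" using c unfolding has_ps_def by blast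
    fix x :: "real^'m" assume x: "x \<in> cube \<rho>"
    have "g x \<in> cube \<sigma>" unfolding cube_def using ps_bound_abs[OF g x] by blast
    then show "((\<lambda>a. c a * mon a (g x)) has_sum f (g x)) UNIV" using c unfolding has_ps_def by blast
  qed
  then show ?thesis using c(2) ps_bound_mono by blast
qed

text \<open>Analogue of |x^n - y^n| \<le> n s^(n-1) |x - y|, splitting off one factor at a time. In
  degree 0 the truncated exponent is harmless because the factor \<open>deg a\<close>
  vanishes.\<close>

lemma ps_bound_mon_diff:
  fixes g h :: "real^'m \<Rightarrow> real^'n"
  assumes \<rho>: "\<rho> > 0" and g: "\<And>i. ps_bound \<rho> (\<lambda>x. g x $ i) s" and h: "\<And>i. ps_bound \<rho> (\<lambda>x. h x $ i) s"
    and gh: "\<And>i. ps_bound \<rho> (\<lambda>x. g x $ i - h x $ i) d"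
  shows "ps_bound \<rho> (\<lambda>x. mon a (g x) - mon a (h x)) (real (deg a) * s ^ (deg a - 1) * d)"
proof (induction a rule: multiindex_induct)
  case 1
  then show ?case using ps_bound_const[of \<rho> 0] by simp
next
  case (2 a i)
  have e: "mon (inc i a) (g x) - mon (inc i a) (h x)
      = (g x $ i - h x $ i) * mon a (g x) + h x $ i * (mon a (g x) - mon a (h x))" for x
    by (simp add: mon_inc algebra_simps)
  have "ps_bound \<rho> (\<lambda>x. mon (inc i a) (g x) - mon (inc i a) (h x))
      (d * s ^ deg a + s * (real (deg a) * s ^ (deg a - 1) * d))"
    unfolding e by (intro ps_bound_add ps_bound_mult ps_bound_mon_compose \<rho> g h gh 2)
  moreover have "d * s ^ deg a + s * (real (deg a) * s ^ (deg a - 1) * d) = real (deg (inc i a)) * s ^ (deg (inc i a) - 1) * d"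
    by (cases "deg a") (auto simp: deg_inc algebra_simps)
  ultimately show ?case by simp
qed

lemma cube_mono: "\<rho> \<le> \<sigma> \<Longrightarrow> cube \<rho> \<subseteq> cube \<sigma>"
  unfolding cube_def by (auto intro: order_trans)

text \<open>If all terms of degree below m vanish, every remaining term gains at least the factor
  \<theta>^m when the radius is multiplied by \<theta>. The case m = 0 restricts a series, m = 1
  makes a function vanishing at 0 small, and m = 2 bounds a Taylor remainder.\<close>

lemma has_ps_shrink:
  assumes c: "has_ps \<rho> c f S" and c0: "\<And>a. deg a < m \<Longrightarrow> c a = 0" and \<theta>: "0 \<le> \<theta>" "\<theta> \<le> 1" and \<rho>: "\<rho> > 0"
  shows "ps_bound (\<theta> * \<rho>) f (\<theta> ^ m * S)"
proof -
  have s: "((\<lambda>a. \<theta> ^ m * (\<bar>c a\<bar> * \<rho> ^ deg a)) has_sum \<theta> ^ m * S) UNIV"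
    by (rule has_sum_cmult_right[OF has_psD1[OF c]])
  have le: "\<bar>c a\<bar> * (\<theta> * \<rho>) ^ deg a \<le> \<theta> ^ m * (\<bar>c a\<bar> * \<rho> ^ deg a)" for a
  proof (cases "deg a < m")
    case False
    then have "\<theta> ^ deg a \<le> \<theta> ^ m" using \<theta> by (intro power_decreasing) auto
    then have "\<theta> ^ deg a * (\<bar>c a\<bar> * \<rho> ^ deg a) \<le> \<theta> ^ m * (\<bar>c a\<bar> * \<rho> ^ deg a)"
      using \<rho> by (intro mult_right_mono) auto
    then show ?thesis by (simp add: power_mult_distrib mult_ac)
  qed (use c0 in simp)
  have sm: "(\<lambda>a. \<bar>c a\<bar> * (\<theta> * \<rho>) ^ deg a) summable_on UNIV"
    by (rule summable_on_comparison_test[OF _ le]) (use s \<theta> \<rho> summable_on_def in auto)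
  have "\<theta> * \<rho> \<le> \<rho>" using \<theta> \<rho> by (simp add: mult_left_le_one_le)
  then have "has_ps (\<theta> * \<rho>) c f (\<Sum>\<^sub>\<infinity>a. \<bar>c a\<bar> * (\<theta> * \<rho>) ^ deg a)"
    unfolding has_ps_def using sm c cube_mono by (fastforce simp: has_ps_def)
  moreover have "(\<Sum>\<^sub>\<infinity>a. \<bar>c a\<bar> * (\<theta> * \<rho>) ^ deg a) \<le> \<theta> ^ m * S"
    by (rule has_sum_mono[OF has_sum_infsum[OF sm] s]) (use le in auto)
  ultimately show ?thesis unfolding ps_bound_def by blast
qed

lemma ps_bound_shrink:
  assumes "ps_bound \<rho> f M" "0 < \<sigma>" "\<sigma> \<le> \<rho>"
  shows "ps_bound \<sigma> f M"
proof -
  obtain c S where c: "has_ps \<rho> c f S" "S \<le> M" using assms unfolding ps_bound_def by blast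
  have "ps_bound ((\<sigma>/\<rho>) * \<rho>) f ((\<sigma>/\<rho>) ^ 0 * S)"
    by (rule has_ps_shrink[OF c(1)]) (use assms in auto)
  then show ?thesis using assms c(2) ps_bound_mono by (simp add: ps_bound_mono)
qed

lemma zero_in_cube: "\<rho> \<ge> 0 \<Longrightarrow> 0 \<in> cube \<rho>"
  by (simp add: cube_def)

lemma mon_at_0: "mon a 0 = (if a = (\<lambda>_. 0) then 1 else 0)"
proof (cases "a = (\<lambda>_. 0)")
  case False
  then obtain i where "a i \<noteq> 0" by auto
  then show ?thesis using False mon_inc[of i "a(i := a i - 1)" 0] inc_pred[of a i] by simp
qed simp

lemma has_ps_at_0:
  assumes "has_ps \<rho> c f S" "\<rho> \<ge> 0" shows "f 0 = c (\<lambda>_. 0)"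
proof -
  have "((\<lambda>a. c a * mon a 0) has_sum c (\<lambda>_. 0)) UNIV"
    by (rule has_sum_finite_neutralI[of "{\<lambda>_. 0}"]) (auto simp: mon_at_0)
  then show ?thesis using assms zero_in_cube[of \<rho>] has_sum_unique unfolding has_ps_def by blast
qed

lemma ps_bound_shrink_zero:
  assumes "ps_bound \<rho> f M" "f 0 = 0" "\<rho> > 0" "0 \<le> \<theta>" "\<theta> \<le> 1"
  shows "ps_bound (\<theta> * \<rho>) f (\<theta> * M)"
proof -
  obtain c S where c: "has_ps \<rho> c f S" "S \<le> M" using assms unfolding ps_bound_def by blast
  have "c a = 0" if "deg a < 1" for a
    using that has_ps_at_0[OF c(1)] assms deg_eq_0_iff[of a] by simp
  then have "ps_bound (\<theta> * \<rho>) f (\<theta> ^ 1 * S)" by (rule has_ps_shrink[OF c(1)]) (use assms in auto)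
  then show ?thesis using ps_bound_mono[of _ f "\<theta> * S" "\<theta> * M"] c(2) assms by (simp add: mult_left_mono)
qed

lemma cube_norm_less:
  assumes "e > 0" obtains \<sigma> where "\<sigma> > 0" "\<And>x::real^'n. x \<in> cube \<sigma> \<Longrightarrow> norm x < e"
proof
  \<comment> \<open>The l^1 norm dominates the Euclidean norm and is at most e / 2 here, which
    leaves room for the strict inequality.\<close>
  let ?\<sigma> = "e / (2 * real CARD('n))"
  show "?\<sigma> > 0" using assms by simp
  fix x :: "real^'n" assume "x \<in> cube ?\<sigma>"
  then have "(\<Sum>i\<in>UNIV. \<bar>x $ i\<bar>) \<le> (\<Sum>i\<in>(UNIV::'n set). ?\<sigma>)" by (intro sum_mono) (auto simp: cube_def)
  also have "\<dots> = e / 2" by simp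
  finally show "norm x < e" using norm_le_l1_cart[of x] assms by simp
qed

lemma norm_in_cube: "norm x \<le> \<rho> \<Longrightarrow> x \<in> cube \<rho>"
  unfolding cube_def using component_le_norm_cart order_trans by blast

section \<open>Real analytic functions\<close>

definition analytic_at :: "(real^'n \<Rightarrow> real) \<Rightarrow> real^'n \<Rightarrow> bool" where
  "analytic_at f p \<longleftrightarrow> (\<exists>\<rho>>0. \<exists>M. ps_bound \<rho> (\<lambda>h. f (p + h)) M)"

lemma analytic_atI: "\<rho> > 0 \<Longrightarrow> ps_bound \<rho> (\<lambda>h. f (p + h)) M \<Longrightarrow> analytic_at f p"
  unfolding analytic_at_def by blast

lemma analytic_atE:
  assumes "analytic_at f p" obtains \<rho> c S where "\<rho> > 0" "has_ps \<rho> c (\<lambda>h. f (p + h)) S"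
  using assms unfolding analytic_at_def ps_bound_def by (elim exE conjE) (rule that)

lemma ps_boundI: "has_ps \<rho> c f S \<Longrightarrow> S \<le> M \<Longrightarrow> ps_bound \<rho> f M"
  unfolding ps_bound_def by blast

text \<open>Unconditional convergence of a real family is absolute convergence. At the corner
  (\<sigma>, ..., \<sigma>) of a small cube inside the ball this is the majorant sum for the whole
  cube.\<close>

lemma real_analytic_on_iff_analytic_at:
  fixes U :: "(real^'n) set"
  assumes "open U"
  shows "real_analytic_on U f \<longleftrightarrow> (\<forall>p\<in>U. analytic_at f p)"
proof
  assume an: "real_analytic_on U f"
  show "\<forall>p\<in>U. analytic_at f p"
  proof
    fix p assume p: "p \<in> U"
    from bspec[OF an[unfolded real_analytic_on_def] p] obtain r c where r: "r > 0"
      and c: "\<forall>x\<in>ball p r \<inter> U. ((\<lambda>a. c a * (\<Prod>i\<in>UNIV. (x $ i - p $ i) ^ a i)) has_sum f x) UNIV"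
      by (elim exE conjE)
    obtain e where e: "e > 0" "ball p e \<subseteq> U" using assms p openE by blast
    obtain \<sigma> where \<sigma>: "\<sigma> > 0" "\<And>x::real^'n. x \<in> cube \<sigma> \<Longrightarrow> norm x < min r e"
      using cube_norm_less[of "min r e"] r e by auto
    have c': "((\<lambda>a. c a * mon a h) has_sum f (p + h)) UNIV" if "h \<in> cube \<sigma>" for h
    proof -
      have "p + h \<in> ball p r \<inter> U" using \<sigma>(2)[OF that] e by (auto simp: dist_norm subset_iff)
      from bspec[OF c this] show ?thesis by (simp add: mon_def)
    qed
    define v :: "real^'n" where "v = (\<chi> i. \<sigma>)"
    have "v \<in> cube \<sigma>" using \<sigma> by (simp add: v_def cube_def)
    from has_sum_imp_summable[OF c'[OF this]] have "(\<lambda>a. c a * mon a v) summable_on UNIV" .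
    then have "(\<lambda>a. norm (c a * mon a v)) summable_on UNIV" by (rule iffD1[OF summable_on_iff_abs_summable_on_real])
    moreover have "norm (c a * mon a v) = \<bar>c a\<bar> * \<sigma> ^ deg a" for a
      using \<sigma> by (simp add: mon_def v_def deg_def power_sum abs_mult abs_prod)
    ultimately have "(\<lambda>a. \<bar>c a\<bar> * \<sigma> ^ deg a) summable_on UNIV" by simp
    then have "has_ps \<sigma> c (\<lambda>h. f (p + h)) (\<Sum>\<^sub>\<infinity>a. \<bar>c a\<bar> * \<sigma> ^ deg a)"
      unfolding has_ps_def using c' by auto
    then show "analytic_at f p" by (intro analytic_atI[OF \<sigma>(1)] ps_boundI[OF _ order_refl])
  qed
next
  assume an: "\<forall>p\<in>U. analytic_at f p"
  show "real_analytic_on U f"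
    unfolding real_analytic_on_def
  proof
    fix p assume "p \<in> U"
    with an have "analytic_at f p" by blast
    then obtain \<rho> c S where \<rho>: "\<rho> > 0" and c: "has_ps \<rho> c (\<lambda>h. f (p + h)) S"
      by (rule analytic_atE)
    have "((\<lambda>a. c a * (\<Prod>i\<in>UNIV. (x $ i - p $ i) ^ a i)) has_sum f x) UNIV" if "x \<in> ball p \<rho> \<inter> U" for x
    proof -
      have "x - p \<in> cube \<rho>" using that by (intro norm_in_cube) (simp add: dist_norm norm_minus_commute)
      from has_psD2[OF c this] show ?thesis by (simp add: mon_def)
    qed
    then show "\<exists>r>0. \<exists>c. \<forall>x\<in>ball p r \<inter> U. ((\<lambda>a. c a * (\<Prod>i\<in>UNIV. (x $ i - p $ i) ^ a i)) has_sum f x) UNIV"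
      using \<rho> by blast
  qed
qed

lemma analytic_atE2:
  assumes "analytic_at f p" "analytic_at g p"
  obtains \<rho> M N where "\<rho> > 0" "ps_bound \<rho> (\<lambda>h. f (p + h)) M" "ps_bound \<rho> (\<lambda>h. g (p + h)) N"
proof -
  obtain \<rho> M where 1: "\<rho> > 0" "ps_bound \<rho> (\<lambda>h. f (p + h)) M" using assms unfolding analytic_at_def by blast
  obtain \<sigma> N where 2: "\<sigma> > 0" "ps_bound \<sigma> (\<lambda>h. g (p + h)) N" using assms unfolding analytic_at_def by blast
  show ?thesis
    by (rule that[of "min \<rho> \<sigma>" M N])
      (use 1 2 in \<open>auto intro: ps_bound_shrink[OF 1(2)] ps_bound_shrink[OF 2(2)]\<close>)
qed

lemma analytic_at_const: "analytic_at (\<lambda>x. k) p"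
  by (rule analytic_atI[of 1, OF _ ps_bound_const]) simp

lemma analytic_at_add: "analytic_at f p \<Longrightarrow> analytic_at g p \<Longrightarrow> analytic_at (\<lambda>x. f x + g x) p"
  by (erule (1) analytic_atE2, rule analytic_atI, assumption, rule ps_bound_add)

lemma analytic_at_mult: "analytic_at f p \<Longrightarrow> analytic_at g p \<Longrightarrow> analytic_at (\<lambda>x. f x * g x) p"
  by (erule (1) analytic_atE2, rule analytic_atI, assumption, rule ps_bound_mult)

lemma analytic_at_coord: "analytic_at (\<lambda>x. x $ i) p"
  by (rule analytic_atI[of 1 _ _ "\<bar>p $ i\<bar> + 1"]) (auto intro!: ps_bound_add ps_bound_const ps_bound_coord)

lemma analytic_at_sum: "finite I \<Longrightarrow> (\<And>i. i \<in> I \<Longrightarrow> analytic_at (f i) p) \<Longrightarrow> analytic_at (\<lambda>x. \<Sum>i\<in>I. f i x) p"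
  by (induction I rule: finite_induct) (auto intro: analytic_at_const analytic_at_add)

lemma analytic_at_linear:
  fixes f :: "real^'n \<Rightarrow> real"
  assumes "linear f" shows "analytic_at f p"
proof -
  have "f = (\<lambda>x. \<Sum>i\<in>UNIV. x $ i * f (axis i 1))" using has_derivative_axis_expand[OF assms] by blast
  moreover have "analytic_at (\<lambda>x. \<Sum>i\<in>UNIV. x $ i * f (axis i 1)) p"
    by (intro analytic_at_sum analytic_at_mult analytic_at_coord analytic_at_const) auto
  ultimately show ?thesis by simp
qed

text \<open>Subtracting the value at p removes the constant term, so shrinking the radius makes the
  norm as small as desired; finiteness of the index type allows one common radius.\<close>

lemma ps_bound_uniform_small:
  fixes g :: "'i::finite \<Rightarrow> real^'m \<Rightarrow> real"
  assumes "\<And>i. analytic_at (g i) p" "\<epsilon> > 0"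
  shows "\<exists>\<rho>>0. \<forall>i. ps_bound \<rho> (\<lambda>h. g i (p + h) - g i p) \<epsilon>"
proof -
  have "\<exists>\<rho>>0. ps_bound \<rho> (\<lambda>h. g i (p + h) - g i p) \<epsilon>" for i
  proof -
    obtain \<rho> M where \<rho>: "\<rho> > 0" "ps_bound \<rho> (\<lambda>h. g i (p + h)) M" using assms unfolding analytic_at_def by blast
    define N where "N = M + \<bar>g i p\<bar>"
    have N: "ps_bound \<rho> (\<lambda>h. g i (p + h) - g i p) N"
      unfolding N_def by (rule ps_bound_minus[OF \<rho> ps_bound_const])
    define \<theta> where "\<theta> = min 1 (\<epsilon> / (\<bar>N\<bar> + 1))"
    have \<theta>: "0 < \<theta>" "\<theta> \<le> 1" using assms(2) by (auto simp: \<theta>_def)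
    have "ps_bound (\<theta> * \<rho>) (\<lambda>h. g i (p + h) - g i p) (\<theta> * N)"
      by (rule ps_bound_shrink_zero[OF N]) (use \<rho> \<theta> in auto)
    moreover have "\<theta> * N \<le> \<epsilon>"
    proof -
      have "\<theta> * N \<le> \<theta> * (\<bar>N\<bar> + 1)" using \<theta> by (intro mult_left_mono) auto
      also have "\<dots> \<le> \<epsilon> / (\<bar>N\<bar> + 1) * (\<bar>N\<bar> + 1)" by (intro mult_right_mono) (auto simp: \<theta>_def)
      also have "\<dots> = \<epsilon>" by (simp add: add_nonneg_eq_0_iff)
      finally show ?thesis .
    qed
    ultimately have "ps_bound (\<theta> * \<rho>) (\<lambda>h. g i (p + h) - g i p) \<epsilon>" by (rule ps_bound_mono)
    moreover have "\<theta> * \<rho> > 0" using \<theta> \<rho> by simp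
    ultimately show ?thesis by blast
  qed
  then have "\<forall>i. \<exists>\<rho>. \<rho> > 0 \<and> ps_bound \<rho> (\<lambda>h. g i (p + h) - g i p) \<epsilon>" by blast
  from choice[OF this] obtain \<rho> where \<rho>: "\<And>i. \<rho> i > 0" "\<And>i. ps_bound (\<rho> i) (\<lambda>h. g i (p + h) - g i p) \<epsilon>" by blast
  define R where "R = Min (range \<rho>)"
  have R: "R > 0" unfolding R_def using \<rho>(1) by (subst Min_gr_iff) auto
  have "R \<le> \<rho> i" for i unfolding R_def by simp
  then have "ps_bound R (\<lambda>h. g i (p + h) - g i p) \<epsilon>" for i by (rule ps_bound_shrink[OF \<rho>(2) R])
  with R show ?thesis by (intro exI[of _ R]) simp
qed

lemma analytic_at_compose:
  fixes g :: "real^'m \<Rightarrow> real^'n"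
  assumes "analytic_at f (g p)" "\<And>i. analytic_at (\<lambda>x. g x $ i) p"
  shows "analytic_at (\<lambda>x. f (g x)) p"
proof -
  obtain \<epsilon> M where f: "\<epsilon> > 0" "ps_bound \<epsilon> (\<lambda>h. f (g p + h)) M" using assms(1) unfolding analytic_at_def by blast
  from ps_bound_uniform_small[of "\<lambda>i x. g x $ i" p \<epsilon>, OF assms(2) f(1)]
  obtain \<rho> where \<rho>: "\<rho> > 0" "\<forall>i. ps_bound \<rho> (\<lambda>h. g (p + h) $ i - g p $ i) \<epsilon>"
    by (elim exE conjE)
  have "ps_bound \<rho> (\<lambda>h. f (g p + (g (p + h) - g p))) M"
    by (rule ps_bound_compose[OF \<rho>(1) _ f(2)]) (use \<rho>(2) in simp)
  then show ?thesis using analytic_atI[OF \<rho>(1), of "\<lambda>x. f (g x)" p M] by simp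
qed

text \<open>1 / f (p + h) is 1 / f p times the geometric series in u = 1 - f (p + h) / f p. The
  radius is taken so small that u has norm at most 1/2.\<close>

lemma analytic_at_inverse:
  fixes f :: "real^'n \<Rightarrow> real"
  assumes "analytic_at f p" "f p \<noteq> 0"
  shows "analytic_at (\<lambda>x. inverse (f x)) p"
proof -
  define u where "u h = - inverse (f p) * (f (p + h) - f p)" for h
  define \<epsilon> where "\<epsilon> = \<bar>f p\<bar> / 2"
  have \<epsilon>: "\<epsilon> > 0" using assms by (simp add: \<epsilon>_def)
  from ps_bound_uniform_small[of "\<lambda>_::unit. f" p \<epsilon>, OF assms(1) \<epsilon>]
  obtain \<rho> where \<rho>: "\<rho> > 0" "ps_bound \<rho> (\<lambda>h. f (p + h) - f p) \<epsilon>"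
    by auto
  have "ps_bound \<rho> u (\<bar>- inverse (f p)\<bar> * \<epsilon>)" unfolding u_def by (rule ps_bound_cmult[OF \<rho>(2)])
  then have u: "ps_bound \<rho> u (1/2)" using assms by (simp add: \<epsilon>_def)
  have up: "ps_bound \<rho> (\<lambda>h. u h ^ k) ((1/2) ^ k)" for k
  proof (induction k)
    case 0
    then show ?case using ps_bound_const[of \<rho> 1] by simp
  next
    case (Suc k)
    then show ?case using ps_bound_mult[OF u Suc \<rho>(1)] by simp
  qed
  have "ps_bound \<rho> (\<lambda>h. 1 / (1 - u h)) 2"
  proof (rule ps_bound_has_sum[OF \<rho>(1) up])
    have "(\<lambda>k. (1/2::real) ^ k) sums (1 / (1 - 1/2))" by (rule geometric_sums) simp
    then show "((\<lambda>k. (1/2::real) ^ k) has_sum 2) UNIV" by (intro sums_nonneg_imp_has_sum) auto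
    fix h :: "real^'n" assume "h \<in> cube \<rho>"
    then have "\<bar>u h\<bar> \<le> 1/2" using ps_bound_abs[OF u] by blast
    then have l: "norm (u h) < 1" by simp
    show "((\<lambda>k. u h ^ k) has_sum 1 / (1 - u h)) UNIV"
    proof (rule norm_summable_imp_has_sum)
      have "summable (\<lambda>k. norm (u h) ^ k)" using l by (intro summable_geometric) simp
      then show "summable (\<lambda>k. norm (u h ^ k))" by (simp only: norm_power)
    qed (rule geometric_sums[OF l])
  qed
  then have "ps_bound \<rho> (\<lambda>h. inverse (f p) * (1 / (1 - u h))) (\<bar>inverse (f p)\<bar> * 2)" by (rule ps_bound_cmult)
  moreover have "inverse (f p) * (1 / (1 - u h)) = inverse (f (p + h))" for h
    using assms(2) by (simp add: u_def field_simps)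
  ultimately show ?thesis using analytic_atI[OF \<rho>(1)] by simp
qed

lemma deg_less_2D:
  assumes "deg a < 2" shows "a = (\<lambda>_. 0) \<or> (\<exists>i. a = inc i (\<lambda>_. 0))"
proof (cases "deg a = 0")
  case False
  then obtain i where i: "a i \<noteq> 0" unfolding deg_def by (metis sum.neutral)
  then have e: "inc i (a(i := a i - 1)) = a" by (rule inc_pred[of a i])
  then have "deg (a(i := a i - 1)) = 0" using assms deg_inc[of i "a(i := a i - 1)"] by simp
  then have z: "a(i := a i - 1) = (\<lambda>_. 0)" by (simp only: deg_eq_0_iff)
  have "a = inc i (\<lambda>_. 0)" using e[unfolded z] by (rule sym)
  then show ?thesis by blast
qed (simp add: deg_eq_0_iff)

text \<open>Without its terms of degree below 2 the series is a remainder of order |h|^2, by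
  \<open>has_ps_shrink\<close> with m = 2 and ratio |h| / \<rho>. The terms of degree 1 are the
  derivative.\<close>

lemma has_ps_has_derivative:
  fixes f :: "real^'n \<Rightarrow> real"
  assumes c: "has_ps \<rho> c f S" and \<rho>: "\<rho> > 0"
  shows "(f has_derivative (\<lambda>h. \<Sum>i\<in>UNIV. c (inc i (\<lambda>_. 0)) * h $ i)) (at 0)"
proof -
  let ?e = "\<lambda>i. inc i (\<lambda>_. 0) :: 'n \<Rightarrow> nat"
  let ?L = "\<lambda>h::real^'n. \<Sum>i\<in>UNIV. c (?e i) * h $ i"
  define c2 where "c2 a = (if deg a < 2 then 0 else c a)" for a
  \<comment> \<open>The multi-indices of degree below 2; there are finitely many, so the affine part
    of f is a finite sum.\<close>
  define B where "B = insert (\<lambda>_. 0) (range ?e)"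
  have inj: "inj ?e" by (rule injI) (metis fun_upd_apply inc_def nat.distinct(1))
  have nB: "a \<in> B" if "deg a < 2" for a
    using deg_less_2D[OF that] by (auto simp: B_def)
  have Bd: "deg a < 2" if "a \<in> B" for a using that by (auto simp: B_def deg_inc)
  define r where "r h = f h - (f 0 + ?L h)" for h
  have low: "((\<lambda>a. (if deg a < 2 then c a else 0) * mon a h) has_sum (f 0 + ?L h)) UNIV" for h
  proof (rule has_sum_finite_neutralI[of B])
    have "(\<Sum>a\<in>B. (if deg a < 2 then c a else 0) * mon a h) = (\<Sum>a\<in>B. c a * mon a h)"
      using Bd by (intro sum.cong) auto
    also have "\<dots> = c (\<lambda>_. 0) + (\<Sum>a\<in>range ?e. c a * mon a h)"
    proof -
      have "(\<lambda>_. 0) \<notin> range ?e" by (auto simp: deg_inc dest: arg_cong[where f = deg])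
      then show ?thesis unfolding B_def by (subst sum.insert) auto
    qed
    also have "(\<Sum>a\<in>range ?e. c a * mon a h) = ?L h"
      by (subst sum.reindex[OF inj]) (simp add: mon_inc)
    finally show "f 0 + ?L h = (\<Sum>a\<in>B. (if deg a < 2 then c a else 0) * mon a h)"
      using has_ps_at_0[OF c] \<rho> by simp
  qed (use nB in \<open>auto simp: B_def\<close>)
  have s: "(\<lambda>a. \<bar>c2 a\<bar> * \<rho> ^ deg a) summable_on UNIV"
    by (rule summable_on_comparison_test[of "\<lambda>a. \<bar>c a\<bar> * \<rho> ^ deg a"])
      (use has_sum_imp_summable[OF has_psD1[OF c]] \<rho> in \<open>auto simp: c2_def\<close>)
  define S2 where "S2 = (\<Sum>\<^sub>\<infinity>a. \<bar>c2 a\<bar> * \<rho> ^ deg a)"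
  have "((\<lambda>a. c2 a * mon a h) has_sum r h) UNIV" if h: "h \<in> cube \<rho>" for h
  proof -
    have "((\<lambda>a. c a * mon a h + - ((if deg a < 2 then c a else 0) * mon a h)) has_sum (f h + - (f 0 + ?L h))) UNIV"
      by (intro has_sum_add has_psD2[OF c h] has_sum_uminusI low)
    moreover have "c a * mon a h + - ((if deg a < 2 then c a else 0) * mon a h) = c2 a * mon a h" for a
      by (simp add: c2_def)
    ultimately show ?thesis by (simp add: r_def algebra_simps)
  qed
  then have c2: "has_ps \<rho> c2 r S2" unfolding has_ps_def S2_def using s by auto
  have rb: "\<bar>r h\<bar> \<le> (norm h / \<rho>)\<^sup>2 * S2" if "norm h < \<rho>" for h
  proof -
    have "ps_bound ((norm h / \<rho>) * \<rho>) r ((norm h / \<rho>) ^ 2 * S2)"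
      by (rule has_ps_shrink[OF c2]) (use that \<rho> in \<open>auto simp: c2_def\<close>)
    then show ?thesis by (rule ps_bound_abs) (use \<rho> in \<open>auto intro: norm_in_cube\<close>)
  qed
  show ?thesis
  proof (rule has_derivativeI_sandwich[OF \<rho>])
    show "bounded_linear ?L"
      by (intro bounded_linear_sum bounded_linear_const_mult bounded_linear_vec_nth)
    show "((\<lambda>h::real^'n. norm h * (S2 / \<rho>\<^sup>2)) \<longlongrightarrow> 0) (at 0)"
      by (rule tendsto_eq_intros refl | simp)+
    fix h :: "real^'n" assume h: "h \<noteq> 0" "dist h 0 < \<rho>"
    have "norm (f h - f 0 - ?L (h - 0)) / norm (h - 0) = \<bar>r h\<bar> / norm h" by (simp add: r_def diff_diff_eq)
    also have "\<dots> \<le> ((norm h / \<rho>)\<^sup>2 * S2) / norm h" using rb[of h] h by (intro divide_right_mono) auto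
    also have "\<dots> = norm h * (S2 / \<rho>\<^sup>2)" using h by (simp add: power2_eq_square)
    finally show "norm (f h - f 0 - ?L (h - 0)) / norm (h - 0) \<le> norm h * (S2 / \<rho>\<^sup>2)" .
  qed
qed

lemma analytic_at_has_derivative:
  fixes f :: "real^'n \<Rightarrow> real"
  assumes "analytic_at f p" shows "\<exists>L. (f has_derivative L) (at p)"
proof -
  obtain \<rho> c S where \<rho>: "\<rho> > 0" and c: "has_ps \<rho> c (\<lambda>h. f (p + h)) S"
    by (rule analytic_atE[OF assms])
  obtain L where L: "((\<lambda>h. f (p + h)) has_derivative L) (at (p - p))"
    using has_ps_has_derivative[OF c \<rho>] by auto
  have "((\<lambda>x. x - p) has_derivative (\<lambda>h. h)) (at p)" by (auto intro!: derivative_eq_intros)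
  from has_derivative_compose[OF this L] show ?thesis by auto
qed

lemma analytic_at_isCont: "analytic_at f p \<Longrightarrow> isCont f p"
  using analytic_at_has_derivative has_derivative_continuous by blast

section \<open>Analyticity of derivatives\<close>

definition cons_coord :: "real \<Rightarrow> real^'n \<Rightarrow> real^('n option)" where
  "cons_coord t y = (\<chi> j. case j of None \<Rightarrow> t | Some i \<Rightarrow> y $ i)"

lemma mon_cons_coord: "mon b (cons_coord t y) = t ^ b None * mon (b \<circ> Some) y"
proof -
  have "mon b (cons_coord t y) = (\<Prod>j\<in>insert None (range Some). cons_coord t y $ j ^ b j)"
    by (simp add: mon_def UNIV_option_conv)
  also have "\<dots> = t ^ b None * (\<Prod>j\<in>range Some. cons_coord t y $ j ^ b j)"
    by (subst prod.insert) (auto simp: cons_coord_def)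
  also have "(\<Prod>j\<in>range Some. cons_coord t y $ j ^ b j) = mon (b \<circ> Some) y"
    by (subst prod.reindex) (auto simp: cons_coord_def mon_def)
  finally show ?thesis .
qed

lemma deg_option: "deg b = b None + deg (b \<circ> Some)"
proof -
  have "deg b = (\<Sum>j\<in>insert None (range Some). b j)"
    by (simp add: deg_def UNIV_option_conv)
  also have "\<dots> = b None + (\<Sum>j\<in>range Some. b j)"
    by (subst sum.insert) auto
  also have "(\<Sum>j\<in>range Some. b j) = deg (b \<circ> Some)"
    by (subst sum.reindex) (auto simp: deg_def)
  finally show ?thesis .
qed

text \<open>Expanding \<open>f (p + y + t v)\<close> as a power series in \<open>(y, t)\<close>, the coefficient of \<open>t\<close>
  is a power series in \<open>y\<close>, and it is the directional derivative.\<close>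

lemma analytic_at_deriv:
  fixes f :: "real^'n \<Rightarrow> real"
  assumes an: "analytic_at f p" and U: "open U" "p \<in> U"
    and d: "\<And>x. x \<in> U \<Longrightarrow> (f has_derivative f' x) (at x)"
  shows "analytic_at (\<lambda>x. f' x v) p"
proof -
  obtain \<rho> M where \<rho>: "\<rho> > 0" and f: "ps_bound \<rho> (\<lambda>h. f (p + h)) M"
    using an unfolding analytic_at_def by blast
  obtain e where e: "e > 0" "ball p e \<subseteq> U" using U openE by blast
  obtain \<tau> where \<tau>: "\<tau> > 0" "\<And>x::real^'n. x \<in> cube \<tau> \<Longrightarrow> norm x < e" using cube_norm_less[OF e(1)] by blast
  \<comment> \<open>Substituting y + t v into the series of f needs components of norm at most
    \<rho>, and \<sigma> (1 + norm v) \<le> \<rho> provides it. The bound by \<tau> keeps p + y in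
    U.\<close>
  define \<sigma> where "\<sigma> = min \<tau> (\<rho> / (1 + norm v))"
  have nv: "1 + norm v > 0" by (smt (verit) norm_ge_zero)
  have \<sigma>: "\<sigma> > 0" "\<sigma> \<le> \<tau>" using \<tau> \<rho> nv by (auto simp: \<sigma>_def)
  have "\<sigma> * (1 + norm v) \<le> \<rho> / (1 + norm v) * (1 + norm v)"
    using nv by (intro mult_right_mono) (auto simp: \<sigma>_def)
  then have \<sigma>v: "\<sigma> * (1 + norm v) \<le> \<rho>" using nv by simp
  define W :: "real^('n option) \<Rightarrow> real^'n" where "W w = (\<chi> i. w $ Some i + v $ i * w $ None)" for w
  have W: "ps_bound \<sigma> (\<lambda>w. W w $ i) \<rho>" for i
  proof -
    have "ps_bound \<sigma> (\<lambda>w. w $ Some i + v $ i * w $ None) (\<sigma> + \<bar>v $ i\<bar> * \<sigma>)"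
      by (intro ps_bound_add ps_bound_cmult ps_bound_coord \<sigma>(1))
    moreover have "\<sigma> + \<bar>v $ i\<bar> * \<sigma> \<le> \<rho>"
    proof -
      have "\<bar>v $ i\<bar> * \<sigma> \<le> norm v * \<sigma>" using \<sigma> by (intro mult_right_mono component_le_norm_cart) auto
      then show ?thesis using \<sigma>v by (simp add: algebra_simps)
    qed
    ultimately show ?thesis unfolding W_def by (auto intro: ps_bound_mono)
  qed
  have "ps_bound \<sigma> (\<lambda>w. f (p + W w)) M" by (rule ps_bound_compose[OF \<sigma>(1) W f])
  then obtain b S where b: "has_ps \<sigma> b (\<lambda>w. f (p + W w)) S" unfolding ps_bound_def by blast
  have W_cons: "W (cons_coord t y) = y + t *\<^sub>R v" for t y
    by (simp add: W_def cons_coord_def vec_eq_iff)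
  have cc: "cons_coord t y \<in> cube \<sigma>" if "\<bar>t\<bar> \<le> \<sigma>" "y \<in> cube \<sigma>" for t y
    using that by (auto simp: cube_def cons_coord_def split: option.split)
  have S0: "S \<ge> 0" using has_ps_nonneg[OF b] \<sigma> by simp
  \<comment> \<open>\<open>ext a\<close> has exponent 1 in t and the exponents a in y, so
    \<open>c\<close> below collects the coefficient of t.\<close>
  define ext :: "('n \<Rightarrow> nat) \<Rightarrow> 'n option \<Rightarrow> nat" where "ext a = case_option 1 a" for a
  have ext: "ext a None = 1" "ext a \<circ> Some = a" for a by (auto simp: ext_def)
  have deg_ext: "deg (ext a) = Suc (deg a)" for a by (simp add: deg_option[of "ext a"] ext)
  have inj: "inj ext" by (rule injI) (metis ext(2))
  have range_ext: "range ext = {a. a None = 1}"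
  proof -
    have "a = ext (a \<circ> Some)" if "a None = 1" for a
      using that by (auto simp: ext_def fun_eq_iff split: option.split)
    then show ?thesis using ext(1) by auto
  qed
  define c where "c a = b (ext a)" for a
  have csum: "(\<lambda>a. \<bar>c a\<bar> * \<sigma> ^ deg a) summable_on UNIV"
  proof -
    have "(\<lambda>a. \<bar>b a\<bar> * \<sigma> ^ deg a) summable_on range ext"
      by (rule summable_on_subset_banach[OF _ subset_UNIV]) (rule has_sum_imp_summable[OF has_psD1[OF b]])
    then have "(\<lambda>a. \<bar>c a\<bar> * \<sigma> ^ (Suc (deg a))) summable_on UNIV"
      by (subst (asm) summable_on_reindex[OF inj]) (simp add: o_def c_def deg_ext)
    then have "(\<lambda>a. inverse \<sigma> * (\<bar>c a\<bar> * \<sigma> ^ (Suc (deg a)))) summable_on UNIV"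
      by (rule summable_on_cmult_right)
    moreover have "inverse \<sigma> * (\<bar>c a\<bar> * \<sigma> ^ (Suc (deg a))) = \<bar>c a\<bar> * \<sigma> ^ deg a" for a
      using \<sigma> by simp
    ultimately show ?thesis by (simp only:)
  qed
  define g where "g y = (\<Sum>\<^sub>\<infinity>a. c a * mon a y)" for y
  note g = has_ps_summable[OF csum, folded g_def]
  \<comment> \<open>Terms without t sum to f (p + y) and those linear in t to t g y. Every other
    term contains t^2, which makes it at most (|t| / \<sigma>)^2 times its majorant.\<close>
  have est: "\<bar>f (p + (y + t *\<^sub>R v)) - f (p + y) - t * g y\<bar> \<le> (\<bar>t\<bar> / \<sigma>)\<^sup>2 * S"
    if y: "y \<in> cube \<sigma>" and t: "\<bar>t\<bar> \<le> \<sigma>" for y t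
  proof -
    let ?w = "cons_coord t y"
    have 0: "((\<lambda>a. if a None = 0 then b a * mon a ?w else 0) has_sum f (p + y)) UNIV"
    proof -
      have "((\<lambda>a. b a * mon a (cons_coord 0 y)) has_sum f (p + W (cons_coord 0 y))) UNIV"
        by (rule has_psD2[OF b cc]) (use y \<sigma> in auto)
      moreover have "b a * mon a (cons_coord 0 y) = (if a None = 0 then b a * mon a ?w else 0)" for a
        by (simp add: mon_cons_coord)
      ultimately show ?thesis by (simp add: W_cons)
    qed
    have 1: "((\<lambda>a. if a None = 1 then b a * mon a ?w else 0) has_sum t * g y) UNIV"
    proof -
      have "((\<lambda>a. t * (c a * mon a y)) has_sum t * g y) UNIV"
        by (rule has_sum_cmult_right[OF has_psD2[OF g y]])
      moreover have "t * (c a * mon a y) = ((\<lambda>a. b a * mon a ?w) \<circ> ext) a" for a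
        by (simp add: c_def mon_cons_coord ext)
      ultimately have "((\<lambda>a. b a * mon a ?w) \<circ> ext has_sum t * g y) UNIV" by (simp only:)
      then have "((\<lambda>a. b a * mon a ?w) has_sum t * g y) (range ext)"
        by (subst has_sum_reindex[OF inj])
      then show ?thesis unfolding range_ext
        by (subst has_sum_cong_neutral[where T = "{a. a None = 1}" and g = "\<lambda>a. b a * mon a ?w"]) auto
    qed
    have all: "((\<lambda>a. b a * mon a ?w) has_sum f (p + (y + t *\<^sub>R v))) UNIV"
      using has_psD2[OF b cc[OF t y]] by (simp add: W_cons)
    have "((\<lambda>a. b a * mon a ?w + - (if a None = 0 then b a * mon a ?w else 0) + - (if a None = 1 then b a * mon a ?w else 0))
       has_sum (f (p + (y + t *\<^sub>R v)) + - f (p + y) + - (t * g y))) UNIV"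
      by (intro has_sum_add has_sum_uminusI all 0 1)
    moreover have "\<bar>b a * mon a ?w + - (if a None = 0 then b a * mon a ?w else 0) + - (if a None = 1 then b a * mon a ?w else 0)\<bar>
        \<le> (\<bar>t\<bar> / \<sigma>)\<^sup>2 * (\<bar>b a\<bar> * \<sigma> ^ deg a)" for a
    proof (cases "a None < 2")
      case True
      then have "a None = 0 \<or> a None = 1" by linarith
      then show ?thesis using \<sigma> by auto
    next
      case False
      then obtain k where k: "a None = 2 + k" by (metis le_Suc_ex not_less)
      have "\<bar>mon a ?w\<bar> = \<bar>t\<bar>\<^sup>2 * (\<bar>t\<bar> ^ k * \<bar>mon (a \<circ> Some) y\<bar>)"
        by (simp add: mon_cons_coord k abs_mult power_abs power_add power2_eq_square)
      also have "\<dots> \<le> \<bar>t\<bar>\<^sup>2 * (\<sigma> ^ k * \<sigma> ^ deg (a \<circ> Some))"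
        using mon_abs_le[OF y] t \<sigma> by (intro mult_left_mono mult_mono power_mono) auto
      also have "\<dots> = (\<bar>t\<bar> / \<sigma>)\<^sup>2 * \<sigma> ^ deg a"
        using \<sigma> by (simp add: deg_option[of a] k power_add power2_eq_square)
      finally have "\<bar>b a\<bar> * \<bar>mon a ?w\<bar> \<le> \<bar>b a\<bar> * ((\<bar>t\<bar> / \<sigma>)\<^sup>2 * \<sigma> ^ deg a)" by (rule mult_left_mono) simp
      then show ?thesis using False by (simp add: abs_mult mult_ac)
    qed
    ultimately have "\<bar>f (p + (y + t *\<^sub>R v)) + - f (p + y) + - (t * g y)\<bar> \<le> (\<bar>t\<bar> / \<sigma>)\<^sup>2 * S"
      by (rule abs_has_sum_le[OF _ has_sum_cmult_right[OF has_psD1[OF b]]])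
    then show ?thesis by simp
  qed
  have gd: "f' (p + y) v = g y" if y: "y \<in> cube \<sigma>" for y
  proof -
    have "y \<in> cube \<tau>" using y cube_mono[OF \<sigma>(2)] by blast
    from \<tau>(2)[OF this] have "p + y \<in> U" using e by (auto simp: dist_norm subset_iff)
    from d[OF this] have df: "(f has_derivative f' (p + y)) (at (p + (y + 0 *\<^sub>R v)))" by simp
    have "((\<lambda>t. p + (y + t *\<^sub>R v)) has_derivative (\<lambda>t. t *\<^sub>R v)) (at 0)"
      by (auto intro!: derivative_eq_intros)
    from has_derivative_compose[OF this df]
    have 1: "((\<lambda>t. f (p + (y + t *\<^sub>R v))) has_derivative (\<lambda>t. f' (p + y) (t *\<^sub>R v))) (at 0)" .
    have 2: "((\<lambda>t. f (p + (y + t *\<^sub>R v))) has_derivative (\<lambda>t. t * g y)) (at 0)"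
    proof (rule has_derivativeI_sandwich[OF \<sigma>(1)])
      show "bounded_linear (\<lambda>t. t * g y)" by (rule bounded_linear_mult_left)
      show "((\<lambda>t::real. \<bar>t\<bar> * (S / \<sigma>\<^sup>2)) \<longlongrightarrow> 0) (at 0)"
        by (rule tendsto_eq_intros refl | simp)+
      fix t :: real assume t: "t \<noteq> 0" "dist t 0 < \<sigma>"
      have "norm (f (p + (y + t *\<^sub>R v)) - f (p + (y + 0 *\<^sub>R v)) - (t - 0) * g y) / norm (t - 0)
         \<le> ((\<bar>t\<bar> / \<sigma>)\<^sup>2 * S) / \<bar>t\<bar>"
        using est[OF y, of t] t by (simp add: divide_right_mono)
      moreover have "((a / \<sigma>)\<^sup>2 * S) / a = a * (S / \<sigma>\<^sup>2)" if "a \<noteq> 0" for a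
        using that by (simp add: power2_eq_square)
      from this[of "\<bar>t\<bar>"] have "((\<bar>t\<bar> / \<sigma>)\<^sup>2 * S) / \<bar>t\<bar> = \<bar>t\<bar> * (S / \<sigma>\<^sup>2)" using t by simp
      ultimately show "norm (f (p + (y + t *\<^sub>R v)) - f (p + (y + 0 *\<^sub>R v)) - (t - 0) * g y) / norm (t - 0)
         \<le> \<bar>t\<bar> * (S / \<sigma>\<^sup>2)" by linarith
    qed
    from fun_cong[OF has_derivative_unique[OF 1 2], of 1] show ?thesis by simp
  qed
  show ?thesis
    by (rule analytic_atI[OF \<sigma>(1)], rule ps_bound_cong[of \<sigma> g], rule gd[symmetric], assumption,
        rule ps_boundI[OF g order_refl])
qed

text \<open>The contraction estimate for Picard iteration, in the norm of power series. By
  \<open>ps_bound_mon_diff\<close> a monomial of degree n \<ge> 2 contributes the factor n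
  \<theta>^(n-1), which is at most 2 \<theta> for \<theta> \<le> 1/2, so the Lipschitz constant is
  proportional to \<theta>.\<close>

lemma ps_bound_lipschitz:
  fixes g h :: "real^'m \<Rightarrow> real^'n" and f :: "real^'n \<Rightarrow> real"
  assumes c: "has_ps R c f S" and c0: "\<And>a. deg a < 2 \<Longrightarrow> c a = 0" and R: "R > 0"
    and \<theta>: "0 < \<theta>" "\<theta> \<le> 1/2" and \<rho>: "\<rho> > 0"
    and g: "\<And>i. ps_bound \<rho> (\<lambda>x. g x $ i) (\<theta> * R)" and h: "\<And>i. ps_bound \<rho> (\<lambda>x. h x $ i) (\<theta> * R)"
    and gh: "\<And>i. ps_bound \<rho> (\<lambda>x. g x $ i - h x $ i) d"
  shows "ps_bound \<rho> (\<lambda>x. f (g x) - f (h x)) (2 * \<theta> / R * S * d)"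
proof -
  have d0: "d \<ge> 0" using ps_bound_nonneg[OF gh] \<rho> by simp
  have pow: "real n * (1/2) ^ (n - 2) \<le> 2" if "n \<ge> 2" for n :: nat
  proof -
    from le_Suc_ex[OF that] obtain k where n: "n = k + 2" by auto
    have "real (k + 2) \<le> 2 * 2 ^ k" by (induction k) auto
    then have "real (k + 2) / 2 ^ k \<le> 2" by (simp add: pos_divide_le_eq)
    moreover have "real (k + 2) * (1/2) ^ k = real (k + 2) / 2 ^ k" by (simp only: power_one_over) simp
    ultimately show ?thesis unfolding n by (simp only: add_diff_cancel_right')
  qed
  have \<theta>n: "real n * \<theta> ^ (n - 1) \<le> 2 * \<theta>" if n: "n \<ge> 2" for n
  proof -
    have "real n * \<theta> ^ (n - 1) = \<theta> * (real n * \<theta> ^ (n - 2))"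
      using n by (cases n; cases "n - 1") (auto simp: algebra_simps)
    also have "\<dots> \<le> \<theta> * (real n * (1/2) ^ (n - 2))"
      using \<theta> by (intro mult_left_mono power_mono) auto
    also have "\<dots> \<le> \<theta> * 2" using pow[OF n] \<theta> by (intro mult_left_mono) auto
    finally show ?thesis by simp
  qed
  have sub: "g x \<in> cube R" "h x \<in> cube R" if x: "x \<in> cube \<rho>" for x
  proof -
    have "\<theta> * R \<le> R" using \<theta> R by (simp add: mult_left_le_one_le)
    then show "g x \<in> cube R" "h x \<in> cube R"
      using ps_bound_abs[OF g x] ps_bound_abs[OF h x] unfolding cube_def by (auto intro: order_trans)
  qed
  show ?thesis
  proof (rule ps_bound_has_sum[OF \<rho>])
    show "ps_bound \<rho> (\<lambda>x. c a * (mon a (g x) - mon a (h x))) (2 * \<theta> / R * d * (\<bar>c a\<bar> * R ^ deg a))" for a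
    proof (cases "deg a < 2")
      case True
      then show ?thesis using c0 ps_bound_const[of \<rho> 0] by simp
    next
      case False
      have "ps_bound \<rho> (\<lambda>x. c a * (mon a (g x) - mon a (h x))) (\<bar>c a\<bar> * (real (deg a) * (\<theta> * R) ^ (deg a - 1) * d))"
        by (intro ps_bound_cmult ps_bound_mon_diff \<rho> g h gh)
      moreover have "real (deg a) * (\<theta> * R) ^ (deg a - 1) \<le> 2 * \<theta> / R * R ^ deg a"
      proof -
        have "real (deg a) * (\<theta> * R) ^ (deg a - 1) = (real (deg a) * \<theta> ^ (deg a - 1)) * R ^ (deg a - 1)"
          by (simp add: power_mult_distrib)
        also have "\<dots> \<le> 2 * \<theta> * R ^ (deg a - 1)"
          using \<theta>n[of "deg a"] False R by (intro mult_right_mono) auto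
        also have "\<dots> = 2 * \<theta> / R * R ^ deg a" using False R by (cases "deg a") auto
        finally show ?thesis .
      qed
      then have "\<bar>c a\<bar> * (real (deg a) * (\<theta> * R) ^ (deg a - 1) * d) \<le> \<bar>c a\<bar> * (2 * \<theta> / R * R ^ deg a * d)"
        using d0 by (intro mult_left_mono mult_right_mono) auto
      ultimately show ?thesis by (rule ps_bound_mono[OF _ order_trans]) (simp add: mult_ac)
    qed
    have "((\<lambda>a. 2 * \<theta> / R * d * (\<bar>c a\<bar> * R ^ deg a)) has_sum 2 * \<theta> / R * d * S) UNIV"
      by (rule has_sum_cmult_right[OF has_psD1[OF c]])
    then show "((\<lambda>a. 2 * \<theta> / R * d * (\<bar>c a\<bar> * R ^ deg a)) has_sum 2 * \<theta> / R * S * d) UNIV"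
      by (simp add: mult_ac)
    fix x :: "real^'m" assume x: "x \<in> cube \<rho>"
    have "((\<lambda>a. c a * mon a (g x) + - (c a * mon a (h x))) has_sum f (g x) + - f (h x)) UNIV"
      by (intro has_sum_add has_sum_uminusI has_psD2[OF c] sub[OF x])
    then show "((\<lambda>a. c a * (mon a (g x) - mon a (h x))) has_sum f (g x) - f (h x)) UNIV"
      by (simp add: right_diff_distrib)
  qed
qed

lemma analytic_at_shift: "analytic_at f p \<Longrightarrow> analytic_at (\<lambda>x. f (p + x)) 0"
  by (simp add: analytic_at_def)

text \<open>Picard iteration for \<open>x = A y + \<eta> x\<close>, where \<open>\<eta>\<close> has no terms of order below 2.\<close>

theorem analytic_at_inverse_map:
  fixes \<phi> \<psi> :: "real^'n \<Rightarrow> real^'n"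
  assumes \<phi>: "\<And>i. analytic_at (\<lambda>x. \<phi> x $ i) p" and d: "(\<phi> has_derivative \<phi>') (at p)"
    and A: "linear A" "\<And>h. A (\<phi>' h) = h" "\<And>h. \<phi>' (A h) = h"
    and U: "open U" "p \<in> U" "inj_on \<phi> U" and V: "open V" "\<phi> p \<in> V"
    and \<psi>: "\<And>y. y \<in> V \<Longrightarrow> \<psi> y \<in> U" "\<And>y. y \<in> V \<Longrightarrow> \<phi> (\<psi> y) = y"
  shows "analytic_at (\<lambda>y. \<psi> y $ i) (\<phi> p)"
proof -
  \<comment> \<open>As A inverts the derivative of \<phi>, the equation \<phi> (p + x) = \<phi> p +
    y is equivalent to x = A y + \<eta> x, and \<eta> has value and derivative 0 at 0.\<close>
  define \<eta> where "\<eta> x = x - A (\<phi> (p + x) - \<phi> p)" for x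
  have \<eta>0: "\<eta> 0 = 0" using linear_0[OF A(1)] by (simp add: \<eta>_def)
  have linA: "linear (\<lambda>z. A z $ i)" for i
    using linear_compose[OF A(1) bounded_linear.linear[OF bounded_linear_vec_nth], of i] by (simp add: o_def)
  have "analytic_at (\<lambda>x. (\<phi> (p + x) - \<phi> p) $ j) 0" for j
    using analytic_at_add[OF analytic_at_shift[OF \<phi>[of j]] analytic_at_const[of "- \<phi> p $ j"]] by simp
  note A\<phi> = analytic_at_compose[where g = "\<lambda>x. \<phi> (p + x) - \<phi> p", OF analytic_at_linear[OF linA] this]
  have "analytic_at (\<lambda>x. x $ i + (-1) * A (\<phi> (p + x) - \<phi> p) $ i) 0" for i
    by (rule analytic_at_add[OF analytic_at_coord analytic_at_mult[OF analytic_at_const A\<phi>]])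
  then have \<eta>an: "analytic_at (\<lambda>x. \<eta> x $ i) 0" for i
    by (simp add: \<eta>_def)
  from ps_bound_uniform_small[of "\<lambda>i x. \<eta> x $ i", OF \<eta>an zero_less_one]
  obtain R where R: "R > 0" and "\<forall>i. ps_bound R (\<lambda>h. \<eta> (0 + h) $ i - \<eta> 0 $ i) 1"
    by (elim exE conjE)
  then have "\<forall>i. \<exists>c. \<exists>S. has_ps R c (\<lambda>h. \<eta> h $ i) S \<and> S \<le> 1" by (simp add: \<eta>0 ps_bound_def)
  from choice[OF this] obtain c where "\<forall>i. \<exists>S. has_ps R (c i) (\<lambda>h. \<eta> h $ i) S \<and> S \<le> 1" by (elim exE)
  from choice[OF this] obtain S where "\<forall>i. has_ps R (c i) (\<lambda>h. \<eta> h $ i) (S i) \<and> S i \<le> 1" by (elim exE)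
  then have c: "\<And>i. has_ps R (c i) (\<lambda>h. \<eta> h $ i) (S i)" and S: "\<And>i. S i \<le> 1" by simp_all
  have "((\<lambda>x. p + x) has_derivative (\<lambda>h. h)) (at 0)" by (auto intro!: derivative_eq_intros)
  from has_derivative_compose[OF this, of \<phi> \<phi>'] d
  have "((\<lambda>x. \<phi> (p + x)) has_derivative \<phi>') (at 0)" by simp
  then have "((\<lambda>x. \<phi> (p + x) - \<phi> p) has_derivative \<phi>') (at 0)" by (auto intro!: derivative_eq_intros)
  from has_derivative_compose[OF this linear_imp_has_derivative[OF A(1)]]
  have "((\<lambda>x. A (\<phi> (p + x) - \<phi> p)) has_derivative (\<lambda>h. h)) (at 0)" by (simp add: A(2))
  from has_derivative_diff[OF has_derivative_ident this]
  have "(\<eta> has_derivative (\<lambda>h. 0)) (at 0)" unfolding \<eta>_def by simp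
  then have \<eta>d: "((\<lambda>h. \<eta> h $ i) has_derivative (\<lambda>h. 0)) (at 0)" for i
    by (subst (asm) has_derivative_cart_iff) simp
  have c0: "c i a = 0" if a: "deg a < 2" for a i
  proof -
    have "c i (inc j (\<lambda>_. 0)) = 0" for j
      using fun_cong[OF has_derivative_unique[OF \<eta>d has_ps_has_derivative[OF c R]], of i "axis j 1"]
      by (simp add: axis_def if_distrib cong: if_cong)
    moreover have "c i (\<lambda>_. 0) = 0" using has_ps_at_0[OF c, of i] R \<eta>0 by simp
    ultimately show ?thesis using deg_less_2D[OF a] by auto
  qed
  \<comment> \<open>Each \<open>S i\<close> is at most 1, so 2 \<theta> / R \<le> 1/2 makes \<eta>
    contract by the factor 1/2 on series of norm at most s.\<close>
  define \<theta> where "\<theta> = min (1/2) (R / 4)"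
  have \<theta>: "0 < \<theta>" "\<theta> \<le> 1/2" "2 * \<theta> / R \<le> 1/2" using R by (auto simp: \<theta>_def field_simps min_def)
  define s where "s = \<theta> * R"
  have s: "s > 0" using \<theta> R by (simp add: s_def)
  have lip: "ps_bound \<rho> (\<lambda>x. \<eta> (g x) $ i - \<eta> (h x) $ i) (d / 2)"
    if "\<rho> > 0" "\<And>i. ps_bound \<rho> (\<lambda>x. g x $ i) s" "\<And>i. ps_bound \<rho> (\<lambda>x. h x $ i) s"
      "\<And>i. ps_bound \<rho> (\<lambda>x. g x $ i - h x $ i) d" for \<rho> d and g h :: "real^'n \<Rightarrow> real^'n" and i
  proof -
    have d0: "d \<ge> 0" using ps_bound_nonneg[OF that(4)] that(1) by simp
    have "ps_bound \<rho> (\<lambda>x. \<eta> (g x) $ i - \<eta> (h x) $ i) (2 * \<theta> / R * S i * d)"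
      by (rule ps_bound_lipschitz[OF c c0 R \<theta>(1,2) that(1)]) (use that in \<open>auto simp: s_def\<close>)
    moreover have "2 * \<theta> / R * S i * d \<le> 1/2 * 1 * d"
      using \<theta> S d0 R has_ps_nonneg[OF c, of i] by (intro mult_right_mono mult_mono) auto
    ultimately show ?thesis using ps_bound_mono by fastforce
  qed
  have s2: "s / 2 > 0" using s by simp
  \<comment> \<open>With A y of norm at most s / 2 and \<eta> contributing at most s / 2, all
    iterates stay in the ball of radius s.\<close>
  from ps_bound_uniform_small[of "\<lambda>i z. A z $ i", OF analytic_at_linear[OF linA] s2, of 0]
  obtain \<sigma> where \<sigma>: "\<sigma> > 0" and "\<forall>i. ps_bound \<sigma> (\<lambda>y. A (0 + y) $ i - A 0 $ i) (s / 2)"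
    by (elim exE conjE)
  then have Ab: "\<And>i. ps_bound \<sigma> (\<lambda>y. A y $ i) (s / 2)" using linear_0[OF A(1)] by simp
  define G where "G = rec_nat (\<lambda>y. 0) (\<lambda>m g y. A y + \<eta> (g y))"
  have G0: "G 0 y = 0" and GS: "G (Suc m) y = A y + \<eta> (G m y)" for m y by (simp_all add: G_def)
  have z: "ps_bound \<sigma> (\<lambda>y::real^'n. (0::real^'n) $ i) s" for i
    using ps_bound_mono[OF ps_bound_const[of \<sigma> 0], of s] s by simp
  have B: "ps_bound \<sigma> (\<lambda>y. G m y $ i) s" for m i
  proof (induction m arbitrary: i)
    case 0
    then show ?case using z by (simp add: G0)
  next
    case (Suc m)
    have "ps_bound \<sigma> (\<lambda>y. \<eta> (G m y) $ i - \<eta> 0 $ i) (s / 2)"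
      by (rule lip[OF \<sigma> Suc z]) (use Suc in simp)
    from ps_bound_add[OF \<sigma> Ab this] show ?case by (simp add: GS \<eta>0)
  qed
  have D: "ps_bound \<sigma> (\<lambda>y. G (Suc m) y $ i - G m y $ i) (s * (1/2) ^ Suc m)" for m i
  proof (induction m arbitrary: i)
    case 0
    then show ?case using Ab by (simp add: G0 GS \<eta>0)
  next
    case (Suc m)
    have "ps_bound \<sigma> (\<lambda>y. \<eta> (G (Suc m) y) $ i - \<eta> (G m y) $ i) (s * (1/2) ^ Suc m / 2)"
      by (rule lip[OF \<sigma> B B Suc])
    then show ?case by (simp add: GS[of "Suc m"] GS[of m, symmetric]) (simp add: GS)
  qed
  \<comment> \<open>The limit of the iteration as a telescoping series; by \<open>D\<close> the
    norms of its terms are bounded by a geometric series with sum s.\<close>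
  define P :: "real^'n \<Rightarrow> real^'n" where "P y = (\<chi> i. \<Sum>m. G (Suc m) y $ i - G m y $ i)" for y
  have ssum: "(\<lambda>m. s * (1/2) ^ Suc m) sums s" using sums_mult[OF power_half_series, of s] by simp
  have dsum: "summable (\<lambda>m. norm (G (Suc m) y $ i - G m y $ i))" if "y \<in> cube \<sigma>" for y i
    by (rule summable_comparison_test'[OF sums_summable[OF ssum], of 0]) (use ps_bound_abs[OF D that] in auto)
  have Psums: "(\<lambda>m. G (Suc m) y $ i - G m y $ i) sums (P y $ i)" if "y \<in> cube \<sigma>" for y i
    using summable_sums[OF summable_norm_cancel[OF dsum[OF that]]] by (simp add: P_def)
  have Pb: "ps_bound \<sigma> (\<lambda>y. P y $ i) s" for i
  proof (rule ps_bound_has_sum[OF \<sigma> D])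
    show "((\<lambda>m. s * (1/2) ^ Suc m) has_sum s) UNIV"
      by (rule sums_nonneg_imp_has_sum[OF ssum]) (use s in auto)
    show "((\<lambda>m. G (Suc m) y $ i - G m y $ i) has_sum P y $ i) UNIV" if "y \<in> cube \<sigma>" for y
      by (rule norm_summable_imp_has_sum[OF dsum[OF that] Psums[OF that]])
  qed
  have lim: "(\<lambda>n. G n y $ i) \<longlonglongrightarrow> P y $ i" if "y \<in> cube \<sigma>" for y i
  proof -
    have "(\<Sum>m<n. G (Suc m) y $ i - G m y $ i) = G n y $ i" for n
      by (subst sum_lessThan_telescope) (simp add: G0)
    then show ?thesis using Psums[OF that, of i] unfolding sums_def by simp
  qed
  have fixP: "P y = A y + \<eta> (P y)" if y: "y \<in> cube \<sigma>" for y
  proof -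
    have "(\<lambda>n. \<eta> (G n y) $ i) \<longlonglongrightarrow> \<eta> (P y) $ i" for i
    proof (rule tendsto_sandwich[of "\<lambda>n. \<eta> (P y) $ i - (\<Sum>j\<in>UNIV. \<bar>G n y $ j - P y $ j\<bar>) / 2" _ _
            "\<lambda>n. \<eta> (P y) $ i + (\<Sum>j\<in>UNIV. \<bar>G n y $ j - P y $ j\<bar>) / 2"])
      \<comment> \<open>For fixed y the values are regarded as constant functions, which turns
        \<open>lip\<close> into a Lipschitz estimate for numbers; the radius 1 and the point 0 are
        arbitrary.\<close>
      have bnd: "\<bar>\<eta> (G n y) $ i - \<eta> (P y) $ i\<bar> \<le> (\<Sum>j\<in>UNIV. \<bar>G n y $ j - P y $ j\<bar>) / 2" for n
      proof (rule ps_bound_abs[of 1 _ _ "0::real^'n"])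
        show "ps_bound 1 (\<lambda>x::real^'n. \<eta> (G n y) $ i - \<eta> (P y) $ i) ((\<Sum>j\<in>UNIV. \<bar>G n y $ j - P y $ j\<bar>) / 2)"
        proof (rule lip)
          show "ps_bound 1 (\<lambda>x::real^'n. G n y $ i) s" for i
            using ps_bound_mono[OF ps_bound_const ps_bound_abs[OF B y]] .
          show "ps_bound 1 (\<lambda>x::real^'n. P y $ i) s" for i
            using ps_bound_mono[OF ps_bound_const ps_bound_abs[OF Pb y]] .
          show "ps_bound 1 (\<lambda>x::real^'n. G n y $ i - P y $ i) (\<Sum>j\<in>UNIV. \<bar>G n y $ j - P y $ j\<bar>)" for i
            by (rule ps_bound_mono[OF ps_bound_const]) (rule member_le_sum, auto)
        qed simp
      qed (simp add: zero_in_cube)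
      show "\<forall>\<^sub>F n in sequentially. \<eta> (P y) $ i - (\<Sum>j\<in>UNIV. \<bar>G n y $ j - P y $ j\<bar>) / 2 \<le> \<eta> (G n y) $ i"
        by (rule always_eventually) (use bnd in \<open>smt (verit)\<close>)
      show "\<forall>\<^sub>F n in sequentially. \<eta> (G n y) $ i \<le> \<eta> (P y) $ i + (\<Sum>j\<in>UNIV. \<bar>G n y $ j - P y $ j\<bar>) / 2"
        by (rule always_eventually) (use bnd in \<open>smt (verit)\<close>)
      have l0: "(\<lambda>n. \<Sum>j\<in>UNIV. \<bar>G n y $ j - P y $ j\<bar>) \<longlonglongrightarrow> 0"
        by (rule tendsto_null_sum, rule tendsto_rabs_zero, rule LIM_zero, rule lim[OF y])
      show "(\<lambda>n. \<eta> (P y) $ i - (\<Sum>j\<in>UNIV. \<bar>G n y $ j - P y $ j\<bar>) / 2) \<longlonglongrightarrow> \<eta> (P y) $ i"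
        using tendsto_diff[OF tendsto_const tendsto_divide[OF l0 tendsto_const[of 2]]] by simp
      show "(\<lambda>n. \<eta> (P y) $ i + (\<Sum>j\<in>UNIV. \<bar>G n y $ j - P y $ j\<bar>) / 2) \<longlonglongrightarrow> \<eta> (P y) $ i"
        using tendsto_add[OF tendsto_const tendsto_divide[OF l0 tendsto_const[of 2]]] by simp
    qed
    then have "(\<lambda>n. A y $ i + \<eta> (G n y) $ i) \<longlonglongrightarrow> A y $ i + \<eta> (P y) $ i" for i
      by (intro tendsto_add tendsto_const)
    then have "(\<lambda>n. G (Suc n) y $ i) \<longlonglongrightarrow> A y $ i + \<eta> (P y) $ i" for i by (simp add: GS)
    then have "A y $ i + \<eta> (P y) $ i = P y $ i" for i
      using LIMSEQ_unique LIMSEQ_Suc[OF lim[OF y]] by blast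
    then show ?thesis by (simp add: vec_eq_iff)
  qed
  have \<phi>P: "\<phi> (p + P y) = \<phi> p + y" if y: "y \<in> cube \<sigma>" for y
  proof -
    have "A (\<phi> (p + P y) - \<phi> p) = A y" using fixP[OF y] by (simp add: \<eta>_def algebra_simps)
    then have "\<phi>' (A (\<phi> (p + P y) - \<phi> p)) = \<phi>' (A y)" by simp
    then show ?thesis by (simp add: A(3) algebra_simps)
  qed
  have "G n 0 = 0" for n by (induction n) (simp_all add: G0 GS \<eta>0 linear_0[OF A(1)])
  then have P0: "P 0 = 0" by (simp add: P_def vec_eq_iff)
  have Pan: "analytic_at (\<lambda>y. P y $ i) 0" for i by (rule analytic_atI[OF \<sigma>]) (use Pb in simp)
  obtain e where e: "e > 0" "ball p e \<subseteq> U" using U openE by blast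
  obtain \<epsilon> where \<epsilon>: "\<epsilon> > 0" "\<And>x::real^'n. x \<in> cube \<epsilon> \<Longrightarrow> norm x < e" using cube_norm_less[OF e(1)] by blast
  obtain e' where e': "e' > 0" "ball (\<phi> p) e' \<subseteq> V" using V openE by blast
  obtain \<tau> where \<tau>: "\<tau> > 0" "\<And>x::real^'n. x \<in> cube \<tau> \<Longrightarrow> norm x < e'" using cube_norm_less[OF e'(1)] by blast
  from ps_bound_uniform_small[of "\<lambda>i y. P y $ i", OF Pan \<epsilon>(1)]
  obtain \<rho> where \<rho>: "\<rho> > 0" and "\<forall>i. ps_bound \<rho> (\<lambda>y. P (0 + y) $ i - P 0 $ i) \<epsilon>" by (elim exE conjE)
  then have Pe: "\<And>i. ps_bound \<rho> (\<lambda>y. P y $ i) \<epsilon>" by (simp add: P0)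
  define \<kappa> where "\<kappa> = min \<sigma> (min \<rho> \<tau>)"
  have \<kappa>: "\<kappa> > 0" "\<kappa> \<le> \<sigma>" "\<kappa> \<le> \<rho>" "\<kappa> \<le> \<tau>" using \<sigma> \<rho> \<tau> by (auto simp: \<kappa>_def)
  \<comment> \<open>For small y both p + P y and \<psi> (\<phi> p + y) lie in U and have the same
    image under \<phi>, so injectivity identifies the series with the given inverse.\<close>
  have eq: "p + P y = \<psi> (\<phi> p + y)" if y: "y \<in> cube \<kappa>" for y
  proof -
    have ys: "y \<in> cube \<sigma>" "y \<in> cube \<rho>" "y \<in> cube \<tau>" using y \<kappa> cube_mono by blast+
    have "P y \<in> cube \<epsilon>" unfolding cube_def using ps_bound_abs[OF Pe ys(2)] by blast
    from \<epsilon>(2)[OF this] have pU: "p + P y \<in> U" using e by (auto simp: dist_norm subset_iff)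
    have "\<phi> p + y \<in> V" using \<tau>(2)[OF ys(3)] e' by (auto simp: dist_norm subset_iff)
    from \<psi>[OF this] \<phi>P[OF ys(1)] pU show ?thesis
      using inj_onD[OF U(3), of "p + P y" "\<psi> (\<phi> p + y)"] by simp
  qed
  show ?thesis
  proof (rule analytic_atI[OF \<kappa>(1)], rule ps_bound_cong)
    show "ps_bound \<kappa> (\<lambda>y. p $ i + P y $ i) (\<bar>p $ i\<bar> + s)"
      by (intro ps_bound_add ps_bound_const ps_bound_shrink[OF Pb] \<kappa>)
    show "p $ i + P y $ i = \<psi> (\<phi> p + y) $ i" if "y \<in> cube \<kappa>" for y
      using eq[OF that] by (metis vector_add_component)
  qed
qed

section \<open>Regularity classes\<close>

text \<open>The class of first derivatives: smooth and analytic functions lose nothing. The lemmas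
  that pass to it assume order at least 1, so the subtraction is not truncated there.\<close>

fun lower :: "regularity \<Rightarrow> regularity" where
  "lower (Fin k) = Fin (k - 1)"
| "lower Infty = Infty"
| "lower Omega = Omega"

definition order_ge :: "nat \<Rightarrow> regularity \<Rightarrow> bool" where
  "order_ge m r \<longleftrightarrow> (\<forall>k. r = Fin k \<longrightarrow> m \<le> k)"

lemma order_ge_simps [simp]: "order_ge m (Fin k) \<longleftrightarrow> m \<le> k" "order_ge m Infty" "order_ge m Omega"
  by (auto simp: order_ge_def)

lemma order_ge_lower: "order_ge (Suc m) r \<Longrightarrow> order_ge m (lower r)"
  by (cases r) auto

lemma order_ge_mono: "order_ge m r \<Longrightarrow> n \<le> m \<Longrightarrow> order_ge n r"
  by (cases r) auto

lemma reg_fun_simps: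
  assumes "open U"
  shows "reg_fun (Fin k) \<alpha> U F \<longleftrightarrow> CK k \<alpha> U F"
    "reg_fun Infty \<alpha> U F \<longleftrightarrow> (\<forall>k. CK k 0 U F)"
    "reg_fun Omega \<alpha> U F \<longleftrightarrow> (\<forall>p\<in>U. analytic_at F p)"
  by (simp_all add: reg_fun_def Ck_alpha_on_iff_CK Ck_on_iff_CK real_analytic_on_iff_analytic_at assms)

context
  fixes \<alpha> :: real
  assumes \<alpha>: "0 \<le> \<alpha>" "\<alpha> \<le> 1"
begin

lemma reg_fun_subset:
  assumes "open U" "open V" "V \<subseteq> U" "reg_fun r \<alpha> U f"
  shows "reg_fun r \<alpha> V f"
  using assms(4) CK_subset[OF _ assms(3)] assms(3)
  by (cases r) (auto simp: reg_fun_simps[OF assms(1)] reg_fun_simps[OF assms(2)])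

lemma reg_fun_const: "open U \<Longrightarrow> reg_fun r \<alpha> U (\<lambda>x. c)"
  by (cases r) (simp_all add: reg_fun_simps CK_const analytic_at_const)

lemma reg_fun_add:
  assumes "open U" "reg_fun r \<alpha> U f" "reg_fun r \<alpha> U g"
  shows "reg_fun r \<alpha> U (\<lambda>x. f x + g x)"
  using assms(2,3) by (cases r) (simp_all add: reg_fun_simps[OF assms(1)] CK_add[OF _ _ assms(1)] \<alpha> analytic_at_add)

lemma reg_fun_mult:
  assumes "open U" "reg_fun r \<alpha> U f" "reg_fun r \<alpha> U g"
  shows "reg_fun r \<alpha> U (\<lambda>x. f x * g x)"
  using assms(2,3) by (cases r) (simp_all add: reg_fun_simps[OF assms(1)] CK_mult[OF _ _ assms(1)] \<alpha> analytic_at_mult)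

lemma reg_fun_inverse:
  assumes "open U" "reg_fun r \<alpha> U f" "\<And>x. x \<in> U \<Longrightarrow> f x \<noteq> 0"
  shows "reg_fun r \<alpha> U (\<lambda>x. inverse (f x))"
  using assms(2,3) by (cases r) (simp_all add: reg_fun_simps[OF assms(1)] CK_inverse[OF _ _ assms(1)] \<alpha> analytic_at_inverse)

lemma reg_fun_sum:
  assumes "open U" "finite I" "\<And>i. i \<in> I \<Longrightarrow> reg_fun r \<alpha> U (f i)"
  shows "reg_fun r \<alpha> U (\<lambda>x. \<Sum>i\<in>I. f i x)"
  using assms(2,3)
  by (induction I rule: finite_induct) (auto intro: reg_fun_const[OF assms(1)] reg_fun_add[OF assms(1)])

lemma reg_fun_linear:
  fixes f :: "real^'n \<Rightarrow> real"
  assumes "open U" "linear f"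
  shows "reg_fun r \<alpha> U f"
  by (cases r) (simp_all add: reg_fun_simps[OF assms(1)] CK_linear_func[OF _ _ assms] \<alpha> analytic_at_linear[OF assms(2)])

lemma reg_fun_compose:
  fixes f :: "real^'n \<Rightarrow> real" and g :: "real^'m \<Rightarrow> real^'n"
  assumes r: "order_ge 1 r" and U: "open U" and V: "open V" and g: "\<And>x. x \<in> U \<Longrightarrow> g x \<in> V"
    and gr: "\<And>i. reg_fun r \<alpha> U (\<lambda>x. g x $ i)" and f: "reg_fun r \<alpha> V f"
  shows "reg_fun r \<alpha> U (\<lambda>x. f (g x))"
proof (cases r)
  case (Fin k)
  have gk: "CK k \<alpha> U (\<lambda>x. g x $ i)" for i using gr Fin by (simp add: reg_fun_simps[OF U])
  have "CK 1 0 U (\<lambda>x. g x $ i)" for i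
    using CK_le[OF U _ _ CK_weaken[OF U gk[of i]], of 1] r Fin by simp
  then have "CK k \<alpha> U (\<lambda>x. f (g x))"
    using f Fin by (intro CK_compose[OF \<alpha> U V g _ gk]) (simp_all add: reg_fun_simps[OF V])
  then show ?thesis using Fin by (simp add: reg_fun_simps[OF U])
next
  case Infty
  have gk: "CK k 0 U (\<lambda>x. g x $ i)" for i k using gr Infty by (simp add: reg_fun_simps[OF U])
  have "CK k 0 U (\<lambda>x. f (g x))" for k
    using f Infty by (intro CK_compose[OF _ _ U V g gk gk]) (simp_all add: reg_fun_simps[OF V])
  then show ?thesis using Infty by (simp add: reg_fun_simps[OF U])
next
  case Omega
  have "analytic_at (\<lambda>x. f (g x)) p" if "p \<in> U" for p
    using gr f g[OF that] that Omega
    by (intro analytic_at_compose[of f g]) (simp_all add: reg_fun_simps[OF U] reg_fun_simps[OF V])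
  then show ?thesis using Omega by (simp add: reg_fun_simps[OF U])
qed

lemma reg_fun_lower:
  assumes "open U" "order_ge 1 r" "reg_fun r \<alpha> U f"
  shows "reg_fun (lower r) \<alpha> U f"
proof (cases r)
  case (Fin k)
  then obtain m where "k = Suc m" using assms by (cases k) auto
  then show ?thesis using assms Fin CK_lower[OF assms(1) \<alpha>] by (simp add: reg_fun_simps)
qed (use assms in auto)

lemma reg_fun_deriv:
  fixes f :: "real^'n \<Rightarrow> real"
  assumes U: "open U" and r: "order_ge 1 r" and f: "reg_fun r \<alpha> U f"
    and d: "\<And>x. x \<in> U \<Longrightarrow> (f has_derivative f' x) (at x)"
  shows "reg_fun (lower r) \<alpha> U (\<lambda>x. f' x h)"
proof (cases r)
  case (Fin k)
  then obtain m where m: "k = Suc m" using r by (cases k) auto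
  then have "CK (Suc m) \<alpha> U f" using f Fin by (simp add: reg_fun_simps[OF U])
  then show ?thesis using CK_deriv[OF \<alpha> U _ d] Fin m by (simp add: reg_fun_simps[OF U])
next
  case Infty
  then have "CK (Suc k) 0 U f" for k using f by (simp add: reg_fun_simps[OF U])
  then show ?thesis using CK_deriv[OF _ _ U _ d, of 0] Infty by (simp add: reg_fun_simps[OF U])
next
  case Omega
  then show ?thesis using f analytic_at_deriv[OF _ U _ d] by (simp add: reg_fun_simps[OF U])
qed

text \<open>This recovers the lost degree. The function that defines the boundary of the sum is at
  first known one degree below r, but so is its explicit gradient.\<close>

lemma reg_fun_raise:
  fixes f :: "real^'n \<Rightarrow> real"
  assumes U: "open U" and r: "order_ge 1 r" and f: "reg_fun (lower r) \<alpha> U f"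
    and d: "\<And>x. x \<in> U \<Longrightarrow> (f has_derivative f' x) (at x)"
    and f': "\<And>i. reg_fun (lower r) \<alpha> U (\<lambda>x. f' x (axis i 1))"
  shows "reg_fun r \<alpha> U f"
proof (cases r)
  case (Fin k)
  then obtain m where m: "k = Suc m" using r by (cases k) auto
  then show ?thesis using CK_SucI[of U f f' m \<alpha>] f' d Fin by (simp add: reg_fun_simps[OF U])
qed (use f in auto)

lemma reg_fun_C1:
  fixes f :: "real^'n \<Rightarrow> real"
  assumes U: "open U" and r: "order_ge 1 r" and f: "reg_fun r \<alpha> U f"
  shows "\<exists>f'. (\<forall>x\<in>U. (f has_derivative f' x) (at x)) \<and> (\<forall>h. continuous_on U (\<lambda>x. f' x h))"
proof -
  have "\<forall>x. \<exists>L. x \<in> U \<longrightarrow> (f has_derivative L) (at x)"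
  proof (cases r)
    case (Fin k)
    then obtain m where m: "k = Suc m" using r by (cases k) auto
    then show ?thesis using f Fin by (auto simp: reg_fun_simps[OF U] CK.simps(2))
  next
    case Infty
    then have "CK (Suc 0) 0 U f" using f unfolding reg_fun_simps[OF U] Infty by blast
    then show ?thesis by (auto simp: CK.simps(2))
  next
    case Omega
    then show ?thesis using f analytic_at_has_derivative by (auto simp: reg_fun_simps[OF U])
  qed
  from choice[OF this] obtain f' where d: "\<And>x. x \<in> U \<Longrightarrow> (f has_derivative f' x) (at x)" by blast
  have "continuous_on U (\<lambda>x. f' x h)" for h
  proof -
    have "reg_fun (lower r) \<alpha> U (\<lambda>x. f' x h)" by (rule reg_fun_deriv[OF U r f d])
    then show ?thesis
    proof (cases r)
      case Infty
      then have "\<forall>k. CK k 0 U (\<lambda>x. f' x h)"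
        using \<open>reg_fun (lower r) \<alpha> U (\<lambda>x. f' x h)\<close> by (simp add: reg_fun_simps[OF U])
      then show ?thesis by (intro CK_imp_continuous_on[OF U]) (rule spec)
    next
      case (Fin k)
      then have "CK (k - 1) \<alpha> U (\<lambda>x. f' x h)"
        using \<open>reg_fun (lower r) \<alpha> U (\<lambda>x. f' x h)\<close> by (simp add: reg_fun_simps[OF U])
      then show ?thesis by (rule CK_imp_continuous_on[OF U])
    qed (auto simp: reg_fun_simps[OF U] continuous_on_eq_continuous_at[OF U] intro: analytic_at_isCont)
  qed
  with d show ?thesis by blast
qed

lemma reg_map_C1:
  fixes \<phi> :: "real^'m \<Rightarrow> real^'n"
  assumes U: "open U" and r: "order_ge 1 r" and \<phi>: "\<And>i. reg_fun r \<alpha> U (\<lambda>x. \<phi> x $ i)"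
  shows "\<exists>\<phi>'. (\<forall>x\<in>U. (\<phi> has_derivative \<phi>' x) (at x)) \<and> (\<forall>h. continuous_on U (\<lambda>x. \<phi>' x h))"
proof -
  have "\<forall>i. \<exists>f'. (\<forall>x\<in>U. ((\<lambda>x. \<phi> x $ i) has_derivative f' x) (at x)) \<and> (\<forall>h. continuous_on U (\<lambda>x. f' x h))"
    using reg_fun_C1[OF U r \<phi>] by (rule allI)
  from choice[OF this] obtain f' where f': "\<And>i x. x \<in> U \<Longrightarrow> ((\<lambda>x. \<phi> x $ i) has_derivative f' i x) (at x)"
    "\<And>i h. continuous_on U (\<lambda>x. f' i x h)" by blast
  show ?thesis
  proof (intro exI[of _ "\<lambda>x h. \<chi> i. f' i x h"] conjI ballI allI)
    show "(\<phi> has_derivative (\<lambda>h. \<chi> i. f' i x h)) (at x)" if "x \<in> U" for x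
      using f'(1)[OF that] by (subst has_derivative_cart_iff) simp
    show "continuous_on U (\<lambda>x. \<chi> i. f' i x h)" for h using f'(2) by (intro continuous_on_vec_lambda)
  qed
qed

text \<open>The inverse function theorem provides \<psi>. Its regularity comes from Cramer's rule in
  the differentiable classes, with exponent 0 and all orders in the smooth one, and from Picard
  iteration in the analytic one.\<close>

theorem reg_inverse_map:
  fixes \<phi> :: "real^'n \<Rightarrow> real^'n"
  assumes U: "open U" "p \<in> U" and r: "order_ge 1 r" and \<phi>: "\<And>i. reg_fun r \<alpha> U (\<lambda>x. \<phi> x $ i)"
    and deriv: "\<forall>x\<in>U. (\<phi> has_derivative \<phi>' x) (at x)"
    and inj: "\<forall>z. \<phi>' p z = 0 \<longrightarrow> z = 0"
  shows "\<exists>U' V \<psi> \<psi>'. open U' \<and> U' \<subseteq> U \<and> p \<in> U' \<and> open V \<and> \<phi> p \<in> V \<and>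
    (\<forall>x\<in>U'. \<phi> x \<in> V \<and> \<psi> (\<phi> x) = x) \<and> (\<forall>y\<in>V. \<psi> y \<in> U' \<and> \<phi> (\<psi> y) = y) \<and>
    (\<forall>y\<in>V. (\<psi> has_derivative \<psi>' y) (at y)) \<and> (\<forall>y\<in>V. \<forall>h. \<phi>' (\<psi> y) (\<psi>' y h) = h) \<and>
    (\<forall>i. reg_fun r \<alpha> V (\<lambda>y. \<psi> y $ i))"
proof -
  note d = bspec[OF deriv]
  from reg_map_C1[OF U(1) r \<phi>] obtain D where
    D: "\<And>x. x \<in> U \<Longrightarrow> (\<phi> has_derivative D x) (at x)" "\<And>h. continuous_on U (\<lambda>x. D x h)"
    by blast
  have D\<phi>': "D x = \<phi>' x" if "x \<in> U" for x using has_derivative_unique[OF D(1) d] that by blast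
  \<comment> \<open>The inverse function theorem asks for a derivative that is continuous in
    operator norm; in finite dimension this follows from continuity in each direction.\<close>
  define f' where "f' x = Blinfun (D x)" for x
  have f': "blinfun_apply (f' x) = D x" if "x \<in> U" for x
    unfolding f'_def using has_derivative_bounded_linear[OF D(1)[OF that]] by (rule bounded_linear_Blinfun_apply)
  have cont: "continuous_on U f'"
  proof (rule continuous_on_blinfun_componentwise)
    show "continuous_on U (\<lambda>x. blinfun_apply (f' x) i)" for i
      using D(2)[of i] f' by (simp cong: continuous_on_cong)
  qed
  have lin: "linear (D p)" using D(1)[OF U(2)] has_derivative_linear by blast
  have "inj (D p)" using lin inj D\<phi>'[OF U(2)] by (simp add: linear_injective_0)
  then obtain g where g: "linear g" "g \<circ> D p = id" using linear_injective_left_inverse[OF lin] by blast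
  have gb: "bounded_linear g" using g(1) by (simp add: linear_conv_bounded_linear)
  have "Blinfun g o\<^sub>L f' p = id_blinfun"
    by (rule blinfun_eqI) (use g(2) f'[OF U(2)] gb in \<open>simp add: bounded_linear_Blinfun_apply o_def fun_eq_iff\<close>)
  then obtain U' V \<psi> \<psi>' where 1: "open U'" "U' \<subseteq> U" "p \<in> U'" "open V" "\<phi> p \<in> V" "homeomorphism U' V \<phi> \<psi>"
    "\<And>y. y \<in> V \<Longrightarrow> (\<psi> has_derivative (\<psi>' y)) (at y)"
    "\<And>y. y \<in> V \<Longrightarrow> \<psi>' y = inv (blinfun_apply (f' (\<psi> y)))"
    "\<And>y. y \<in> V \<Longrightarrow> bij (blinfun_apply (f' (\<psi> y)))"
    using inverse_function_theorem[OF U(1) _ cont U(2), of \<phi>] f' D(1) by metis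
  have 2: "\<And>x. x \<in> U' \<Longrightarrow> \<phi> x \<in> V \<and> \<psi> (\<phi> x) = x" and 3: "\<And>y. y \<in> V \<Longrightarrow> \<psi> y \<in> U' \<and> \<phi> (\<psi> y) = y"
    using 1(6) unfolding homeomorphism_def by auto
  have bl: "blinfun_apply (f' (\<psi> y)) = \<phi>' (\<psi> y)" if "y \<in> V" for y
    using f' D\<phi>' 3[OF that] 1(2) by auto
  have 4: "\<phi>' (\<psi> y) (\<psi>' y h) = h" if "y \<in> V" for y h
    using 1(8,9)[OF that] bl[OF that] by (simp add: bij_is_surj surj_f_inv_f)
  have 5: "\<psi>' y (\<phi>' (\<psi> y) h) = h" if "y \<in> V" for y h
    using 1(8,9)[OF that] bl[OF that] by (simp add: bij_is_inj)
  have d': "(\<phi> has_derivative \<phi>' x) (at x)" if "x \<in> U'" for x using d 1(2) that by blast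
  have det: "det (matrix (\<phi>' x)) \<noteq> 0" if "x \<in> U'" for x
  proof -
    have y: "\<phi> x \<in> V" "\<psi> (\<phi> x) = x" using 2[OF that] by auto
    have l: "linear (\<phi>' x)" using d'[OF that] has_derivative_linear by blast
    have "bij (\<phi>' x)" using 1(9)[OF y(1)] bl[OF y(1)] y(2) by simp
    then show ?thesis using det_nz_iff_inj[OF l] bij_is_inj by blast
  qed
  have 6: "reg_fun r \<alpha> V (\<lambda>y. \<psi> y $ i)" for i
  proof (cases r)
    case (Fin k)
    then obtain m where m: "k = Suc m" using r by (cases k) auto
    have "CK (Suc m) \<alpha> U' (\<lambda>x. \<phi> x $ i)" for i
      using \<phi> CK_subset[OF _ 1(2)] Fin m by (simp add: reg_fun_simps[OF U(1)])
    from CK_inverse_map[OF \<alpha> 1(1,4) _ d' 1(7) 4 det this] 3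
    show ?thesis using Fin m by (simp add: reg_fun_simps[OF 1(4)])
  next
    case Infty
    have "CK (Suc m) 0 U' (\<lambda>x. \<phi> x $ i)" for i m
      using \<phi> CK_subset[OF _ 1(2)] Infty by (simp add: reg_fun_simps[OF U(1)])
    from CK_inverse_map[OF _ _ 1(1,4) _ d' 1(7) 4 det this] 3
    have "CK (Suc m) 0 V (\<lambda>y. \<psi> y $ i)" for m by simp
    then have "CK m 0 V (\<lambda>y. \<psi> y $ i)" for m using CK_lower[OF 1(4)] by simp
    then show ?thesis using Infty by (simp add: reg_fun_simps[OF 1(4)])
  next
    case Omega
    have "analytic_at (\<lambda>y. \<psi> y $ i) y" if y: "y \<in> V" for y
    proof -
      have x: "\<psi> y \<in> U'" "\<phi> (\<psi> y) = y" using 3[OF y] by auto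
      have "analytic_at (\<lambda>y. \<psi> y $ i) (\<phi> (\<psi> y))"
      proof (rule analytic_at_inverse_map[where \<phi> = \<phi> and \<psi> = \<psi> and p = "\<psi> y" and \<phi>' = "\<phi>' (\<psi> y)" and A = "\<psi>' y" and U = U' and V = V])
        show "analytic_at (\<lambda>x. \<phi> x $ i) (\<psi> y)" for i
          using \<phi>[of i] Omega x(1) 1(2) by (auto simp: reg_fun_simps[OF U(1)])
        show "linear (\<psi>' y)" using 1(7)[OF y] has_derivative_linear by blast
        show "inj_on \<phi> U'" using 2 by (metis inj_onI)
      qed (use 1 2 3 4 5 d' x y in auto)
      then show ?thesis using x by simp
    qed
    then show ?thesis using Omega by (simp add: reg_fun_simps[OF 1(4)])
  qed
  show ?thesis
    by (rule exI[of _ U'], rule exI[of _ V], rule exI[of _ \<psi>], rule exI[of _ \<psi>'])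
      (simp add: 1(1-5,7) 2 3 4 6)
qed

end

section \<open>Boundary charts of convex bodies\<close>

definition supports :: "'a::real_inner set \<Rightarrow> 'a \<Rightarrow> 'a \<Rightarrow> bool" where
  "supports C x u \<longleftrightarrow> (\<forall>y\<in>C. (y - x) \<bullet> u \<le> 0)"

text \<open>A ball around c inside C leaves room for a step in the direction u, and the supporting
  inequality still holds after it.\<close>

lemma supports_interior:
  assumes "supports C x u" "u \<noteq> 0" "c \<in> interior C"
  shows "(c - x) \<bullet> u < 0"
proof -
  obtain e where e: "e > 0" "cball c e \<subseteq> C" using assms(3) mem_interior_cball by blast
  define y where "y = c + (e / norm u) *\<^sub>R u"
  have "y \<in> C" using e assms(2) by (auto simp: y_def dist_norm subset_iff)
  then have "(y - x) \<bullet> u \<le> 0" using assms(1) by (simp add: supports_def)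
  moreover have "(y - x) \<bullet> u = (c - x) \<bullet> u + (e / norm u) * (u \<bullet> u)"
    by (simp add: y_def inner_simps)
  moreover have "(e / norm u) * (u \<bullet> u) > 0" using e assms(2) by simp
  ultimately show ?thesis by linarith
qed

lemma supports_scaleR: "supports C x u \<Longrightarrow> k \<ge> 0 \<Longrightarrow> supports C x (k *\<^sub>R u)"
  by (auto simp: supports_def mult_nonneg_nonpos)

lemma supports_frontier:
  fixes C :: "'a::euclidean_space set"
  assumes "supports C x u" "u \<noteq> 0" "x \<in> C"
  shows "x \<in> frontier C"
proof -
  have "x \<notin> interior C" using supports_interior[OF assms(1,2), of x] by auto
  then show ?thesis using assms(3) closure_subset by (auto simp: frontier_def)
qed

lemma frontier_supports:
  fixes C :: "(real^'n) set"
  assumes "convex_body C" "x \<in> frontier C"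
  obtains u where "norm u = 1" "supports C x u"
proof -
  have C: "convex C" "compact C" "interior C \<noteq> {}" using assms(1) by (auto simp: convex_body_def)
  have x: "x \<in> C" using assms(2) C(2) by (simp add: frontier_def compact_imp_closed)
  have "x \<notin> rel_interior C"
    using assms(2) C(3) rel_interior_nonempty_interior by (auto simp: frontier_def)
  then obtain a where a: "a \<noteq> 0" "\<And>y. y \<in> C \<Longrightarrow> a \<bullet> x \<le> a \<bullet> y"
    by (metis (no_types) supporting_hyperplane_rel_boundary[OF C(1) x])
  define u where "u = - (1 / norm a) *\<^sub>R a"
  have "norm u = 1" using a by (simp add: u_def)
  moreover have "supports C x u"
    unfolding supports_def
  proof
    fix y assume "y \<in> C"
    then have "0 \<le> (y - x) \<bullet> a" using a(2)[of y] by (simp add: inner_commute[of _ a] inner_diff_right)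
    then show "(y - x) \<bullet> u \<le> 0" by (simp add: u_def divide_nonneg_nonneg)
  qed
  ultimately show ?thesis by (rule that)
qed

section \<open>Symmetry of the Hessian\<close>

lemma isCont_tendsto_nhds: "isCont f x \<Longrightarrow> (f \<longlongrightarrow> f x) (nhds x)"
  by (simp add: isCont_def tendsto_at_iff_tendsto_nhds)

lemma dist_self_add: "dist x (x + v) = norm (v::'a::real_normed_vector)"
  by (simp add: dist_norm)

text \<open>The gradient g is only differentiated at the single point x: the mean value theorem
  along a turns the second difference into an increment of g, which H evaluates up to an error
  o(s).\<close>

lemma second_difference:
  fixes F :: "'a::euclidean_space \<Rightarrow> real"
  assumes U: "open U" "x \<in> U" and dF: "\<forall>y\<in>U. (F has_derivative (\<lambda>h. g y \<bullet> h)) (at y)"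
    and dg: "(g has_derivative H) (at x)" and \<epsilon>: "\<epsilon> > 0"
  shows "\<exists>\<delta>>0. \<forall>s. 0 < s \<and> s < \<delta> \<longrightarrow>
    \<bar>F (x + s *\<^sub>R a + s *\<^sub>R b) - F (x + s *\<^sub>R a) - F (x + s *\<^sub>R b) + F x - s\<^sup>2 * (H b \<bullet> a)\<bar> \<le> \<epsilon> * s\<^sup>2"
proof -
  \<comment> \<open>Bounds (2 norm a + norm b) norm a, the factor with which the two linearisation
    errors enter; the added ones keep it positive.\<close>
  define K where "K = (2 * norm a + norm b + 1) * (norm a + 1)"
  have K: "K > 0" unfolding K_def by (intro mult_pos_pos add_nonneg_pos) auto
  obtain r where r: "r > 0" "ball x r \<subseteq> U" using U openE by blast
  obtain d where d: "d > 0" "\<And>y. norm (y - x) < d \<Longrightarrow> norm (g y - g x - H (y - x)) \<le> (\<epsilon> / K) * norm (y - x)"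
    using dg \<epsilon> K unfolding has_derivative_at_alt by (metis divide_pos_pos)
  define e where "e = min r d"
  define \<delta> where "\<delta> = e / (norm a + norm b + 1)"
  have e: "e > 0" using r d by (simp add: e_def)
  have ab: "norm a + norm b + 1 > 0" by (simp add: add_nonneg_pos)
  have \<delta>: "\<delta> > 0" using e ab by (simp add: \<delta>_def)
  have lin: "linear H" using dg has_derivative_linear by blast
  show ?thesis
  proof (intro exI conjI allI impI)
    show "\<delta> > 0" by (rule \<delta>)
    fix s :: real assume "0 < s \<and> s < \<delta>"
    then have s: "0 < s" "s < \<delta>" by auto
    have small: "norm (t *\<^sub>R a + q *\<^sub>R b) < e" if "0 \<le> t" "t \<le> s" "0 \<le> q" "q \<le> s" for t q
    proof -
      have "norm (t *\<^sub>R a + q *\<^sub>R b) \<le> norm (t *\<^sub>R a) + norm (q *\<^sub>R b)" by (rule norm_triangle_ineq)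
      also have "\<dots> = t * norm a + q * norm b" using that by simp
      also have "\<dots> \<le> s * norm a + s * norm b" using that by (intro add_mono mult_right_mono) auto
      also have "\<dots> \<le> s * (norm a + norm b + 1)" using s by (simp add: algebra_simps)
      also have "\<dots> < \<delta> * (norm a + norm b + 1)" using s ab by (intro mult_strict_right_mono) auto
      also have "\<dots> = e" using ab by (simp add: \<delta>_def)
      finally show ?thesis .
    qed
    have inU: "x + t *\<^sub>R a + q *\<^sub>R b \<in> U" if "0 \<le> t" "t \<le> s" "0 \<le> q" "q \<le> s" for t q
    proof -
      have "dist x (x + (t *\<^sub>R a + q *\<^sub>R b)) < r" using small[OF that] by (simp add: dist_self_add e_def)
      then show ?thesis using r by (auto simp: add.assoc)
    qed
    \<comment> \<open>The difference of F on two parallel segments; its increment from 0 to s is the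
      second difference.\<close>
    define \<phi> where "\<phi> t = F (x + t *\<^sub>R a + s *\<^sub>R b) - F (x + t *\<^sub>R a + 0 *\<^sub>R b)" for t
    have d1: "((\<lambda>t. F (x + t *\<^sub>R a + q *\<^sub>R b)) has_derivative (\<lambda>h. h * (g (x + t *\<^sub>R a + q *\<^sub>R b) \<bullet> a))) (at t)"
      if "0 \<le> t" "t \<le> s" "0 \<le> q" "q \<le> s" for t q
    proof -
      have "((\<lambda>t. x + t *\<^sub>R a + q *\<^sub>R b) has_derivative (\<lambda>h. h *\<^sub>R a)) (at t)"
        by (auto intro!: derivative_eq_intros)
      from has_derivative_compose[OF this bspec[OF dF inU[OF that]]] show ?thesis by simp
    qed
    have "\<exists>t>0. t < s \<and> \<phi> s - \<phi> 0 = (s - 0) * ((g (x + t *\<^sub>R a + s *\<^sub>R b) - g (x + t *\<^sub>R a + 0 *\<^sub>R b)) \<bullet> a)"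
    proof (rule MVT2[OF s(1)])
      fix t assume t: "0 \<le> t" "t \<le> s"
      have "(\<phi> has_derivative (\<lambda>h. h * (g (x + t *\<^sub>R a + s *\<^sub>R b) \<bullet> a) - h * (g (x + t *\<^sub>R a + 0 *\<^sub>R b) \<bullet> a))) (at t)"
        unfolding \<phi>_def by (intro has_derivative_diff d1) (use t s in auto)
      then show "DERIV \<phi> t :> (g (x + t *\<^sub>R a + s *\<^sub>R b) - g (x + t *\<^sub>R a + 0 *\<^sub>R b)) \<bullet> a"
        by (rule has_derivative_imp_has_field_derivative) (simp only: inner_diff_left right_diff_distrib)
    qed
    then obtain t where t: "0 < t" "t < s"
      "\<phi> s - \<phi> 0 = s * ((g (x + t *\<^sub>R a + s *\<^sub>R b) - g (x + t *\<^sub>R a + 0 *\<^sub>R b)) \<bullet> a)" by auto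
    define r1 where "r1 = g (x + t *\<^sub>R a + s *\<^sub>R b) - g x - H (t *\<^sub>R a + s *\<^sub>R b)"
    define r2 where "r2 = g (x + t *\<^sub>R a + 0 *\<^sub>R b) - g x - H (t *\<^sub>R a)"
    have n1: "norm r1 \<le> \<epsilon> / K * (s * (norm a + norm b))"
    proof -
      have "norm r1 \<le> \<epsilon> / K * norm (t *\<^sub>R a + s *\<^sub>R b)"
        using d(2)[of "x + t *\<^sub>R a + s *\<^sub>R b"] small[of t s] t s by (simp add: r1_def e_def add.assoc)
      also have "\<dots> \<le> \<epsilon> / K * (s * (norm a + norm b))"
      proof (rule mult_left_mono)
        have "norm (t *\<^sub>R a + s *\<^sub>R b) \<le> t * norm a + s * norm b"
          using norm_triangle_ineq[of "t *\<^sub>R a" "s *\<^sub>R b"] t s by simp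
        also have "\<dots> \<le> s * (norm a + norm b)" using t by (simp add: algebra_simps mult_right_mono)
        finally show "norm (t *\<^sub>R a + s *\<^sub>R b) \<le> s * (norm a + norm b)" .
      qed (use \<epsilon> K in simp)
      finally show ?thesis .
    qed
    have n2: "norm r2 \<le> \<epsilon> / K * (s * norm a)"
    proof -
      have "norm r2 \<le> \<epsilon> / K * norm (t *\<^sub>R a)"
        using d(2)[of "x + t *\<^sub>R a"] small[of t 0] t s by (simp add: r2_def e_def)
      also have "\<dots> \<le> \<epsilon> / K * (s * norm a)"
        by (rule mult_left_mono) (use \<epsilon> K t in \<open>auto simp: mult_right_mono\<close>)
      finally show ?thesis .
    qed
    have "g (x + t *\<^sub>R a + s *\<^sub>R b) - g (x + t *\<^sub>R a + 0 *\<^sub>R b) = s *\<^sub>R H b + (r1 - r2)"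
      by (simp add: r1_def r2_def linear_add[OF lin] linear_scale[OF lin])
    with t(3) have "\<phi> s - \<phi> 0 = s * ((s *\<^sub>R H b + (r1 - r2)) \<bullet> a)" by (simp only:)
    then have "\<phi> s - \<phi> 0 - s\<^sup>2 * (H b \<bullet> a) = s * ((r1 - r2) \<bullet> a)"
      by (simp add: inner_add_left power2_eq_square distrib_left)
    then have "\<bar>\<phi> s - \<phi> 0 - s\<^sup>2 * (H b \<bullet> a)\<bar> \<le> s * (norm (r1 - r2) * norm a)"
      using s Cauchy_Schwarz_ineq2[of "r1 - r2" a] by (simp add: abs_mult)
    also have "\<dots> \<le> s * ((\<epsilon> / K * (s * (2 * norm a + norm b))) * norm a)"
    proof -
      have "norm (r1 - r2) \<le> norm r1 + norm r2" by (rule norm_triangle_ineq4)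
      also have "\<dots> \<le> \<epsilon> / K * (s * (norm a + norm b)) + \<epsilon> / K * (s * norm a)" using n1 n2 by (rule add_mono)
      also have "\<dots> = \<epsilon> / K * (s * (2 * norm a + norm b))" by (simp add: algebra_simps)
      finally show ?thesis using s by (intro mult_left_mono mult_right_mono) auto
    qed
    also have "\<dots> = \<epsilon> * s\<^sup>2 * ((2 * norm a + norm b) * norm a / K)" by (simp add: power2_eq_square)
    also have "\<dots> \<le> \<epsilon> * s\<^sup>2 * 1"
    proof -
      have "(2 * norm a + norm b) * norm a \<le> K" unfolding K_def by (intro mult_mono) auto
      then have "(2 * norm a + norm b) * norm a / K \<le> 1" using K by simp
      then show ?thesis using \<epsilon> by (intro mult_left_mono) auto
    qed
    finally show "\<bar>F (x + s *\<^sub>R a + s *\<^sub>R b) - F (x + s *\<^sub>R a) - F (x + s *\<^sub>R b) + F x - s\<^sup>2 * (H b \<bullet> a)\<bar> \<le> \<epsilon> * s\<^sup>2"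
      by (simp add: \<phi>_def algebra_simps)
  qed
qed

text \<open>The second difference does not change when a and b are exchanged, and both values
  approximate it. Symmetry matters later because only a symmetric semidefinite form is sure to have
  all its null vectors in its kernel.\<close>

lemma hessian_symmetric:
  fixes F :: "'a::euclidean_space \<Rightarrow> real"
  assumes U: "open U" "x \<in> U" and dF: "\<forall>y\<in>U. (F has_derivative (\<lambda>h. g y \<bullet> h)) (at y)"
    and dg: "(g has_derivative H) (at x)"
  shows "H a \<bullet> b = H b \<bullet> a"
proof (rule ccontr)
  assume "H a \<bullet> b \<noteq> H b \<bullet> a"
  \<comment> \<open>Two errors of \<epsilon> s^2 cover only half of the supposed gap.\<close>
  define \<epsilon> where "\<epsilon> = \<bar>H a \<bullet> b - H b \<bullet> a\<bar> / 4"
  have \<epsilon>: "\<epsilon> > 0" using \<open>H a \<bullet> b \<noteq> H b \<bullet> a\<close> by (simp add: \<epsilon>_def)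
  from second_difference[OF U dF dg \<epsilon>, of a b]
  obtain \<delta>1 where 1: "\<delta>1 > 0" "\<And>s. 0 < s \<Longrightarrow> s < \<delta>1 \<Longrightarrow>
    \<bar>F (x + s *\<^sub>R a + s *\<^sub>R b) - F (x + s *\<^sub>R a) - F (x + s *\<^sub>R b) + F x - s\<^sup>2 * (H b \<bullet> a)\<bar> \<le> \<epsilon> * s\<^sup>2"
    by (elim exE conjE) blast
  from second_difference[OF U dF dg \<epsilon>, of b a]
  obtain \<delta>2 where 2: "\<delta>2 > 0" "\<And>s. 0 < s \<Longrightarrow> s < \<delta>2 \<Longrightarrow>
    \<bar>F (x + s *\<^sub>R b + s *\<^sub>R a) - F (x + s *\<^sub>R b) - F (x + s *\<^sub>R a) + F x - s\<^sup>2 * (H a \<bullet> b)\<bar> \<le> \<epsilon> * s\<^sup>2"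
    by (elim exE conjE) blast
  define s where "s = min \<delta>1 \<delta>2 / 2"
  have s: "0 < s" "s < \<delta>1" "s < \<delta>2" using 1 2 by (auto simp: s_def)
  have e: "x + s *\<^sub>R b + s *\<^sub>R a = x + s *\<^sub>R a + s *\<^sub>R b" by (simp add: add_ac)
  have "\<bar>s\<^sup>2 * (H a \<bullet> b) - s\<^sup>2 * (H b \<bullet> a)\<bar> \<le> 2 * (\<epsilon> * s\<^sup>2)"
    using 1(2)[OF s(1,2)] 2(2)[OF s(1,3)] unfolding e by linarith
  moreover have "\<bar>s\<^sup>2 * (H a \<bullet> b) - s\<^sup>2 * (H b \<bullet> a)\<bar> = s\<^sup>2 * \<bar>H a \<bullet> b - H b \<bullet> a\<bar>"
    by (simp add: abs_mult flip: right_diff_distrib)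
  ultimately have "s\<^sup>2 * \<bar>H a \<bullet> b - H b \<bullet> a\<bar> \<le> s\<^sup>2 * (2 * \<epsilon>)" by (simp add: mult_ac)
  then have "\<bar>H a \<bullet> b - H b \<bullet> a\<bar> \<le> 2 * \<epsilon>" using s by (simp add: mult_le_cancel_left)
  then show False using \<epsilon> by (simp add: \<epsilon>_def)
qed

section \<open>Boundary points, normals and curvature in a chart\<close>

locale boundary_chart =
  fixes C U :: "(real^'n) set" and F :: "real^'n \<Rightarrow> real" and g :: "real^'n \<Rightarrow> real^'n" and H
  assumes body: "convex_body C" and openU: "open U"
    and dF: "\<And>x. x \<in> U \<Longrightarrow> (F has_derivative (\<lambda>h. g x \<bullet> h)) (at x)"
    and gnz: "\<And>x. x \<in> U \<Longrightarrow> g x \<noteq> 0"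
    and fr: "frontier C \<inter> U = {x\<in>U. F x = 0}"
    and dg: "\<And>x. x \<in> U \<Longrightarrow> (g has_derivative H x) (at x)"
begin

lemma fr_iff: "x \<in> U \<Longrightarrow> x \<in> frontier C \<longleftrightarrow> F x = 0"
  using fr by blast

lemma closedC: "closed C" and convexC: "convex C"
  using body by (auto simp: convex_body_def compact_imp_closed)

lemma frontier_sub: "frontier C \<subseteq> C"
  using closedC by (simp add: frontier_subset_closed)

text \<open>On the line through x + t z in the direction of the gradient, F changes sign within
  distance \<epsilon> |t|. The intermediate value theorem finds a zero of F, which is a boundary
  point.\<close>

lemma tangent_approx:
  assumes x: "x \<in> U" "x \<in> frontier C" and z: "g x \<bullet> z = 0" and \<epsilon>: "\<epsilon> > 0"
  shows "\<exists>\<delta>>0. \<forall>t. \<bar>t\<bar> < \<delta> \<longrightarrow> (\<exists>y\<in>frontier C. norm (y - (x + t *\<^sub>R z)) \<le> \<epsilon> * \<bar>t\<bar>)"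
proof -
  let ?n = "g x"
  have n: "norm ?n > 0" using gnz[OF x(1)] by simp
  define \<eta> where "\<eta> = \<epsilon> / norm ?n"
  have \<eta>: "\<eta> > 0" using \<epsilon> n by (simp add: \<eta>_def)
  define K where "K = norm z + \<epsilon> + 1"
  have K: "K > 0" using \<epsilon> by (simp add: K_def add_nonneg_pos)
  \<comment> \<open>Makes the linearisation error at most half of the first-order value \<eta> |t|
    (g x \<bullet> g x) at the ends of the segment.\<close>
  define \<kappa> where "\<kappa> = \<eta> * (?n \<bullet> ?n) / (2 * K)"
  have \<kappa>: "\<kappa> > 0" using \<eta> n K by (simp add: \<kappa>_def)
  have Fx: "F x = 0" using fr_iff x by blast
  obtain d where d: "d > 0" "\<And>y. norm (y - x) < d \<Longrightarrow> \<bar>F y - F x - ?n \<bullet> (y - x)\<bar> \<le> \<kappa> * norm (y - x)"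
    using dF[OF x(1)] \<kappa> unfolding has_derivative_at_alt real_norm_def by blast
  obtain r where r: "r > 0" "ball x r \<subseteq> U" using openU x openE by blast
  define \<delta> where "\<delta> = min r d / K"
  have \<delta>: "\<delta> > 0" using r d K by (simp add: \<delta>_def)
  have "\<exists>y\<in>frontier C. norm (y - (x + t *\<^sub>R z)) \<le> \<epsilon> * \<bar>t\<bar>" if t: "\<bar>t\<bar> < \<delta>" for t
  proof (cases "t = 0")
    case True
    then show ?thesis using x by (intro bexI[of _ x]) auto
  next
    case False
    define q where "q s = x + (t *\<^sub>R z + s *\<^sub>R ?n)" for s
    have hn: "norm (t *\<^sub>R z + s *\<^sub>R ?n) \<le> \<bar>t\<bar> * K \<and> norm (t *\<^sub>R z + s *\<^sub>R ?n) < min r d" if s: "\<bar>s\<bar> \<le> \<eta> * \<bar>t\<bar>" for s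
    proof -
      have "norm (t *\<^sub>R z + s *\<^sub>R ?n) \<le> \<bar>t\<bar> * norm z + \<bar>s\<bar> * norm ?n"
        using norm_triangle_ineq[of "t *\<^sub>R z" "s *\<^sub>R ?n"] by simp
      also have "\<dots> \<le> \<bar>t\<bar> * norm z + (\<eta> * \<bar>t\<bar>) * norm ?n" using s by (intro add_left_mono mult_right_mono) auto
      also have "\<dots> = \<bar>t\<bar> * (norm z + \<epsilon>)" using n by (simp add: \<eta>_def algebra_simps)
      also have "\<dots> \<le> \<bar>t\<bar> * K" by (intro mult_left_mono) (auto simp: K_def)
      finally have 1: "norm (t *\<^sub>R z + s *\<^sub>R ?n) \<le> \<bar>t\<bar> * K" .
      have "\<bar>t\<bar> * K < \<delta> * K" using t K by simp
      also have "\<dots> = min r d" using K by (simp add: \<delta>_def)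
      finally show ?thesis using 1 by simp
    qed
    have qU: "q s \<in> U" if "\<bar>s\<bar> \<le> \<eta> * \<bar>t\<bar>" for s
    proof -
      have "dist x (q s) < r" using hn[OF that] by (simp add: q_def dist_self_add)
      then show ?thesis using r by auto
    qed
    have est: "\<bar>F (q s) - s * (?n \<bullet> ?n)\<bar> \<le> \<kappa> * (\<bar>t\<bar> * K)" if s: "\<bar>s\<bar> \<le> \<eta> * \<bar>t\<bar>" for s
    proof -
      have "\<bar>F (q s) - s * (?n \<bullet> ?n)\<bar> \<le> \<kappa> * norm (t *\<^sub>R z + s *\<^sub>R ?n)"
        using d(2)[of "q s"] hn[OF s] by (simp add: q_def Fx inner_simps z)
      also have "\<dots> \<le> \<kappa> * (\<bar>t\<bar> * K)" using hn[OF s] \<kappa> by (intro mult_left_mono) auto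
      finally show ?thesis .
    qed
    have half: "\<kappa> * (\<bar>t\<bar> * K) < \<eta> * \<bar>t\<bar> * (?n \<bullet> ?n)"
    proof -
      have "\<kappa> * (\<bar>t\<bar> * K) = (\<eta> * \<bar>t\<bar> * (?n \<bullet> ?n)) / 2" using K by (simp add: \<kappa>_def)
      moreover have "\<eta> * \<bar>t\<bar> * (?n \<bullet> ?n) > 0" using \<eta> False n by (intro mult_pos_pos) auto
      ultimately show ?thesis by linarith
    qed
    let ?S = "\<eta> * \<bar>t\<bar>"
    have S: "?S > 0" using \<eta> False by simp
    have up: "F (q ?S) > 0" using est[of ?S] half S by (simp add: abs_le_iff)
    have lo: "F (q (- ?S)) < 0" using est[of "- ?S"] half S by (simp add: abs_le_iff)
    have "continuous_on {- ?S..?S} (\<lambda>s. F (q s))"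
    proof (rule continuous_on_compose2[of U F])
      show "continuous_on U F"
        using dF openU by (auto simp: continuous_on_eq_continuous_at intro: has_derivative_continuous)
      show "continuous_on {- ?S..?S} q" unfolding q_def by (intro continuous_intros)
      show "q ` {- ?S..?S} \<subseteq> U" using qU by auto
    qed
    then obtain s where s: "- ?S \<le> s" "s \<le> ?S" "F (q s) = 0"
      using IVT'[of "\<lambda>s. F (q s)" "- ?S" 0 ?S] up lo S by auto
    then have sa: "\<bar>s\<bar> \<le> ?S" by simp
    have "q s \<in> frontier C" using fr_iff[OF qU[OF sa]] s(3) by simp
    moreover have "norm (q s - (x + t *\<^sub>R z)) \<le> \<epsilon> * \<bar>t\<bar>"
    proof -
      have "norm (q s - (x + t *\<^sub>R z)) = \<bar>s\<bar> * norm ?n" by (simp add: q_def)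
      also have "\<dots> \<le> ?S * norm ?n" using sa by (intro mult_right_mono) auto
      also have "\<dots> = \<epsilon> * \<bar>t\<bar>" using n by (simp add: \<eta>_def)
      finally show ?thesis .
    qed
    ultimately show ?thesis by blast
  qed
  then show ?thesis using \<delta> by blast
qed

text \<open>The nearest point of the boundary to \<open>x + t z\<close> gives a curve in the boundary
  with velocity \<open>z\<close>.\<close>

lemma tangent_curve:
  assumes x: "x \<in> U" "x \<in> frontier C" and z: "g x \<bullet> z = 0"
  shows "\<exists>c. c 0 = x \<and> (\<forall>t. c t \<in> frontier C) \<and> (c has_derivative (\<lambda>t::real. t *\<^sub>R z)) (at 0)"
proof (intro exI conjI allI)
  define c where "c t = closest_point (frontier C) (x + t *\<^sub>R z)" for t
  have cl: "closed (frontier C)" "frontier C \<noteq> {}" using x by auto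
  have c0: "c 0 = x" using x by (simp add: c_def closest_point_self)
  then show "c 0 = x" .
  show "c t \<in> frontier C" for t unfolding c_def using cl by (rule closest_point_in_set)
  show "(c has_derivative (\<lambda>t. t *\<^sub>R z)) (at 0)"
    unfolding has_derivative_at_alt
  proof (intro conjI allI impI)
    show "bounded_linear (\<lambda>t. t *\<^sub>R z)" by (rule bounded_linear_scaleR_left)
    fix e :: real assume e: "0 < e"
    from tangent_approx[OF x z e] obtain \<delta> where \<delta>: "\<delta> > 0"
      "\<forall>t. \<bar>t\<bar> < \<delta> \<longrightarrow> (\<exists>y\<in>frontier C. norm (y - (x + t *\<^sub>R z)) \<le> e * \<bar>t\<bar>)"
      by (elim exE conjE)
    have "norm (c t - c 0 - (t - 0) *\<^sub>R z) \<le> e * norm (t - 0)" if "norm (t - 0) < \<delta>" for t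
    proof -
      from that have "\<bar>t\<bar> < \<delta>" by simp
      from \<delta>(2)[rule_format, OF this]
      obtain y where y: "y \<in> frontier C" "norm (y - (x + t *\<^sub>R z)) \<le> e * \<bar>t\<bar>" by (elim bexE)
      have "dist (x + t *\<^sub>R z) (c t) \<le> dist (x + t *\<^sub>R z) y"
        unfolding c_def by (rule closest_point_le[OF cl(1) y(1)])
      then show ?thesis using y(2) c0 by (simp add: dist_norm norm_minus_commute algebra_simps)
    qed
    then show "\<exists>d>0. \<forall>y. norm (y - 0) < d \<longrightarrow> norm (c y - c 0 - (y - 0) *\<^sub>R z) \<le> e * norm (y - 0)"
      using \<delta>(1) by blast
  qed
qed

text \<open>Along a boundary curve whose velocity is the tangential part z of w, the function (c t -
  x) \<bullet> w has a maximum at 0. So z \<bullet> w = 0, and this is z \<bullet> z.\<close>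

lemma supports_parallel:
  assumes x: "x \<in> U" "x \<in> frontier C" and w: "supports C x w"
  shows "\<exists>k. w = k *\<^sub>R g x"
proof -
  let ?n = "g x"
  define k where "k = (w \<bullet> ?n) / (?n \<bullet> ?n)"
  define z where "z = w - k *\<^sub>R ?n"
  have nn: "?n \<bullet> ?n \<noteq> 0" using gnz[OF x(1)] by simp
  have z: "?n \<bullet> z = 0" using nn by (simp add: z_def k_def inner_simps inner_commute)
  from tangent_curve[OF x z] obtain c where
    c: "c 0 = x" "\<And>t. c t \<in> frontier C" "(c has_derivative (\<lambda>t::real. t *\<^sub>R z)) (at 0)"
    by (elim exE conjE) simp
  have "((\<lambda>t. (c t - x) \<bullet> w) has_derivative (\<lambda>t. t * (z \<bullet> w))) (at 0)"
    using c(3) by (auto intro!: derivative_eq_intros)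
  then have "DERIV (\<lambda>t. (c t - x) \<bullet> w) 0 :> z \<bullet> w"
    by (simp add: has_field_derivative_def mult_commute_abs)
  moreover have "\<forall>t. \<bar>0 - t\<bar> < 1 \<longrightarrow> (c t - x) \<bullet> w \<le> (c 0 - x) \<bullet> w"
    using w c(1,2) frontier_sub by (auto simp: supports_def)
  ultimately have "z \<bullet> w = 0" using DERIV_local_max[of _ "z \<bullet> w" 0 1] by simp
  then have "z \<bullet> z = 0" using z by (simp add: z_def inner_simps inner_commute)
  then show ?thesis by (auto simp: z_def)
qed

text \<open>The chart does not say on which side F is positive; an interior point c0 decides whether
  the gradient must be reversed to point outwards.\<close>

lemma supports_inner_interior:
  assumes x: "x \<in> U" "x \<in> frontier C" and c0: "c0 \<in> interior C"
  shows "g x \<bullet> (c0 - x) \<noteq> 0"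
    and "supports C x ((- sgn (g x \<bullet> (c0 - x)) / norm (g x)) *\<^sub>R g x)"
proof -
  obtain u where u: "norm u = 1" "supports C x u" by (rule frontier_supports[OF body x(2)])
  obtain k where k: "u = k *\<^sub>R g x" using supports_parallel[OF x u(2)] by blast
  have "u \<noteq> 0" using u(1) by auto
  have neg: "k * (g x \<bullet> (c0 - x)) < 0"
    using supports_interior[OF u(2) \<open>u \<noteq> 0\<close> c0] by (simp add: k inner_commute)
  then show "g x \<bullet> (c0 - x) \<noteq> 0" by auto
  have "\<bar>k\<bar> * norm (g x) = 1" using u(1) k by simp
  then have "\<bar>k\<bar> = 1 / norm (g x)" using gnz[OF x(1)] by (simp add: field_simps)
  moreover have "k = - sgn (g x \<bullet> (c0 - x)) * \<bar>k\<bar>"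
    using neg by (auto simp: sgn_if mult_less_0_iff)
  ultimately have "k = - sgn (g x \<bullet> (c0 - x)) / norm (g x)" by simp
  then show "supports C x ((- sgn (g x \<bullet> (c0 - x)) / norm (g x)) *\<^sub>R g x)" using u(2) k by simp
qed

text \<open>Supporting vectors at x are multiples of the gradient, and an interior point fixes their
  common sign. So the unit one is unique, as the description by \<open>THE\<close> in
  \<open>gauss_map\<close> requires.\<close>

lemma gauss_map_eq:
  assumes x: "x \<in> U" "x \<in> frontier C" and w: "supports C x w" "w \<noteq> 0"
  shows "gauss_map C x = (1 / norm w) *\<^sub>R w"
proof -
  obtain c0 where c0: "c0 \<in> interior C" using body by (auto simp: convex_body_def)
  let ?u = "(1 / norm w) *\<^sub>R w"
  have u: "norm ?u = 1" "supports C x ?u" using w by (auto intro: supports_scaleR)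
  show ?thesis unfolding gauss_map_def
  proof (rule the_equality)
    show "norm ?u = 1 \<and> (\<forall>y\<in>C. (y - x) \<bullet> ?u \<le> 0)" using u by (simp add: supports_def)
    fix v assume v: "norm v = 1 \<and> (\<forall>y\<in>C. (y - x) \<bullet> v \<le> 0)"
    then have vs: "supports C x v" by (simp add: supports_def)
    obtain k where k: "?u = k *\<^sub>R g x" using supports_parallel[OF x u(2)] by blast
    obtain l where l: "v = l *\<^sub>R g x" using supports_parallel[OF x vs] by blast
    have "?u \<noteq> 0" "v \<noteq> 0" using u(1) v by auto
    then have "k * (g x \<bullet> (c0 - x)) < 0" "l * (g x \<bullet> (c0 - x)) < 0"
      using supports_interior[OF u(2) _ c0] supports_interior[OF vs _ c0] k l by (simp_all add: inner_commute)
    then have kl: "(k > 0 \<and> l > 0) \<or> (k < 0 \<and> l < 0)" by (auto simp: mult_less_0_iff)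
    have "\<bar>k\<bar> * norm (g x) = \<bar>l\<bar> * norm (g x)" using u(1) v k l by (metis norm_scaleR)
    then have "\<bar>k\<bar> = \<bar>l\<bar>" using gnz[OF x(1)] by simp
    then have "k = l" using kl by auto
    then show "v = ?u" using k l by simp
  qed
qed

lemma gauss_map_supports:
  assumes x: "x \<in> U" "x \<in> frontier C"
  shows "norm (gauss_map C x) = 1" "supports C x (gauss_map C x)"
proof -
  obtain u where u: "norm u = 1" "supports C x u" by (rule frontier_supports[OF body x(2)])
  then have "u \<noteq> 0" by auto
  have "gauss_map C x = u" using gauss_map_eq[OF x u(2) \<open>u \<noteq> 0\<close>] u(1) by simp
  then show "norm (gauss_map C x) = 1" "supports C x (gauss_map C x)" using u by simp_all
qed

lemma continuous_g: "continuous_on U g"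
  using dg openU by (auto simp: continuous_on_eq_continuous_at intro: has_derivative_continuous)

text \<open>On the boundary near x the Gauss map is the restriction of a field E = s g / |g| with a
  constant sign s. The derivative of E along z is a nonzero multiple of H x z plus a multiple of the
  gradient, and it is orthogonal to the normal; hence for tangent z it vanishes exactly if H x z is
  parallel to the gradient.\<close>

lemma gauss_curv_eq_0_iff:
  assumes x: "x \<in> U" "x \<in> frontier C"
  shows "gauss_curv C x = 0 \<longleftrightarrow> (\<exists>z. z \<noteq> 0 \<and> g x \<bullet> z = 0 \<and> (\<exists>k. H x z = k *\<^sub>R g x))"
proof -
  obtain c0 where c0: "c0 \<in> interior C" using body by (auto simp: convex_body_def)
  define \<nu> where "\<nu> = gauss_map C x"
  \<comment> \<open>The sign that makes E point outwards at x. It stays right nearby because g y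
    \<bullet> (c0 - y) is continuous and nonzero at x.\<close>
  define s where "s = - sgn (g x \<bullet> (c0 - x))"
  have s: "s \<noteq> 0" "s * s = 1"
    using supports_inner_interior(1)[OF x c0] by (auto simp: s_def sgn_if)
  define E where "E y = (s / norm (g y)) *\<^sub>R g y" for y
  have gx: "g x \<noteq> 0" using gnz x by blast
  have gE: "gauss_map C y = (- sgn (g y \<bullet> (c0 - y)) / norm (g y)) *\<^sub>R g y" if y: "y \<in> U" "y \<in> frontier C" for y
  proof -
    have "- sgn (g y \<bullet> (c0 - y)) / norm (g y) \<noteq> 0"
      using supports_inner_interior(1)[OF y c0] gnz[OF y(1)] by (auto simp: sgn_if)
    then show ?thesis
      using gauss_map_eq[OF y supports_inner_interior(2)[OF y c0]] supports_inner_interior(1)[OF y c0] gnz[OF y(1)]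
      by (simp add: abs_sgn_eq)
  qed
  have \<nu>E: "\<nu> = E x" using gE[OF x] by (simp add: \<nu>_def E_def s_def)
  have "isCont (\<lambda>y. g y \<bullet> (c0 - y)) x"
    using continuous_g openU x by (intro continuous_intros) (auto simp: continuous_on_eq_continuous_at)
  from isCont_tendsto_nhds[OF this]
  have lim: "((\<lambda>y. g y \<bullet> (c0 - y)) \<longlongrightarrow> g x \<bullet> (c0 - x)) (nhds x)" .
  have "\<forall>\<^sub>F y in nhds x. sgn (g y \<bullet> (c0 - y)) = sgn (g x \<bullet> (c0 - x))"
  proof (cases "g x \<bullet> (c0 - x) > 0")
    case True
    then show ?thesis using order_tendstoD(1)[OF lim True] by (auto elim: eventually_mono)
  next
    case False
    then have n: "g x \<bullet> (c0 - x) < 0" using supports_inner_interior(1)[OF x c0] by simp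
    show ?thesis using order_tendstoD(2)[OF lim n] n by (auto elim: eventually_mono)
  qed
  with eventually_nhds_in_open[OF openU x(1)]
  have "\<forall>\<^sub>F y in nhds x. y \<in> frontier C \<longrightarrow> gauss_map C y = E y"
    by eventually_elim (auto simp: gE E_def s_def)
  then obtain W where W: "open W" "x \<in> W" "\<And>y. y \<in> W \<Longrightarrow> y \<in> frontier C \<Longrightarrow> gauss_map C y = E y"
    unfolding eventually_nhds by blast
  have "(\<lambda>y. s / norm (g y)) differentiable (at x)"
  proof -
    have "(\<lambda>y. norm (g y)) differentiable (at x)"
      using differentiable_compose[of norm g x UNIV] differentiable_norm_at[OF gx] dg[OF x(1)]
      by (auto simp: differentiable_def)
    then show ?thesis using gx by (intro differentiable_divide) auto
  qed
  then obtain \<mu> where \<mu>: "((\<lambda>y. s / norm (g y)) has_derivative \<mu>) (at x)" by (auto simp: differentiable_def)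
  define E' where "E' h = (s / norm (g x)) *\<^sub>R H x h + \<mu> h *\<^sub>R g x" for h
  have dE: "(E has_derivative E') (at x)"
    unfolding E_def[abs_def] E'_def[abs_def] by (rule has_derivative_scaleR[OF \<mu> dg[OF x(1)]])
  \<comment> \<open>Differentiates the identity E y \<bullet> E y = 1.\<close>
  have E'n: "E' h \<bullet> \<nu> = 0" for h
  proof -
    have 1: "((\<lambda>y. E y \<bullet> E y) has_derivative (\<lambda>h. E x \<bullet> E' h + E' h \<bullet> E x)) (at x)"
      by (rule has_derivative_inner[OF dE dE])
    have "((\<lambda>y. 1::real) has_derivative (\<lambda>h. E x \<bullet> E' h + E' h \<bullet> E x)) (at x)"
    proof (rule has_derivative_transform_within_open[OF 1 openU x(1)])
      fix y assume "y \<in> U"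
      then have "norm (g y) \<noteq> 0" using gnz by simp
      then show "E y \<bullet> E y = 1" using s(2) by (simp add: E_def power2_norm_eq_inner[symmetric] power2_eq_square)
    qed
    from has_derivative_unique[OF this has_derivative_const] have "E x \<bullet> E' h + E' h \<bullet> E x = 0" by (rule fun_cong)
    then show ?thesis by (simp add: \<nu>E inner_commute)
  qed
  have \<nu>g: "\<nu> = (s / norm (g x)) *\<^sub>R g x" by (simp add: \<nu>E E_def)
  have n1: "\<nu> \<bullet> \<nu> = 1" using gauss_map_supports(1)[OF x] by (simp add: \<nu>_def norm_eq_1)
  have snz: "s / norm (g x) \<noteq> 0" using s gx by simp
  have perp: "z \<bullet> \<nu> = 0 \<longleftrightarrow> g x \<bullet> z = 0" for z using snz by (simp add: \<nu>g inner_commute)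
  have ex: "(gauss_map C has_derivative E') (at x within frontier C)"
  proof -
    obtain d where d: "d > 0" "ball x d \<subseteq> W" using W openE by blast
    have "E y = gauss_map C y" if "y \<in> frontier C" "dist y x < d" for y
      using that W(3) d(2) by (auto simp: dist_commute subset_iff)
    then show ?thesis
      by (rule has_derivative_transform_within[OF has_derivative_at_withinI[OF dE] d(1) x(2)])
  qed
  define L where "L = (SOME L. (gauss_map C has_derivative L) (at x within frontier C))"
  have L: "(gauss_map C has_derivative L) (at x within frontier C)"
    unfolding L_def by (rule someI[of "\<lambda>L. (gauss_map C has_derivative L) (at x within frontier C)", OF ex])
  \<comment> \<open>The derivative picked by \<open>SOME\<close> is tested along boundary curves,
    which determine it on tangent vectors; \<open>gauss_curv\<close> applies it only to
    those.\<close>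
  have LE: "L z = E' z" if z: "g x \<bullet> z = 0" for z
  proof -
    from tangent_curve[OF x z] obtain c where
      c: "c 0 = x" "\<And>t. c t \<in> frontier C" "(c has_derivative (\<lambda>t::real. t *\<^sub>R z)) (at 0)"
      by (elim exE conjE) simp
    have "range c \<subseteq> frontier C" using c(2) by auto
    then have "(gauss_map C has_derivative L) (at (c 0) within range c)"
      using has_derivative_subset[OF L] c(1) by simp
    from has_derivative_in_compose[OF c(3) this]
    have 1: "((\<lambda>t. gauss_map C (c t)) has_derivative (\<lambda>t. L (t *\<^sub>R z))) (at 0)" .
    from has_derivative_compose[OF c(3), of E E'] dE c(1)
    have 2: "((\<lambda>t. E (c t)) has_derivative (\<lambda>t. E' (t *\<^sub>R z))) (at 0)" by simp
    have "isCont c 0" using c(3) has_derivative_continuous by blast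
    then have "\<forall>\<^sub>F t in nhds 0. c t \<in> W"
      using W(1,2) c(1) by (intro topological_tendstoD[OF isCont_tendsto_nhds]) auto
    then obtain T where T: "open T" "0 \<in> T" "\<And>t. t \<in> T \<Longrightarrow> c t \<in> W" unfolding eventually_nhds by blast
    have "((\<lambda>t. gauss_map C (c t)) has_derivative (\<lambda>t. E' (t *\<^sub>R z))) (at 0)"
      by (rule has_derivative_transform_within_open[OF 2 T(1,2)]) (use W(3) T(3) c(2) in auto)
    from fun_cong[OF has_derivative_unique[OF 1 this], of 1] show ?thesis by simp
  qed
  have linE': "linear E'" using dE has_derivative_linear by blast
  define M where "M v = L (v - (v \<bullet> \<nu>) *\<^sub>R \<nu>) + (v \<bullet> \<nu>) *\<^sub>R \<nu>" for v
  have M: "M v = E' (v - (v \<bullet> \<nu>) *\<^sub>R \<nu>) + (v \<bullet> \<nu>) *\<^sub>R \<nu>" for v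
  proof -
    have "(v - (v \<bullet> \<nu>) *\<^sub>R \<nu>) \<bullet> \<nu> = 0" using n1 by (simp add: inner_diff_left)
    then show ?thesis unfolding M_def using LE perp by simp
  qed
  have linM: "linear M"
    unfolding M by (rule linearI)
      (simp_all add: linear_add[OF linE'] linear_diff[OF linE'] linear_scale[OF linE'] inner_simps algebra_simps)
  have "gauss_curv C x = det (matrix M)"
    unfolding gauss_curv_def Let_def M_def[abs_def] L_def \<nu>_def by simp
  then have "gauss_curv C x = 0 \<longleftrightarrow> \<not> inj M" using det_nz_iff_inj[OF linM] by auto
  also have "\<dots> \<longleftrightarrow> (\<exists>v. v \<noteq> 0 \<and> M v = 0)" using linear_injective_0[OF linM] by blast
  also have "\<dots> \<longleftrightarrow> (\<exists>z. z \<noteq> 0 \<and> g x \<bullet> z = 0 \<and> (\<exists>k. H x z = k *\<^sub>R g x))"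
  proof
    assume "\<exists>v. v \<noteq> 0 \<and> M v = 0"
    then obtain v where v: "v \<noteq> 0" "M v = 0" by blast
    have "M v \<bullet> \<nu> = v \<bullet> \<nu>" using n1 E'n by (simp add: M inner_add_left)
    then have vn: "v \<bullet> \<nu> = 0" using v by simp
    then have "E' v = 0" using v(2) M by simp
    then have "(s / norm (g x)) *\<^sub>R H x v = (- \<mu> v) *\<^sub>R g x" by (simp add: E'_def add_eq_0_iff2)
    moreover have "H x v = inverse (s / norm (g x)) *\<^sub>R ((s / norm (g x)) *\<^sub>R H x v)" using snz by simp
    ultimately have "H x v = (inverse (s / norm (g x)) * (- \<mu> v)) *\<^sub>R g x" by (simp only: scaleR_scaleR)
    then show "\<exists>z. z \<noteq> 0 \<and> g x \<bullet> z = 0 \<and> (\<exists>k. H x z = k *\<^sub>R g x)" using v(1) vn perp by blast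
  next
    assume "\<exists>z. z \<noteq> 0 \<and> g x \<bullet> z = 0 \<and> (\<exists>k. H x z = k *\<^sub>R g x)"
    then obtain z k where z: "z \<noteq> 0" "g x \<bullet> z = 0" "H x z = k *\<^sub>R g x" by blast
    have "E' z = (s / norm (g x) * k + \<mu> z) *\<^sub>R g x" by (simp add: E'_def z(3) scaleR_add_left)
    moreover have "E' z \<bullet> \<nu> = 0" by (rule E'n)
    ultimately have "E' z = 0" using snz gx by (auto simp: \<nu>g)
    moreover have "z \<bullet> \<nu> = 0" using z(2) perp by blast
    ultimately have "M z = 0" by (simp add: M)
    then show "\<exists>v. v \<noteq> 0 \<and> M v = 0" using z(1) by blast
  qed
  finally show ?thesis .
qed

end

section \<open>Minkowski sums\<close>

text \<open>Divide by t^2 and pass to the limit. Applied to the increments of a boundary point and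
  of its normal, this turns monotonicity of the Gauss map into semidefiniteness of its
  derivative.\<close>

lemma inner_derivatives_nonneg:
  fixes \<phi> \<psi> :: "real \<Rightarrow> 'a::real_inner"
  assumes "(\<phi> has_derivative (\<lambda>t. t *\<^sub>R a)) (at 0)" "(\<psi> has_derivative (\<lambda>t. t *\<^sub>R b)) (at 0)"
    and "\<phi> 0 = 0" "\<psi> 0 = 0" and nn: "\<forall>\<^sub>F t in at 0. \<phi> t \<bullet> \<psi> t \<ge> 0"
  shows "a \<bullet> b \<ge> 0"
proof -
  have q: "((\<lambda>t. (1 / t) *\<^sub>R f t) \<longlongrightarrow> c) (at 0)"
    if "(f has_derivative (\<lambda>t. t *\<^sub>R c)) (at 0)" "f 0 = 0" for f :: "real \<Rightarrow> 'a" and c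
  proof -
    have "((\<lambda>t. (f t - f 0 - (t - 0) *\<^sub>R c) /\<^sub>R norm (t - 0)) \<longlongrightarrow> 0) (at 0)"
      using that(1) unfolding has_derivative_def by simp
    then have "((\<lambda>t. norm ((f t - f 0 - (t - 0) *\<^sub>R c) /\<^sub>R norm (t - 0))) \<longlongrightarrow> 0) (at 0)"
      by (rule tendsto_norm_zero)
    then have "((\<lambda>t. (1 / t) *\<^sub>R f t - c) \<longlongrightarrow> 0) (at 0)"
    proof (rule tendsto_norm_zero_cancel[OF Lim_transform_eventually])
      show "\<forall>\<^sub>F t in at 0. norm ((f t - f 0 - (t - 0) *\<^sub>R c) /\<^sub>R norm (t - 0)) = norm ((1 / t) *\<^sub>R f t - c)"
        unfolding eventually_at_filter
      proof (rule always_eventually, intro allI impI)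
        fix t :: real assume t: "t \<noteq> 0"
        then have "(1 / t) *\<^sub>R f t - c = (1 / t) *\<^sub>R (f t - t *\<^sub>R c)" by (simp add: scaleR_diff_right)
        then show "norm ((f t - f 0 - (t - 0) *\<^sub>R c) /\<^sub>R norm (t - 0)) = norm ((1 / t) *\<^sub>R f t - c)"
          using that(2) by (simp add: divide_inverse)
      qed
    qed
    then show ?thesis by (rule Lim_null[THEN iffD2])
  qed
  have "((\<lambda>t. ((1 / t) *\<^sub>R \<phi> t) \<bullet> ((1 / t) *\<^sub>R \<psi> t)) \<longlongrightarrow> a \<bullet> b) (at 0)"
    by (intro tendsto_inner q assms)
  moreover have "\<forall>\<^sub>F t in at 0. 0 \<le> ((1 / t) *\<^sub>R \<phi> t) \<bullet> ((1 / t) *\<^sub>R \<psi> t)"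
    using nn
  proof eventually_elim
    case (elim t)
    have "((1 / t) *\<^sub>R \<phi> t) \<bullet> ((1 / t) *\<^sub>R \<psi> t) = (1 / t)\<^sup>2 * (\<phi> t \<bullet> \<psi> t)"
      by (simp add: power2_eq_square)
    then show ?case using elim by simp
  qed
  ultimately show ?thesis by (intro tendsto_lowerbound[of _ "a \<bullet> b" "at 0"]) auto
qed

lemma minkowski_sum_supports:
  assumes "supports A a v" "supports B b v"
  shows "supports (minkowski_sum A B) (a + b) v"
proof -
  have "(x + y - (a + b)) \<bullet> v \<le> 0" if "x \<in> A" "y \<in> B" for x y
  proof -
    have "(x + y - (a + b)) \<bullet> v = (x - a) \<bullet> v + (y - b) \<bullet> v" by (simp add: inner_simps)
    then show ?thesis using assms that by (simp add: supports_def add_nonpos_nonpos)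
  qed
  then show ?thesis unfolding supports_def minkowski_sum_def by blast
qed

lemma supports_summands:
  assumes "supports (minkowski_sum A B) (a + b) v" "a \<in> A" "b \<in> B"
  shows "supports A a v" "supports B b v"
proof -
  have "(x - a) \<bullet> v \<le> 0" if "x \<in> A" for x
  proof -
    have "x + b \<in> minkowski_sum A B" using that assms(3) by (auto simp: minkowski_sum_def)
    then have "(x + b - (a + b)) \<bullet> v \<le> 0" using assms(1) unfolding supports_def by blast
    then show ?thesis by simp
  qed
  moreover have "(y - b) \<bullet> v \<le> 0" if "y \<in> B" for y
  proof -
    have "a + y \<in> minkowski_sum A B" using that assms(2) by (auto simp: minkowski_sum_def)
    then have "(a + y - (a + b)) \<bullet> v \<le> 0" using assms(1) unfolding supports_def by blast
    then show ?thesis by simp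
  qed
  ultimately show "supports A a v" "supports B b v" by (auto simp: supports_def)
qed

lemma convex_body_minkowski_sum:
  assumes "convex_body A" "convex_body B"
  shows "convex_body (minkowski_sum A B)"
  unfolding convex_body_def
proof (intro conjI)
  have A: "compact A" "convex A" "interior A \<noteq> {}" and B: "compact B" "convex B" "interior B \<noteq> {}"
    using assms by (auto simp: convex_body_def)
  have e: "minkowski_sum A B = {x + y | x y. x \<in> A \<and> y \<in> B}" by (simp add: minkowski_sum_def)
  show "compact (minkowski_sum A B)" unfolding e by (rule compact_sums[OF A(1) B(1)])
  have "minkowski_sum A B = (\<Union>x\<in>A. \<Union>y\<in>B. {x + y})" by (auto simp: minkowski_sum_def)
  then show "convex (minkowski_sum A B)" using convex_sums[OF A(2) B(2)] by simp
  obtain b where b: "b \<in> B" using B(3) interior_subset by fastforce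
  obtain a where a: "a \<in> interior A" using A(3) by blast
  have "(+) b ` interior A \<subseteq> minkowski_sum A B"
    using b interior_subset by (fastforce simp: minkowski_sum_def add.commute)
  then have "(+) b ` interior A \<subseteq> interior (minkowski_sum A B)"
    by (intro interior_maximal open_translation) auto
  then show "interior (minkowski_sum A B) \<noteq> {}" using a by auto
qed

lemma closed_supports:
  assumes "continuous_on UNIV f" "continuous_on UNIV h"
  shows "closed {z. supports C (f z) (h z)}"
proof -
  have "{z. supports C (f z) (h z)} = (\<Inter>y\<in>C. {z. (y - f z) \<bullet> h z \<le> 0})" by (auto simp: supports_def)
  moreover have "closed {z. (y - f z) \<bullet> h z \<le> 0}" for y
    using assms by (intro closed_Collect_le continuous_intros) auto
  ultimately show ?thesis by auto
qed

text \<open>The pairs with a common normal that lie outside Ua \<times> Ub form, together with their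
  normals, a compact set. Its image under addition is closed and misses x0.\<close>

lemma nearby_decomposition:
  fixes A B :: "(real^'n) set"
  assumes A: "compact A" and B: "compact B"
    and unique: "\<forall>a b v. a \<in> A \<longrightarrow> b \<in> B \<longrightarrow> norm v = 1 \<longrightarrow> supports A a v \<longrightarrow> supports B b v \<longrightarrow>
        a + b = x0 \<longrightarrow> a \<in> Ua \<and> b \<in> Ub"
    and Ua: "open Ua" and Ub: "open Ub"
  shows "\<exists>W. open W \<and> x0 \<in> W \<and> (\<forall>a b v. a \<in> A \<longrightarrow> b \<in> B \<longrightarrow> norm v = 1 \<longrightarrow> supports A a v \<longrightarrow>
     supports B b v \<longrightarrow> a + b \<in> W \<longrightarrow> a \<in> Ua \<and> b \<in> Ub)"
proof -
  define K where "K = (A \<times> B \<times> sphere 0 1) \<inter> {z. supports A (fst z) (snd (snd z))}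
     \<inter> {z. supports B (fst (snd z)) (snd (snd z))} \<inter> - (Ua \<times> Ub \<times> UNIV)"
  have "compact K" unfolding K_def
    by (intro compact_Int_closed compact_Times A B compact_sphere closed_supports continuous_intros)
      (use Ua Ub in \<open>auto intro: open_Times simp: closed_Compl\<close>)
  then have c: "compact ((\<lambda>z. fst z + fst (snd z)) ` K)"
    by (intro compact_continuous_image continuous_intros)
  have x0: "x0 \<notin> (\<lambda>z. fst z + fst (snd z)) ` K"
    unfolding K_def using unique by (force)
  show ?thesis
  proof (intro exI conjI allI impI)
    show "open (- ((\<lambda>z. fst z + fst (snd z)) ` K))" using c by (simp add: compact_imp_closed open_Compl)
    show "x0 \<in> - ((\<lambda>z. fst z + fst (snd z)) ` K)" using x0 by simp
    fix a b v assume as: "a \<in> A" "b \<in> B" "norm v = 1" "supports A a v" "supports B b v"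
      "a + b \<in> - ((\<lambda>z. fst z + fst (snd z)) ` K)"
    then have "(a, b, v) \<notin> K" by force
    then show "a \<in> Ua" "b \<in> Ub" using as by (auto simp: K_def)
  qed
qed

section \<open>The normalised normal field of a chart\<close>

locale reg_chart = boundary_chart C U F g H
  for C U :: "(real^'n) set" and F :: "real^'n \<Rightarrow> real" and g :: "real^'n \<Rightarrow> real^'n" and H +
  fixes r :: regularity and \<alpha> :: real and p :: "real^'n"
  assumes \<alpha>: "0 \<le> \<alpha>" "\<alpha> \<le> 1" and r2: "order_ge 2 r"
    and regF: "reg_fun r \<alpha> U F" and regg: "\<And>i. reg_fun (lower r) \<alpha> U (\<lambda>x. g x $ i)"
    and p: "p \<in> U" "p \<in> frontier C"
begin

definition u where "u = gauss_map C p"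

text \<open>The normal scaled to have product 1 with the normal u at p. It is a rational expression
  in the gradient, so its class follows from products and inverses, and parallel normals of two
  bodies with the same u become equal.\<close>

definition N where "N x = inverse (g x \<bullet> u) *\<^sub>R g x"

definition DN where "DN x h = inverse (g x \<bullet> u) *\<^sub>R H x h + (- (inverse (g x \<bullet> u) * (H x h \<bullet> u) * inverse (g x \<bullet> u))) *\<^sub>R g x"

definition U0 where "U0 = {x\<in>U. g x \<bullet> u \<noteq> 0}"

lemma norm_u: "norm u = 1" and supports_u: "supports C p u"
  using gauss_map_supports[OF p] by (auto simp: u_def)

lemma u_u: "u \<bullet> u = 1" using norm_u by (simp add: norm_eq_1)

lemma g_p: obtains k where "k \<noteq> 0" "g p = k *\<^sub>R u"
proof -
  obtain k where k: "u = k *\<^sub>R g p" using supports_parallel[OF p supports_u] by blast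
  then have "k \<noteq> 0" using norm_u by auto
  then have "inverse k \<noteq> 0" "g p = inverse k *\<^sub>R u" using k by auto
  then show ?thesis by (rule that)
qed

lemma p_U0: "p \<in> U0"
proof -
  obtain k where "k \<noteq> 0" "g p = k *\<^sub>R u" by (rule g_p)
  then show ?thesis using p u_u by (simp add: U0_def)
qed

lemma open_U0: "open U0"
proof -
  have "open (U \<inter> (\<lambda>x. g x \<bullet> u) -` (- {0}))"
    using continuous_g openU by (intro continuous_open_preimage continuous_intros) auto
  moreover have "U \<inter> (\<lambda>x. g x \<bullet> u) -` (- {0}) = U0" by (auto simp: U0_def)
  ultimately show ?thesis by simp
qed

lemma U0D: "x \<in> U0 \<Longrightarrow> x \<in> U" "x \<in> U0 \<Longrightarrow> g x \<bullet> u \<noteq> 0"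
  by (auto simp: U0_def)

lemma N_u: "x \<in> U0 \<Longrightarrow> N x \<bullet> u = 1"
  using U0D by (simp add: N_def)

lemma g_N: "x \<in> U0 \<Longrightarrow> g x = (g x \<bullet> u) *\<^sub>R N x"
  using U0D by (simp add: N_def)

lemma N_p: "N p = u"
proof -
  obtain k where "k \<noteq> 0" "g p = k *\<^sub>R u" by (rule g_p)
  then show ?thesis by (simp add: N_def u_u)
qed

lemma DN_has_derivative:
  assumes "x \<in> U0" shows "(N has_derivative DN x) (at x)"
proof -
  note d = dg[OF U0D(1)[OF assms]]
  have "((\<lambda>x. g x \<bullet> u) has_derivative (\<lambda>h. H x h \<bullet> u)) (at x)"
    using d by (auto intro!: derivative_eq_intros)
  from has_derivative_scaleR[OF Deriv.has_derivative_inverse[OF U0D(2)[OF assms] this] d]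
  show ?thesis unfolding N_def[abs_def] DN_def[abs_def] .
qed

lemma DN_u: "x \<in> U0 \<Longrightarrow> DN x h \<bullet> u = 0"
  using U0D(2)[of x] by (simp add: DN_def inner_diff_left)

text \<open>Rephrases the criterion of \<open>gauss_curv_eq_0_iff\<close>: nonzero curvature means
  that \<open>DN x\<close> is injective on the tangent space.\<close>

lemma DN_eq_0_iff:
  assumes x: "x \<in> U0" and h: "g x \<bullet> h = 0"
  shows "DN x h = 0 \<longleftrightarrow> (\<exists>k. H x h = k *\<^sub>R g x)"
proof
  assume "DN x h = 0"
  then have "inverse (g x \<bullet> u) *\<^sub>R H x h = (inverse (g x \<bullet> u) * (H x h \<bullet> u) * inverse (g x \<bullet> u)) *\<^sub>R g x"
    by (simp add: DN_def)
  moreover have "H x h = (g x \<bullet> u) *\<^sub>R (inverse (g x \<bullet> u) *\<^sub>R H x h)" using U0D(2)[OF x] by simp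
  ultimately have "H x h = ((g x \<bullet> u) * (inverse (g x \<bullet> u) * (H x h \<bullet> u) * inverse (g x \<bullet> u))) *\<^sub>R g x"
    by (simp only: scaleR_scaleR)
  then show "\<exists>k. H x h = k *\<^sub>R g x" ..
next
  assume "\<exists>k. H x h = k *\<^sub>R g x"
  then obtain k where "H x h = k *\<^sub>R g x" by blast
  then show "DN x h = 0" using U0D(2)[OF x] by (simp add: DN_def)
qed

lemma reg_N: "reg_fun (lower r) \<alpha> U0 (\<lambda>x. N x $ i)"
proof -
  have sub: "U0 \<subseteq> U" by (auto simp: U0_def)
  have gi: "reg_fun (lower r) \<alpha> U0 (\<lambda>x. g x $ i)" for i
    by (rule reg_fun_subset[OF \<alpha> openU open_U0 sub regg])
  have "reg_fun (lower r) \<alpha> U0 (\<lambda>x. \<Sum>i\<in>UNIV. g x $ i * u $ i)"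
    by (intro reg_fun_sum[OF \<alpha> open_U0] reg_fun_mult[OF \<alpha> open_U0] gi reg_fun_const[OF \<alpha> open_U0]) auto
  then have "reg_fun (lower r) \<alpha> U0 (\<lambda>x. g x \<bullet> u)" by (simp add: inner_vec_def)
  then have "reg_fun (lower r) \<alpha> U0 (\<lambda>x. inverse (g x \<bullet> u))"
    by (rule reg_fun_inverse[OF \<alpha> open_U0]) (rule U0D)
  from reg_fun_mult[OF \<alpha> open_U0 this gi[of i]] show ?thesis by (simp add: N_def)
qed

lemma continuous_N: "continuous_on U0 N"
  using DN_has_derivative open_U0 by (auto simp: continuous_on_eq_continuous_at intro: has_derivative_continuous)

text \<open>At p the field is the outer normal u, and by continuity it keeps pointing away from an
  interior point c0 nearby.\<close>

lemma N_supports_near: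
  shows "\<exists>W. open W \<and> p \<in> W \<and> W \<subseteq> U0 \<and> (\<forall>x\<in>W. x \<in> frontier C \<longrightarrow> supports C x (N x))"
proof -
  obtain c0 where c0: "c0 \<in> interior C" using body by (auto simp: convex_body_def)
  define W where "W = U0 \<inter> (\<lambda>x. (c0 - x) \<bullet> N x) -` {..<0}"
  have "open W" unfolding W_def
    using continuous_N open_U0 by (intro continuous_open_preimage continuous_intros) auto
  moreover have "u \<noteq> 0" using norm_u by auto
  then have "p \<in> W" using supports_interior[OF supports_u _ c0] p_U0 by (simp add: W_def N_p)
  moreover have "W \<subseteq> U0" by (auto simp: W_def)
  moreover have "supports C x (N x)" if x: "x \<in> W" "x \<in> frontier C" for x
  proof -
    have xU: "x \<in> U0" "x \<in> U" using x by (auto simp: W_def U0_def)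
    obtain v where v: "norm v = 1" "supports C x v" by (rule frontier_supports[OF body x(2)])
    then have v0: "v \<noteq> 0" by auto
    obtain k where k: "v = k *\<^sub>R g x" using supports_parallel[OF xU(2) x(2) v(2)] by blast
    define l where "l = k * (g x \<bullet> u)"
    have vl: "v = l *\<^sub>R N x" using k g_N[OF xU(1)] unfolding l_def by (metis scaleR_scaleR)
    have "l * ((c0 - x) \<bullet> N x) < 0" using supports_interior[OF v(2) v0 c0] vl by simp
    moreover have "(c0 - x) \<bullet> N x < 0" using x by (auto simp: W_def)
    ultimately have l: "l > 0" by (auto simp: mult_less_0_iff)
    have "N x = inverse l *\<^sub>R v" using vl l by simp
    then show ?thesis using supports_scaleR[OF v(2), of "inverse l"] l by simp
  qed
  ultimately show ?thesis by blast
qed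

lemma g_p_inner_eq_0_iff: "g p \<bullet> z = 0 \<longleftrightarrow> z \<bullet> u = 0"
proof -
  obtain k where "k \<noteq> 0" "g p = k *\<^sub>R u" by (rule g_p)
  then show ?thesis by (simp add: inner_commute)
qed

text \<open>For directions orthogonal to u the correction term in \<open>DN p\<close> drops out, and
  what remains is the Hessian divided by g p \<bullet> u.\<close>

lemma DN_symmetric:
  assumes "a \<bullet> u = 0" "b \<bullet> u = 0"
  shows "DN p a \<bullet> b = DN p b \<bullet> a"
proof -
  have gp: "g p \<bullet> a = 0" "g p \<bullet> b = 0" using assms g_p_inner_eq_0_iff by auto
  have "H p a \<bullet> b = H p b \<bullet> a" using hessian_symmetric[OF openU p(1) _ dg[OF p(1)], of F] dF by blast
  then show ?thesis using gp by (simp add: DN_def inner_diff_left)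
qed

text \<open>Adding the supporting inequalities at p and at a boundary point c t gives (c t - p)
  \<bullet> (N (c t) - u) \<ge> 0. A boundary curve with velocity a yields the derivative
  form.\<close>

lemma DN_nonneg:
  assumes "a \<bullet> u = 0"
  shows "a \<bullet> DN p a \<ge> 0"
proof -
  from N_supports_near obtain W where
    W: "open W" "p \<in> W" "W \<subseteq> U0" "\<And>x. x \<in> W \<Longrightarrow> x \<in> frontier C \<Longrightarrow> supports C x (N x)"
    by blast
  have "g p \<bullet> a = 0" using assms g_p_inner_eq_0_iff by auto
  from tangent_curve[OF p this] obtain c where
    c: "c 0 = p" "\<And>t. c t \<in> frontier C" "(c has_derivative (\<lambda>t::real. t *\<^sub>R a)) (at 0)"
    by (elim exE conjE) simp
  have lin: "linear (DN p)" using DN_has_derivative[OF p_U0] has_derivative_linear by blast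
  show ?thesis
  proof (rule inner_derivatives_nonneg)
    show "((\<lambda>t. c t - p) has_derivative (\<lambda>t. t *\<^sub>R a)) (at 0)" using c(3) by (auto intro!: derivative_eq_intros)
    have "((\<lambda>t. N (c t)) has_derivative (\<lambda>t. DN p (t *\<^sub>R a))) (at 0)"
      using has_derivative_compose[OF c(3), of N "DN p"] DN_has_derivative[OF p_U0] c(1) by simp
    then show "((\<lambda>t. N (c t) - u) has_derivative (\<lambda>t. t *\<^sub>R DN p a)) (at 0)"
      using linear_scale[OF lin] by (auto intro!: derivative_eq_intros)
    show "c 0 - p = 0" "N (c 0) - u = 0" using c(1) N_p by auto
    have "\<forall>\<^sub>F t in nhds 0. c t \<in> W"
      using W(1,2) c(1) has_derivative_continuous[OF c(3)] by (intro topological_tendstoD[OF isCont_tendsto_nhds]) auto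
    then have "\<forall>\<^sub>F t in at 0. c t \<in> W" by (simp add: eventually_at_filter eventually_mono)
    then show "\<forall>\<^sub>F t in at 0. (c t - p) \<bullet> (N (c t) - u) \<ge> 0"
    proof eventually_elim
      case (elim t)
      have "(c t - p) \<bullet> u \<le> 0" using supports_u c(2) frontier_sub by (auto simp: supports_def)
      moreover have "(p - c t) \<bullet> N (c t) \<le> 0"
        using W(4)[OF elim c(2)] p(2) frontier_sub by (auto simp: supports_def)
      ultimately show ?case by (simp add: inner_diff_left inner_diff_right)
    qed
  qed
qed

text \<open>A null vector of a symmetric positive semidefinite form lies in its kernel: otherwise
  the form would be negative at z + t \<open>DN p z\<close> for some t < 0.\<close>

lemma DN_eq_0_of_inner:
  assumes z: "z \<bullet> u = 0" and 0: "z \<bullet> DN p z = 0"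
  shows "DN p z = 0"
proof -
  have lin: "linear (DN p)" using DN_has_derivative[OF p_U0] has_derivative_linear by blast
  let ?w = "DN p z"
  have wu: "?w \<bullet> u = 0" by (rule DN_u[OF p_U0])
  define q where "q = ?w \<bullet> DN p ?w"
  have q0: "q \<ge> 0" unfolding q_def by (rule DN_nonneg[OF wu])
  have "0 \<le> 2 * t * (?w \<bullet> ?w) + t\<^sup>2 * q" for t
  proof -
    have "0 \<le> (z + t *\<^sub>R ?w) \<bullet> DN p (z + t *\<^sub>R ?w)"
      by (rule DN_nonneg) (use z wu in \<open>simp add: inner_add_left\<close>)
    also have "\<dots> = z \<bullet> ?w + t * (?w \<bullet> ?w) + t * (DN p ?w \<bullet> z) + t\<^sup>2 * q"
      by (simp add: linear_add[OF lin] linear_scale[OF lin] inner_simps q_def power2_eq_square inner_commute algebra_simps)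
    also have "DN p ?w \<bullet> z = ?w \<bullet> ?w" using DN_symmetric[OF wu z] by simp
    finally show ?thesis using 0 by simp
  qed
  note * = this
  \<comment> \<open>This s satisfies s q < 1, so at t = - a s the bound becomes a^2 s (s q - 2),
    which is negative unless a = 0.\<close>
  define a s where "a = ?w \<bullet> ?w" and "s = 1 / (q + 1)"
  have s: "s > 0" "s * q < 1" using q0 by (auto simp: s_def)
  have "2 * (- a * s) * a + (- a * s)\<^sup>2 * q = a\<^sup>2 * s * (s * q - 2)"
    by (simp add: power2_eq_square algebra_simps)
  with *[of "- a * s"] have "0 \<le> a\<^sup>2 * s * (s * q - 2)" by (simp add: a_def)
  then have "a\<^sup>2 * s \<le> 0" using s(2) by (simp add: zero_le_mult_iff)
  then have "a = 0" using s(1) by (simp add: mult_le_0_iff)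
  then have "?w \<bullet> ?w = 0" by (simp add: a_def)
  then show ?thesis by simp
qed

end

context reg_chart
begin

text \<open>N has values in the hyperplane v \<bullet> u = 1, so it cannot be a local diffeomorphism
  by itself. Adding F x in the direction u supplies the missing dimension: \<Gamma> maps the
  boundary F = 0 into that hyperplane, and \<xi> is its local inverse.\<close>

lemma inverse_gauss_map:
  assumes curv: "gauss_curv C p \<noteq> 0"
  shows "\<exists>U1 V \<xi> X. open U1 \<and> p \<in> U1 \<and> U1 \<subseteq> U0 \<and> open V \<and> u \<in> V \<and>
    (\<forall>i. reg_fun (lower r) \<alpha> V (\<lambda>v. \<xi> v $ i)) \<and>
    (\<forall>v\<in>V. (\<xi> has_derivative X v) (at v)) \<and> \<xi> u = p \<and>
    (\<forall>v\<in>V. v \<bullet> u = 1 \<longrightarrow> \<xi> v \<in> U1 \<and> \<xi> v \<in> frontier C \<and> N (\<xi> v) = v \<and> supports C (\<xi> v) v) \<and>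
    (\<forall>x\<in>U1. x \<in> frontier C \<longrightarrow> N x \<in> V \<and> \<xi> (N x) = x \<and> gauss_curv C x \<noteq> 0)"
proof -
  from N_supports_near obtain W where
    W: "open W" "p \<in> W" "W \<subseteq> U0" "\<And>x. x \<in> W \<Longrightarrow> x \<in> frontier C \<Longrightarrow> supports C x (N x)"
    by blast
  define \<Gamma> where "\<Gamma> x = N x + F x *\<^sub>R u" for x
  define D\<Gamma> where "D\<Gamma> x h = DN x h + (g x \<bullet> h) *\<^sub>R u" for x h
  have WU: "W \<subseteq> U" using W(3) by (auto simp: U0_def)
  have q1: "order_ge 1 (lower r)" using order_ge_lower[of 1 r] r2 by (simp add: numeral_2_eq_2)
  have r1: "order_ge 1 r" using order_ge_mono[OF r2] by simp
  have reg: "reg_fun (lower r) \<alpha> W (\<lambda>x. \<Gamma> x $ i)" for i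
  proof -
    have "reg_fun (lower r) \<alpha> W F"
      by (rule reg_fun_subset[OF \<alpha> openU W(1) WU reg_fun_lower[OF \<alpha> openU r1 regF]])
    moreover have "reg_fun (lower r) \<alpha> W (\<lambda>x. N x $ i)"
      by (rule reg_fun_subset[OF \<alpha> open_U0 W(1,3) reg_N])
    ultimately have "reg_fun (lower r) \<alpha> W (\<lambda>x. N x $ i + F x * u $ i)"
      by (intro reg_fun_add[OF \<alpha> W(1)] reg_fun_mult[OF \<alpha> W(1)] reg_fun_const[OF \<alpha> W(1)])
    then show ?thesis by (simp add: \<Gamma>_def)
  qed
  have d: "(\<Gamma> has_derivative D\<Gamma> x) (at x)" if "x \<in> W" for x
    unfolding \<Gamma>_def[abs_def] D\<Gamma>_def[abs_def]
    using DN_has_derivative[of x] dF[of x] that W(3) WU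
    by (intro has_derivative_add has_derivative_scaleR_left) auto
  \<comment> \<open>The component along u shows that z is tangent. Then DN p z = 0, which nonzero
    curvature allows only for z = 0.\<close>
  have inj: "z = 0" if z: "D\<Gamma> p z = 0" for z
  proof -
    have "D\<Gamma> p z \<bullet> u = g p \<bullet> z" using DN_u[OF p_U0, of z] by (simp add: D\<Gamma>_def inner_add_left u_u)
    then have gz: "g p \<bullet> z = 0" using z by simp
    then have "DN p z = 0" using z by (simp add: D\<Gamma>_def)
    then have "\<exists>k. H p z = k *\<^sub>R g p" using DN_eq_0_iff[OF p_U0 gz] by simp
    then show ?thesis using curv gauss_curv_eq_0_iff[OF p] gz by blast
  qed
  from d inj have d': "\<forall>x\<in>W. (\<Gamma> has_derivative D\<Gamma> x) (at x)" and inj': "\<forall>z. D\<Gamma> p z = 0 \<longrightarrow> z = 0"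
    by blast+
  obtain U1 V \<xi> X where 1: "open U1" "U1 \<subseteq> W" "p \<in> U1" "open V" "\<Gamma> p \<in> V"
    "\<forall>x\<in>U1. \<Gamma> x \<in> V \<and> \<xi> (\<Gamma> x) = x" "\<forall>v\<in>V. \<xi> v \<in> U1 \<and> \<Gamma> (\<xi> v) = v"
    "\<forall>v\<in>V. (\<xi> has_derivative X v) (at v)" "\<forall>v\<in>V. \<forall>h. D\<Gamma> (\<xi> v) (X v h) = h"
    "\<forall>i. reg_fun (lower r) \<alpha> V (\<lambda>v. \<xi> v $ i)"
    using reg_inverse_map[OF \<alpha> W(1,2) q1 reg d' inj'] by (elim exE conjE)
  have "F p = 0" using fr_iff[OF p(1)] p(2) by simp
  then have \<Gamma>p: "\<Gamma> p = u" by (simp add: \<Gamma>_def N_p)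
  have \<Gamma>N: "\<Gamma> x = N x" if "x \<in> U1" "x \<in> frontier C" for x
    using that 1(2) WU fr_iff[of x] by (auto simp: \<Gamma>_def)
  have A: "\<xi> v \<in> U1 \<and> \<xi> v \<in> frontier C \<and> N (\<xi> v) = v \<and> supports C (\<xi> v) v" if v: "v \<in> V" "v \<bullet> u = 1" for v
  proof -
    have x: "\<xi> v \<in> U1" "\<Gamma> (\<xi> v) = v" using 1(7) v(1) by auto
    then have xW: "\<xi> v \<in> W" "\<xi> v \<in> U0" "\<xi> v \<in> U" using 1(2) W(3) WU by auto
    have "\<Gamma> (\<xi> v) \<bullet> u = 1 + F (\<xi> v)" using N_u[OF xW(2)] by (simp add: \<Gamma>_def inner_add_left u_u)
    then have F0: "F (\<xi> v) = 0" using x v by simp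
    then have f: "\<xi> v \<in> frontier C" using fr_iff[OF xW(3)] by simp
    moreover have "N (\<xi> v) = v" using \<Gamma>N[OF x(1) f] x(2) by simp
    ultimately show ?thesis using W(4)[OF xW(1) f] x(1) by simp
  qed
  have B: "N x \<in> V \<and> \<xi> (N x) = x \<and> gauss_curv C x \<noteq> 0" if x: "x \<in> U1" "x \<in> frontier C" for x
  proof -
    have v: "\<Gamma> x \<in> V" "\<xi> (\<Gamma> x) = x" using 1(6) x(1) by auto
    have xW: "x \<in> W" "x \<in> U0" "x \<in> U" using x(1) 1(2) W(3) WU by auto
    \<comment> \<open>The derivative of \<Gamma> is invertible at every point of U1, so no tangent
      vector there meets the criterion for vanishing curvature.\<close>
    have "gauss_curv C x \<noteq> 0"
    proof
      assume "gauss_curv C x = 0"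
      then obtain z where z: "z \<noteq> 0" "g x \<bullet> z = 0" "\<exists>k. H x z = k *\<^sub>R g x"
        using gauss_curv_eq_0_iff[OF xW(3) x(2)] by blast
      then have "D\<Gamma> x z = 0" using DN_eq_0_iff[OF xW(2) z(2)] by (simp add: D\<Gamma>_def)
      moreover have lin: "linear (D\<Gamma> x)" using d[OF xW(1)] has_derivative_linear by blast
      moreover have "surj (D\<Gamma> x)" using 1(9) v by (metis surjI)
      then have "inj (D\<Gamma> x)" using lin linear_surjective_imp_injective by blast
      ultimately show False using z(1) linear_injective_0 by blast
    qed
    then show ?thesis using v \<Gamma>N[OF x] by simp
  qed
  have "\<xi> u = p" using B[OF 1(3) p(2)] N_p by simp
  then show ?thesis
    using 1(1,3,4,5,8,10) order_trans[OF 1(2) W(3)] \<Gamma>p A B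
    by (intro exI[of _ U1] exI[of _ V] exI[of _ \<xi>] exI[of _ X]) simp
qed

lemma gauss_curv_nonzero_near:
  assumes "gauss_curv C p \<noteq> 0"
  shows "\<exists>T. open T \<and> p \<in> T \<and> (\<forall>x\<in>T. x \<in> frontier C \<longrightarrow> gauss_curv C x \<noteq> 0)"
  using inverse_gauss_map[OF assms] by (elim exE conjE, intro exI conjI) (assumption | simp)+

end

section \<open>The boundary of the sum near a point of nonzero curvature\<close>

theorem minkowski_sum_chart:
  fixes A B :: "(real^'n) set"
  assumes A: "reg_chart A Ua Fa ga Ha r \<alpha> a0" and B: "reg_chart B Ub Fb gb Hb r \<alpha> b0"
    and u: "gauss_map A a0 = gauss_map B b0" and curv: "gauss_curv A a0 \<noteq> 0"
  shows "\<exists>W Q. open W \<and> a0 + b0 \<in> W \<and> reg_fun r \<alpha> W Q \<and>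
     (\<forall>x\<in>W. \<exists>L. (Q has_derivative L) (at x) \<and> L \<noteq> (\<lambda>_. 0)) \<and>
     frontier (minkowski_sum A B) \<inter> W = {x\<in>W. Q x = 0}"
proof -
  interpret A: reg_chart A Ua Fa ga Ha r \<alpha> a0 by fact
  interpret B: reg_chart B Ub Fb gb Hb r \<alpha> b0 by fact
  let ?S = "minkowski_sum A B"
  note \<alpha> = A.\<alpha>
  have uB: "B.u = A.u" using u by (simp add: A.u_def B.u_def)
  have q1: "order_ge 1 (lower r)" using order_ge_lower[of 1 r] A.r2 by (simp add: numeral_2_eq_2)
  have r1: "order_ge 1 r" using order_ge_mono[OF A.r2] by simp
  from A.inverse_gauss_map[OF curv] obtain U1 V \<xi> X where
    U1: "open U1" "a0 \<in> U1" "U1 \<subseteq> A.U0" and V: "open V" "A.u \<in> V"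
    and "\<forall>i. reg_fun (lower r) \<alpha> V (\<lambda>v. \<xi> v $ i)"
    and "\<forall>v\<in>V. (\<xi> has_derivative X v) (at v)" and \<xi>u: "\<xi> A.u = a0"
    and "\<forall>v\<in>V. v \<bullet> A.u = 1 \<longrightarrow> \<xi> v \<in> U1 \<and> \<xi> v \<in> frontier A \<and> A.N (\<xi> v) = v \<and> supports A (\<xi> v) v"
    and "\<forall>x\<in>U1. x \<in> frontier A \<longrightarrow> A.N x \<in> V \<and> \<xi> (A.N x) = x \<and> gauss_curv A x \<noteq> 0"
    by (elim exE conjE)
  then have reg\<xi>: "\<And>i. reg_fun (lower r) \<alpha> V (\<lambda>v. \<xi> v $ i)"
    and d\<xi>: "\<And>v. v \<in> V \<Longrightarrow> (\<xi> has_derivative X v) (at v)"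
    and \<xi>: "\<And>v. v \<in> V \<Longrightarrow> v \<bullet> A.u = 1 \<Longrightarrow> \<xi> v \<in> U1 \<and> \<xi> v \<in> frontier A \<and> A.N (\<xi> v) = v \<and> supports A (\<xi> v) v"
    and \<xi>N: "\<And>x. x \<in> U1 \<Longrightarrow> x \<in> frontier A \<Longrightarrow> A.N x \<in> V \<and> \<xi> (A.N x) = x"
    by simp_all
  from B.N_supports_near obtain WB where
    WB: "open WB" "b0 \<in> WB" "WB \<subseteq> B.U0" "\<And>x. x \<in> WB \<Longrightarrow> x \<in> frontier B \<Longrightarrow> supports B x (B.N x)"
    by blast
  define D where "D = WB \<inter> B.N -` V"
  have oD: "open D" unfolding D_def
    using continuous_on_subset[OF B.continuous_N WB(3)] WB(1) V(1) by (rule continuous_open_preimage)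
  have b0D: "b0 \<in> D" using WB V B.N_p uB by (simp add: D_def)
  have DU: "D \<subseteq> B.U0" "D \<subseteq> WB" "D \<subseteq> Ub" using WB(3) by (auto simp: D_def B.U0_def)
  have NV: "B.N y \<in> V" "B.N y \<bullet> A.u = 1" if "y \<in> D" for y
    using that B.N_u[of y] DU uB by (auto simp: D_def)
  define \<Phi> where "\<Phi> y = y + \<xi> (B.N y)" for y
  define D\<Phi> where "D\<Phi> y h = h + X (B.N y) (B.DN y h)" for y h
  have d\<xi>N: "((\<lambda>y. \<xi> (B.N y)) has_derivative (\<lambda>h. X (B.N y) (B.DN y h))) (at y)" if "y \<in> D" for y
    by (rule has_derivative_compose[OF B.DN_has_derivative d\<xi>]) (use that DU NV in auto)
  have d\<Phi>: "(\<Phi> has_derivative D\<Phi> y) (at y)" if "y \<in> D" for y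
    unfolding \<Phi>_def[abs_def] D\<Phi>_def[abs_def] by (intro has_derivative_add has_derivative_ident d\<xi>N that)
  have reg\<Phi>: "reg_fun (lower r) \<alpha> D (\<lambda>y. \<Phi> y $ i)" for i
  proof -
    have "reg_fun (lower r) \<alpha> D (\<lambda>y. B.N y $ j)" for j
      by (rule reg_fun_subset[OF \<alpha> B.open_U0 oD DU(1) B.reg_N])
    from reg_fun_compose[OF \<alpha> q1 oD V(1) NV(1) this reg\<xi>[of i]]
    have "reg_fun (lower r) \<alpha> D (\<lambda>y. \<xi> (B.N y) $ i)" by simp
    moreover have "reg_fun (lower r) \<alpha> D (\<lambda>y. y $ i)"
      by (rule reg_fun_linear[OF \<alpha> oD]) (simp add: bounded_linear.linear bounded_linear_vec_nth)
    ultimately have "reg_fun (lower r) \<alpha> D (\<lambda>y. y $ i + \<xi> (B.N y) $ i)"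
      by (intro reg_fun_add[OF \<alpha> oD])
    then show ?thesis by (simp add: \<Phi>_def)
  qed
  \<comment> \<open>Differentiates Fa (\<xi> (B.N y)) = 0, which holds because B.N y lies in the
    slice where \<xi> takes values in the boundary of A.\<close>
  have perp: "B.N y \<bullet> X (B.N y) (B.DN y h) = 0" if y: "y \<in> D" for y h
  proof -
    let ?v = "B.N y"
    have x: "\<xi> ?v \<in> U1" "A.N (\<xi> ?v) = ?v" using \<xi>[OF NV[OF y]] by auto
    then have xU: "\<xi> ?v \<in> A.U0" "\<xi> ?v \<in> Ua" using U1(3) by (auto simp: A.U0_def)
    have 1: "((\<lambda>y. Fa (\<xi> (B.N y))) has_derivative (\<lambda>h. ga (\<xi> ?v) \<bullet> X ?v (B.DN y h))) (at y)"
      by (rule has_derivative_compose[OF d\<xi>N[OF y] A.dF[OF xU(2)]])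
    have "((\<lambda>y. 0::real) has_derivative (\<lambda>h. ga (\<xi> ?v) \<bullet> X ?v (B.DN y h))) (at y)"
    proof (rule has_derivative_transform_within_open[OF 1 oD y])
      fix y' assume "y' \<in> D"
      from \<xi>[OF NV[OF this]] have "\<xi> (B.N y') \<in> frontier A" "\<xi> (B.N y') \<in> Ua"
        using U1(3) by (auto simp: A.U0_def)
      then show "Fa (\<xi> (B.N y')) = 0" using A.fr_iff by blast
    qed
    from fun_cong[OF has_derivative_unique[OF this has_derivative_const]]
    have "ga (\<xi> ?v) \<bullet> X ?v (B.DN y h) = 0" .
    then have "(ga (\<xi> ?v) \<bullet> A.u) * (?v \<bullet> X ?v (B.DN y h)) = 0"
      using A.g_N[OF xU(1)] x(2) by (metis inner_scaleR_left)
    then show ?thesis using A.U0D(2)[OF xU(1)] by simp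
  qed
  \<comment> \<open>Used twice: it makes kernel vectors of D\<Phi> tangent to B, and it replaces P x
    h by h in the gradient of Q.\<close>
  have star: "gb y \<bullet> D\<Phi> y h = gb y \<bullet> h" if y: "y \<in> D" for y h
  proof -
    have "y \<in> B.U0" using y DU by blast
    have "gb y \<bullet> X (B.N y) (B.DN y h) = (gb y \<bullet> B.u) * (B.N y \<bullet> X (B.N y) (B.DN y h))"
      using B.g_N[OF \<open>y \<in> B.U0\<close>] by (metis inner_scaleR_left)
    then show ?thesis using perp[OF y] by (simp add: D\<Phi>_def inner_add_right)
  qed
  have inj: "z = 0" if z: "D\<Phi> b0 z = 0" for z
  proof -
    define w where "w = B.DN b0 z"
    have Xw: "z = - X A.u w" using z B.N_p uB by (simp add: D\<Phi>_def w_def add_eq_0_iff2)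
    have "gb b0 \<bullet> z = 0" using star[OF b0D, of z] z by simp
    then have zu: "z \<bullet> B.u = 0" using B.g_p_inner_eq_0_iff by blast
    have wu: "w \<bullet> A.u = 0" using B.DN_u[OF B.p_U0, of z] uB by (simp add: w_def)
    have linX: "linear (X A.u)" using d\<xi>[OF V(2)] has_derivative_linear by blast
    have "X A.u w \<bullet> w \<ge> 0"
    proof (rule inner_derivatives_nonneg)
      have l: "((\<lambda>t. A.u + t *\<^sub>R w) has_derivative (\<lambda>t. t *\<^sub>R w)) (at 0)" by (auto intro!: derivative_eq_intros)
      then have "((\<lambda>t. \<xi> (A.u + t *\<^sub>R w)) has_derivative (\<lambda>t. X A.u (t *\<^sub>R w))) (at 0)"
        using has_derivative_compose[OF l, of \<xi> "X A.u"] d\<xi>[OF V(2)] by simp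
      then show "((\<lambda>t. \<xi> (A.u + t *\<^sub>R w) - a0) has_derivative (\<lambda>t. t *\<^sub>R X A.u w)) (at 0)"
        using linear_scale[OF linX] by (auto intro!: derivative_eq_intros)
      show "((\<lambda>t. t *\<^sub>R w) has_derivative (\<lambda>t. t *\<^sub>R w)) (at 0)" by (auto intro!: derivative_eq_intros)
      show "\<xi> (A.u + 0 *\<^sub>R w) - a0 = 0" "0 *\<^sub>R w = 0" using \<xi>u by auto
      have "\<forall>\<^sub>F t in nhds 0. A.u + t *\<^sub>R w \<in> V"
        using V has_derivative_continuous[OF l] by (intro topological_tendstoD[OF isCont_tendsto_nhds]) auto
      then have "\<forall>\<^sub>F t in at 0. A.u + t *\<^sub>R w \<in> V" by (simp add: eventually_at_filter eventually_mono)
      then show "\<forall>\<^sub>F t in at 0. (\<xi> (A.u + t *\<^sub>R w) - a0) \<bullet> (t *\<^sub>R w) \<ge> 0"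
      proof eventually_elim
        case (elim t)
        have "(A.u + t *\<^sub>R w) \<bullet> A.u = 1" using wu A.u_u by (simp add: inner_add_left)
        from \<xi>[OF elim this] have x: "\<xi> (A.u + t *\<^sub>R w) \<in> frontier A" "supports A (\<xi> (A.u + t *\<^sub>R w)) (A.u + t *\<^sub>R w)" by auto
        have "(\<xi> (A.u + t *\<^sub>R w) - a0) \<bullet> A.u \<le> 0"
          using A.supports_u x(1) A.frontier_sub by (auto simp: supports_def)
        moreover have "(a0 - \<xi> (A.u + t *\<^sub>R w)) \<bullet> (A.u + t *\<^sub>R w) \<le> 0"
          using x(2) A.p(2) A.frontier_sub by (auto simp: supports_def)
        moreover have "(a0 - \<xi> (A.u + t *\<^sub>R w)) \<bullet> (A.u + t *\<^sub>R w)
            = - ((\<xi> (A.u + t *\<^sub>R w) - a0) \<bullet> A.u) - (\<xi> (A.u + t *\<^sub>R w) - a0) \<bullet> (t *\<^sub>R w)"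
          by (simp only: inner_diff_left inner_add_right)
        ultimately show ?case by linarith
      qed
    qed
    then have "z \<bullet> w \<le> 0" using Xw by simp
    moreover have "z \<bullet> w \<ge> 0" using B.DN_nonneg[OF zu] by (simp add: w_def)
    ultimately have "z \<bullet> B.DN b0 z = 0" by (simp add: w_def)
    then have "w = 0" using B.DN_eq_0_of_inner[OF zu] by (simp add: w_def)
    then show "z = 0" using Xw linear_0[OF linX] by simp
  qed
  from d\<Phi> inj have d': "\<forall>y\<in>D. (\<Phi> has_derivative D\<Phi> y) (at y)" and inj': "\<forall>z. D\<Phi> b0 z = 0 \<longrightarrow> z = 0"
    by blast+
  obtain U2 V2 \<Psi> P where 2: "open U2" "U2 \<subseteq> D" "b0 \<in> U2" "open V2" "\<Phi> b0 \<in> V2"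
    and "\<forall>x\<in>U2. \<Phi> x \<in> V2 \<and> \<Psi> (\<Phi> x) = x" "\<forall>y\<in>V2. \<Psi> y \<in> U2 \<and> \<Phi> (\<Psi> y) = y"
    "\<forall>y\<in>V2. (\<Psi> has_derivative P y) (at y)"
    "\<forall>y\<in>V2. \<forall>h. D\<Phi> (\<Psi> y) (P y h) = h"
    "\<forall>i. reg_fun (lower r) \<alpha> V2 (\<lambda>y. \<Psi> y $ i)"
    using reg_inverse_map[OF \<alpha> oD b0D q1 reg\<Phi> d' inj'] by (elim exE conjE)
  then have \<Psi>\<Phi>: "\<And>x. x \<in> U2 \<Longrightarrow> \<Phi> x \<in> V2 \<and> \<Psi> (\<Phi> x) = x"
    and \<Phi>\<Psi>: "\<And>y. y \<in> V2 \<Longrightarrow> \<Psi> y \<in> U2 \<and> \<Phi> (\<Psi> y) = y"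
    and d\<Psi>: "\<And>y. y \<in> V2 \<Longrightarrow> (\<Psi> has_derivative P y) (at y)"
    and D\<Phi>P: "\<And>y h. y \<in> V2 \<Longrightarrow> D\<Phi> (\<Psi> y) (P y h) = h"
    and reg\<Psi>: "\<And>i. reg_fun (lower r) \<alpha> V2 (\<lambda>y. \<Psi> y $ i)"
    by simp_all
  have x0V2: "a0 + b0 \<in> V2" using 2(5) B.N_p uB \<xi>u by (simp add: \<Phi>_def add.commute)
  have \<Psi>D: "\<Psi> x \<in> D" "\<Psi> x \<in> Ub" if "x \<in> V2" for x using \<Phi>\<Psi>[OF that] 2(2) DU by auto
  define Q where "Q x = Fb (\<Psi> x)" for x
  have dQ: "(Q has_derivative (\<lambda>h. gb (\<Psi> x) \<bullet> h)) (at x)" if x: "x \<in> V2" for x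
  proof -
    have "(Q has_derivative (\<lambda>h. gb (\<Psi> x) \<bullet> P x h)) (at x)"
      unfolding Q_def[abs_def] by (rule has_derivative_compose[OF d\<Psi>[OF x] B.dF[OF \<Psi>D(2)[OF x]]])
    moreover have "gb (\<Psi> x) \<bullet> P x h = gb (\<Psi> x) \<bullet> h" for h
      using star[OF \<Psi>D(1)[OF x], of "P x h"] D\<Phi>P[OF x] by simp
    ultimately show ?thesis by simp
  qed
  have regQ: "reg_fun r \<alpha> V2 Q"
  proof (rule reg_fun_raise[OF \<alpha> 2(4) r1 _ dQ])
    show "reg_fun (lower r) \<alpha> V2 Q" unfolding Q_def
      by (rule reg_fun_compose[OF \<alpha> q1 2(4) B.openU \<Psi>D(2) reg\<Psi> reg_fun_lower[OF \<alpha> B.openU r1 B.regF]])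
    show "reg_fun (lower r) \<alpha> V2 (\<lambda>x. gb (\<Psi> x) \<bullet> axis i 1)" for i
      using reg_fun_compose[OF \<alpha> q1 2(4) B.openU \<Psi>D(2) reg\<Psi> B.regg[of i]] by (simp add: inner_axis)
  qed
  have gnz: "\<exists>L. (Q has_derivative L) (at x) \<and> L \<noteq> (\<lambda>_. 0)" if x: "x \<in> V2" for x
  proof -
    have "gb (\<Psi> x) \<bullet> gb (\<Psi> x) \<noteq> 0" using B.gnz[OF \<Psi>D(2)[OF x]] by simp
    then have "(\<lambda>h. gb (\<Psi> x) \<bullet> h) \<noteq> (\<lambda>_. 0)" by metis
    then show ?thesis using dQ[OF x] by blast
  qed
  have cA: "compact A" "convex A" and cB: "compact B" using A.body B.body by (auto simp: convex_body_def)
  have body: "convex_body ?S" by (rule convex_body_minkowski_sum[OF A.body B.body])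
  have ab: "a0 \<in> A" "b0 \<in> B" using A.p(2) B.p(2) A.frontier_sub B.frontier_sub by auto
  \<comment> \<open>As v supports the sum at a0 + b0, it is also a normal at a0. If a differed from
    a0, points of the segment from a0 to a close to a0 would be boundary points with the normal u,
    against injectivity of the normal field there.\<close>
  have unique: "a \<in> U1 \<and> b \<in> U2"
    if as: "a \<in> A" "b \<in> B" "norm v = 1" "supports A a v" "supports B b v" "a + b = a0 + b0" for a b v
  proof -
    have "supports ?S (a0 + b0) v" using minkowski_sum_supports[OF as(4,5)] as(6) by simp
    from supports_summands(1)[OF this ab] have sv: "supports A a0 v" .
    have "v \<noteq> 0" using as(3) by auto
    then have vu: "v = A.u" using A.gauss_map_eq[OF A.p sv] as(3) by (simp add: A.u_def)
    have "a = a0"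
    proof (rule ccontr)
      assume ne: "a \<noteq> a0"
      define l where "l t = a0 + t *\<^sub>R (a - a0)" for t :: real
      have "isCont l 0" unfolding l_def by (intro continuous_intros)
      then have "\<forall>\<^sub>F t in nhds 0. l t \<in> U1"
        using U1(1,2) by (intro topological_tendstoD[OF isCont_tendsto_nhds]) (auto simp: l_def)
      then obtain e where e: "e > 0" "\<And>t. dist t 0 < e \<Longrightarrow> l t \<in> U1" unfolding eventually_nhds_metric by blast
      define t where "t = min 1 (e / 2)"
      have t: "0 < t" "t \<le> 1" "t < e" using e by (auto simp: t_def)
      have lU: "l t \<in> U1" using e(2)[of t] t by simp
      have "l t = (1 - t) *\<^sub>R a0 + t *\<^sub>R a" by (simp add: l_def algebra_simps)
      then have lA: "l t \<in> A" using convexD[OF cA(2) ab(1) as(1), of "1 - t" t] t by simp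
      have "(a0 - a) \<bullet> A.u \<le> 0" using as(4) ab(1) vu by (simp add: supports_def)
      have ls: "supports A (l t) A.u"
        unfolding supports_def
      proof
        fix y assume "y \<in> A"
        then have "(y - a0) \<bullet> A.u \<le> 0" using sv vu by (simp add: supports_def)
        moreover have "t * ((a0 - a) \<bullet> A.u) \<le> 0" using \<open>(a0 - a) \<bullet> A.u \<le> 0\<close> t by (simp add: mult_nonneg_nonpos)
        moreover have "(y - l t) \<bullet> A.u = (y - a0) \<bullet> A.u + t * ((a0 - a) \<bullet> A.u)"
          by (simp add: l_def inner_simps algebra_simps)
        ultimately show "(y - l t) \<bullet> A.u \<le> 0" by linarith
      qed
      have u0: "A.u \<noteq> 0" using A.norm_u by auto
      have lf: "l t \<in> frontier A" by (rule supports_frontier[OF ls u0 lA])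
      have lUa: "l t \<in> A.U0" "l t \<in> Ua" using lU U1(3) by (auto simp: A.U0_def)
      obtain k where k: "A.u = k *\<^sub>R ga (l t)" using A.supports_parallel[OF lUa(2) lf ls] by blast
      then have k': "A.u = (k * (ga (l t) \<bullet> A.u)) *\<^sub>R A.N (l t)"
        using A.g_N[OF lUa(1)] by (metis scaleR_scaleR)
      then have "A.u \<bullet> A.u = (k * (ga (l t) \<bullet> A.u)) * (A.N (l t) \<bullet> A.u)" by (metis inner_scaleR_left)
      then have "k * (ga (l t) \<bullet> A.u) = 1" using A.u_u A.N_u[OF lUa(1)] by simp
      then have "A.N (l t) = A.u" using k' by simp
      then have "l t = a0" using \<xi>N[OF lU lf] \<xi>u by simp
      then show False using t ne by (simp add: l_def)
    qed
    then show ?thesis using as(6) U1(2) 2(3) by simp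
  qed
  then have "\<forall>a b v. a \<in> A \<longrightarrow> b \<in> B \<longrightarrow> norm v = 1 \<longrightarrow> supports A a v \<longrightarrow> supports B b v \<longrightarrow>
      a + b = a0 + b0 \<longrightarrow> a \<in> U1 \<and> b \<in> U2" by blast
  from nearby_decomposition[OF cA(1) cB this U1(1) 2(1)] obtain W where
    W: "open W" "a0 + b0 \<in> W" and near: "\<forall>a b v. a \<in> A \<longrightarrow> b \<in> B \<longrightarrow> norm v = 1 \<longrightarrow> supports A a v \<longrightarrow>
     supports B b v \<longrightarrow> a + b \<in> W \<longrightarrow> a \<in> U1 \<and> b \<in> U2" by (elim exE conjE)
  \<comment> \<open>W forces every decomposition of a boundary point of the sum into U1 and U2,
    where \<Psi> recovers the summand b. Conversely a zero of Q yields two boundary points with a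
    common normal, whose sum is a boundary point.\<close>
  have zero: "x \<in> frontier ?S \<longleftrightarrow> Q x = 0" if x: "x \<in> V2" "x \<in> W" for x
  proof
    assume fx: "x \<in> frontier ?S"
    obtain v where v: "norm v = 1" "supports ?S x v" by (rule frontier_supports[OF body fx])
    have "closed ?S" using body by (simp add: convex_body_def compact_imp_closed)
    then have "x \<in> ?S" using fx frontier_subset_closed by blast
    then obtain a b where x': "x = a + b" "a \<in> A" "b \<in> B" by (auto simp: minkowski_sum_def)
    have s: "supports A a v" "supports B b v" using supports_summands v(2) x' by blast+
    have aU: "a \<in> U1" and bU: "b \<in> U2" using near x' v(1) s x(2) by blast+
    have v0: "v \<noteq> 0" using v(1) by auto
    have af: "a \<in> frontier A" and bf: "b \<in> frontier B"
      using supports_frontier[OF s(1) v0 x'(2)] supports_frontier[OF s(2) v0 x'(3)] by auto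
    have aU0: "a \<in> A.U0" "a \<in> Ua" using aU U1(3) by (auto simp: A.U0_def)
    have bU0: "b \<in> B.U0" "b \<in> Ub" "b \<in> D" using bU 2(2) DU by auto
    obtain k where k: "v = k *\<^sub>R ga a" using A.supports_parallel[OF aU0(2) af s(1)] by blast
    obtain l where l: "v = l *\<^sub>R gb b" using B.supports_parallel[OF bU0(2) bf s(2)] by blast
    define k' l' where "k' = k * (ga a \<bullet> A.u)" and "l' = l * (gb b \<bullet> B.u)"
    have k': "v = k' *\<^sub>R A.N a" using k A.g_N[OF aU0(1)] unfolding k'_def by (metis scaleR_scaleR)
    have l': "v = l' *\<^sub>R B.N b" using l B.g_N[OF bU0(1)] unfolding l'_def by (metis scaleR_scaleR)
    \<comment> \<open>Both normal fields have product 1 with u, so the two multiples agree and the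
      normalised normals coincide.\<close>
    have "v \<bullet> A.u = k'" using A.N_u[OF aU0(1)] by (subst k') simp
    moreover have "v \<bullet> A.u = l'" using B.N_u[OF bU0(1)] uB by (subst l') simp
    ultimately have "k' = l'" by simp
    moreover have "k' \<noteq> 0" using k' v0 by auto
    ultimately have "A.N a = B.N b" using k' l' by simp
    then have "\<Phi> b = x" using \<xi>N[OF aU af] x'(1) by (simp add: \<Phi>_def add.commute)
    then have "\<Psi> x = b" using \<Psi>\<Phi>[OF bU] by auto
    then show "Q x = 0" using B.fr_iff[OF bU0(2)] bf by (simp add: Q_def)
  next
    assume "Q x = 0"
    let ?y = "\<Psi> x"
    have y: "?y \<in> D" "?y \<in> Ub" "?y \<in> WB" using \<Psi>D[OF x(1)] DU by auto
    then have yf: "?y \<in> frontier B" using \<open>Q x = 0\<close> B.fr_iff by (simp add: Q_def)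
    have sB: "supports B ?y (B.N ?y)" using WB(4)[OF y(3) yf] .
    have a: "\<xi> (B.N ?y) \<in> frontier A" "supports A (\<xi> (B.N ?y)) (B.N ?y)" using \<xi>[OF NV[OF y(1)]] by auto
    have x': "x = \<xi> (B.N ?y) + ?y" using \<Phi>\<Psi>[OF x(1)] by (simp add: \<Phi>_def add.commute)
    have s: "supports ?S x (B.N ?y)" using minkowski_sum_supports[OF a(2) sB] x' by simp
    have "x \<in> ?S" using x' a(1) yf A.frontier_sub B.frontier_sub by (auto simp: minkowski_sum_def)
    moreover have "B.N ?y \<noteq> 0" using NV(2)[OF y(1)] by auto
    ultimately show "x \<in> frontier ?S" using supports_frontier[OF s] by blast
  qed
  show ?thesis
  proof (rule exI[of _ "V2 \<inter> W"], rule exI[of _ Q], intro conjI ballI)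
    show "open (V2 \<inter> W)" using 2(4) W(1) by blast
    show "a0 + b0 \<in> V2 \<inter> W" using x0V2 W(2) by blast
    show "reg_fun r \<alpha> (V2 \<inter> W) Q" by (rule reg_fun_subset[OF \<alpha> 2(4) _ _ regQ]) (use 2(4) W(1) in auto)
    show "\<exists>L. (Q has_derivative L) (at x) \<and> L \<noteq> (\<lambda>_. 0)" if "x \<in> V2 \<inter> W" for x using gnz that by blast
    show "frontier ?S \<inter> (V2 \<inter> W) = {x \<in> V2 \<inter> W. Q x = 0}" using zero by blast
  qed
qed

section \<open>Normals with vanishing curvature\<close>

lemma reg_body_chart:
  fixes C :: "(real^'n) set"
  assumes \<alpha>: "0 \<le> \<alpha>" "\<alpha> \<le> 1" and r2: "order_ge 2 r" and C: "reg_body r \<alpha> C" and p: "p \<in> frontier C"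
  shows "\<exists>U F g H. reg_chart C U F g H r \<alpha> p"
proof -
  obtain U F where U: "open U" "p \<in> U" and F: "reg_fun r \<alpha> U F"
    and nz: "\<forall>x\<in>U. \<exists>L. (F has_derivative L) (at x) \<and> L \<noteq> (\<lambda>_. 0)"
    and fr: "frontier C \<inter> U = {x\<in>U. F x = 0}"
    using C p unfolding reg_body_def by blast
  have "\<forall>x. \<exists>L. x \<in> U \<longrightarrow> (F has_derivative L) (at x) \<and> L \<noteq> (\<lambda>_. 0)" using nz by blast
  from choice[OF this] obtain L where L: "\<And>x. x \<in> U \<Longrightarrow> (F has_derivative L x) (at x)"
    "\<And>x. x \<in> U \<Longrightarrow> L x \<noteq> (\<lambda>_. 0)" by blast
  define g where "g x = (\<chi> i. L x (axis i 1))" for x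
  have Lg: "L x = (\<lambda>h. g x \<bullet> h)" if "x \<in> U" for x
  proof
    fix h
    have "linear (L x)" using L(1)[OF that] has_derivative_linear by blast
    from has_derivative_axis_expand[OF this, of h] show "L x h = g x \<bullet> h"
      by (simp add: g_def inner_vec_def mult.commute)
  qed
  have q1: "order_ge 1 (lower r)" using order_ge_lower[of 1 r] r2 by (simp add: numeral_2_eq_2)
  have r1: "order_ge 1 r" using order_ge_mono[OF r2] by simp
  have regg: "reg_fun (lower r) \<alpha> U (\<lambda>x. g x $ i)" for i
    using reg_fun_deriv[OF \<alpha> U(1) r1 F L(1), of "axis i 1"] by (simp add: g_def)
  from reg_map_C1[OF \<alpha> U(1) q1 regg] obtain H where H: "\<And>x. x \<in> U \<Longrightarrow> (g has_derivative H x) (at x)" by blast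
  have "reg_chart C U F g H r \<alpha> p"
  proof
    show "convex_body C" using C by (simp add: reg_body_def)
    show "(F has_derivative (\<lambda>h. g x \<bullet> h)) (at x)" if "x \<in> U" for x using L(1)[OF that] Lg[OF that] by simp
    show "g x \<noteq> 0" if "x \<in> U" for x using L(2)[OF that] Lg[OF that] by auto
  qed (use U fr H \<alpha> r2 F regg p in auto)
  then show ?thesis by blast
qed

context
  fixes C :: "(real^'n) set" and r :: regularity and \<alpha> :: real
  assumes \<alpha>: "0 \<le> \<alpha>" "\<alpha> \<le> 1" and r2: "order_ge 2 r" and C: "reg_body r \<alpha> C"
begin

lemma reg_body_gauss_map:
  assumes "p \<in> frontier C"
  shows "norm (gauss_map C p) = 1" "supports C p (gauss_map C p)"
    "supports C p v \<Longrightarrow> norm v = 1 \<Longrightarrow> gauss_map C p = v"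
proof -
  obtain U F g H where "reg_chart C U F g H r \<alpha> p" using reg_body_chart[OF \<alpha> r2 C assms] by blast
  then interpret reg_chart C U F g H r \<alpha> p .
  show "norm (gauss_map C p) = 1" "supports C p (gauss_map C p)" using gauss_map_supports[OF p] by auto
  show "gauss_map C p = v" if "supports C p v" "norm v = 1"
  proof -
    have "v \<noteq> 0" using that(2) by auto
    then show ?thesis using gauss_map_eq[OF p that(1)] that(2) by simp
  qed
qed

lemma Zset_norm: "v \<in> Zset C \<Longrightarrow> norm v = 1"
  using reg_body_gauss_map(1) by (auto simp: Zset_def)

text \<open>Nonzero curvature persists nearby, so the boundary points of zero curvature form a
  compact set. Their normals are a projection of the pairs (x, v) with v supporting at x, which is a
  closed relation.\<close>

lemma compact_Zset: "compact (Zset C)"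
proof -
  define K where "K = {x \<in> frontier C. gauss_curv C x = 0}"
  have cC: "compact C" using C by (simp add: reg_body_def convex_body_def)
  have cf: "compact (frontier C)" using compact_frontier[OF cC] .
  have "\<forall>p\<in>frontier C - K. \<exists>T. open T \<and> p \<in> T \<and> T \<inter> K = {}"
  proof
    fix p assume p': "p \<in> frontier C - K"
    then obtain U F g H where "reg_chart C U F g H r \<alpha> p" using reg_body_chart[OF \<alpha> r2 C] by blast
    then interpret reg_chart C U F g H r \<alpha> p .
    have "gauss_curv C p \<noteq> 0" using p' by (simp add: K_def)
    from gauss_curv_nonzero_near[OF this]
    obtain U1 where "open U1" "p \<in> U1" "\<forall>x\<in>U1. x \<in> frontier C \<longrightarrow> gauss_curv C x \<noteq> 0"
      by (elim exE conjE)
    then show "\<exists>T. open T \<and> p \<in> T \<and> T \<inter> K = {}" by (intro exI[of _ U1]) (auto simp: K_def)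
  qed
  from bchoice[OF this] obtain T where T: "\<And>p. p \<in> frontier C - K \<Longrightarrow> open (T p) \<and> p \<in> T p \<and> T p \<inter> K = {}" by blast
  have "K = frontier C \<inter> - (\<Union>p\<in>frontier C - K. T p)" using T by (auto simp: K_def)
  moreover have "open (\<Union>p\<in>frontier C - K. T p)" using T by blast
  ultimately have cK: "compact K" using compact_Int_closed[OF cf] by (metis closed_Compl)
  have "compact ((K \<times> sphere 0 1) \<inter> {z. supports C (fst z) (snd z)})"
    by (intro compact_Int_closed compact_Times cK compact_sphere closed_supports continuous_intros)
  then have "compact (snd ` ((K \<times> sphere 0 1) \<inter> {z. supports C (fst z) (snd z)}))"
    by (intro compact_continuous_image continuous_intros)
  moreover have "snd ` ((K \<times> sphere 0 1) \<inter> {z. supports C (fst z) (snd z)}) = Zset C"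
  proof (intro set_eqI iffI)
    fix v assume "v \<in> snd ` ((K \<times> sphere 0 1) \<inter> {z. supports C (fst z) (snd z)})"
    then obtain x where x: "x \<in> K" "norm v = 1" "supports C x v" by auto
    then have "gauss_map C x = v" by (intro reg_body_gauss_map(3)) (auto simp: K_def)
    then show "v \<in> Zset C" using x(1) by (auto simp: Zset_def K_def)
  next
    fix v assume "v \<in> Zset C"
    then obtain x where x: "x \<in> frontier C" "gauss_curv C x = 0" "v = gauss_map C x" by (auto simp: Zset_def)
    then have "(x, v) \<in> (K \<times> sphere 0 1) \<inter> {z. supports C (fst z) (snd z)}"
      using reg_body_gauss_map(1,2)[OF x(1)] by (simp add: K_def)
    then show "v \<in> snd ` ((K \<times> sphere 0 1) \<inter> {z. supports C (fst z) (snd z)})" by force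
  qed
  ultimately show ?thesis by simp
qed

text \<open>At the point of \<open>C\<close> farthest from \<open>-t u0\<close> a ball touches \<open>C\<close> from outside, so the
  curvature there is nonzero and the supporting hyperplane meets \<open>C\<close> only in that point. Its normal
  tends to \<open>u0\<close> as \<open>t\<close> tends to infinity.\<close>

lemma Zset_codense:
  assumes u0: "norm u0 = 1" and \<epsilon>: "\<epsilon> > 0"
  shows "\<exists>v. norm v = 1 \<and> dist v u0 < \<epsilon> \<and> v \<notin> Zset C"
proof -
  have cC: "compact C" "C \<noteq> {}" using C interior_subset by (fastforce simp: reg_body_def convex_body_def)+
  obtain M where M: "M \<ge> 0" "\<And>x. x \<in> C \<Longrightarrow> norm x \<le> M"
    using compact_imp_bounded[OF cC(1)] unfolding bounded_iff by (metis linorder_le_cases order_trans)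
  \<comment> \<open>Points of C have norm at most M, so R \<ge> t - M = 2 M / \<epsilon> + 1. This
    makes dist v u0 \<le> 2 M / R < \<epsilon>.\<close>
  define t where "t = M + 2 * M / \<epsilon> + 1"
  define q where "q = - t *\<^sub>R u0"
  obtain x where x: "x \<in> C" "\<And>y. y \<in> C \<Longrightarrow> dist q y \<le> dist q x"
    using distance_attains_sup[OF cC, of q] by blast
  define R where "R = norm (x - q)"
  have t0: "t > 0" using M(1) \<epsilon> by (simp add: t_def add_nonneg_pos)
  have xq: "x - q = t *\<^sub>R u0 + x" by (simp add: q_def)
  have Rt: "\<bar>R - t\<bar> \<le> norm x"
  proof -
    have "\<bar>norm (x - q) - norm (t *\<^sub>R u0)\<bar> \<le> norm (x - q - t *\<^sub>R u0)" by (rule norm_triangle_ineq3)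
    then show ?thesis using u0 t0 by (simp add: R_def xq)
  qed
  have R: "R \<ge> 2 * M / \<epsilon> + 1" using Rt M(2)[OF x(1)] by (simp add: t_def)
  then have R0: "R > 0" using M(1) \<epsilon> by (smt (verit) divide_nonneg_pos)
  define v where "v = (1 / R) *\<^sub>R (x - q)"
  have v1: "norm v = 1" using R0 by (simp add: v_def R_def)
  have xqv: "x - q = R *\<^sub>R v" using R0 by (simp add: v_def)
  have far: "norm (y - q) \<le> R" if "y \<in> C" for y
    using x(2)[OF that] by (simp add: R_def dist_norm norm_minus_commute)
  have sq: "(norm (y - q))\<^sup>2 = (norm (y - x))\<^sup>2 + 2 * R * ((y - x) \<bullet> v) + R\<^sup>2" for y
  proof -
    have e: "y - q = (y - x) + R *\<^sub>R v" unfolding xqv[symmetric] by simp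
    have "(norm (y - q))\<^sup>2 = ((y - x) + R *\<^sub>R v) \<bullet> ((y - x) + R *\<^sub>R v)"
      unfolding e by (rule power2_norm_eq_inner)
    also have "\<dots> = (y - x) \<bullet> (y - x) + 2 * R * ((y - x) \<bullet> v) + R\<^sup>2 * (v \<bullet> v)"
    proof -
      have "(a + R *\<^sub>R v) \<bullet> (a + R *\<^sub>R v) = a \<bullet> a + 2 * R * (a \<bullet> v) + R\<^sup>2 * (v \<bullet> v)" for a
        by (simp add: inner_add_left inner_add_right inner_commute[of v a] power2_eq_square distrib_left)
      then show ?thesis .
    qed
    finally show ?thesis using v1 by (simp add: power2_norm_eq_inner norm_eq_1)
  qed
  \<comment> \<open>The ball of radius R around q contains C and touches it at x; this is its
    inequality expanded at x.\<close>
  have key: "(norm (y - x))\<^sup>2 + 2 * R * ((y - x) \<bullet> v) \<le> 0" if "y \<in> C" for y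
    using sq[of y] power_mono[OF far[OF that] norm_ge_zero, of 2] by simp
  have sv: "supports C x v"
    unfolding supports_def
  proof
    fix y assume "y \<in> C"
    from key[OF this] have "2 * R * ((y - x) \<bullet> v) \<le> 0" by (smt (verit) zero_le_power2)
    then show "(y - x) \<bullet> v \<le> 0" using R0 by (simp add: mult_le_0_iff)
  qed
  have v0: "v \<noteq> 0" using v1 by auto
  have xf: "x \<in> frontier C" by (rule supports_frontier[OF sv v0 x(1)])
  have "dist v u0 < \<epsilon>"
  proof -
    have "v - u0 = (1 / R) *\<^sub>R (x + (t - R) *\<^sub>R u0)"
      using R0 by (simp add: v_def xq algebra_simps)
    then have "dist v u0 = norm (x + (t - R) *\<^sub>R u0) / R" using R0 by (simp add: dist_norm)
    also have "\<dots> \<le> (norm x + \<bar>t - R\<bar>) / R"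
      using norm_triangle_ineq[of x "(t - R) *\<^sub>R u0"] u0 R0 by (intro divide_right_mono) auto
    also have "\<dots> \<le> 2 * M / R" using Rt M(2)[OF x(1)] R0 by (intro divide_right_mono) auto
    also have "\<dots> < \<epsilon>"
    proof -
      have "2 * M < \<epsilon> * (2 * M / \<epsilon> + 1)" using \<epsilon> by (simp add: distrib_left)
      also have "\<dots> \<le> \<epsilon> * R" using R \<epsilon> by (intro mult_left_mono) auto
      finally show ?thesis using R0 by (simp add: divide_less_eq)
    qed
    finally show ?thesis .
  qed
  moreover have "v \<notin> Zset C"
  proof
    assume "v \<in> Zset C"
    then obtain x' where x': "x' \<in> frontier C" "gauss_curv C x' = 0" "v = gauss_map C x'" by (auto simp: Zset_def)
    have "closed C" using cC by (simp add: compact_imp_closed)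
    then have x'C: "x' \<in> C" using x'(1) frontier_subset_closed by blast
    \<comment> \<open>With the normal v also at x', the product (x' - x) \<bullet> v is nonnegative,
      and \<open>key\<close> leaves only x' = x.\<close>
    have "supports C x' v" using reg_body_gauss_map(2)[OF x'(1)] x'(3) by simp
    then have "(x - x') \<bullet> v \<le> 0" using x(1) by (simp add: supports_def)
    then have "(x' - x) \<bullet> v \<ge> 0" by (simp add: inner_diff_left)
    then have "(norm (x' - x))\<^sup>2 \<le> 0" using key[OF x'C] R0 by (smt (verit) mult_nonneg_nonneg)
    then have xx: "x' = x" by simp
    obtain U F g H where "reg_chart C U F g H r \<alpha> x" using reg_body_chart[OF \<alpha> r2 C xf] by blast
    then interpret reg_chart C U F g H r \<alpha> x .
    have uv: "u = v" using x'(3) xx by (simp add: u_def)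
    obtain z where z: "z \<noteq> 0" "g x \<bullet> z = 0" "\<exists>k. H x z = k *\<^sub>R g x"
      using gauss_curv_eq_0_iff[OF p] x'(2) xx by blast
    have DNz: "DN x z = 0" using DN_eq_0_iff[OF p_U0 z(2)] z(3) by simp
    from N_supports_near obtain W where
      W: "open W" "x \<in> W" "W \<subseteq> U0" "\<And>y. y \<in> W \<Longrightarrow> y \<in> frontier C \<Longrightarrow> supports C y (N y)"
      by blast
    from tangent_curve[OF p z(2)] obtain c where
      c: "c 0 = x" "\<And>t. c t \<in> frontier C" "(c has_derivative (\<lambda>t::real. t *\<^sub>R z)) (at 0)"
      by (elim exE conjE) simp
    \<comment> \<open>With this k, \<open>key\<close> reads (y - x) \<bullet> v \<le> - k |y - x|^2.
      Together with the supporting inequality at c t it gives (c t - x) \<bullet> (N (c t) - v)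
      \<ge> k |c t - x|^2, which is incompatible with DN x z = 0.\<close>
    define k where "k = 1 / (2 * R)"
    have k: "k > 0" using R0 by (simp add: k_def)
    have lin: "linear (DN x)" using DN_has_derivative[OF p_U0] has_derivative_linear by blast
    have "z \<bullet> (- k *\<^sub>R z) \<ge> 0"
    proof (rule inner_derivatives_nonneg)
      show d1: "((\<lambda>t. c t - x) has_derivative (\<lambda>t. t *\<^sub>R z)) (at 0)" using c(3) by (auto intro!: derivative_eq_intros)
      have "((\<lambda>t. N (c t)) has_derivative (\<lambda>t. DN x (t *\<^sub>R z))) (at 0)"
        using has_derivative_compose[OF c(3), of N "DN x"] DN_has_derivative[OF p_U0] c(1) by simp
      then have "((\<lambda>t. N (c t)) has_derivative (\<lambda>t. 0)) (at 0)" using linear_scale[OF lin] DNz by simp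
      have "((\<lambda>t. N (c t) - v - k *\<^sub>R (c t - x)) has_derivative (\<lambda>t. 0 - 0 - k *\<^sub>R (t *\<^sub>R z))) (at 0)"
        by (intro has_derivative_diff has_derivative_const has_derivative_scaleR_right d1) fact
      moreover have "(\<lambda>t. 0 - 0 - k *\<^sub>R (t *\<^sub>R z)) = (\<lambda>t. t *\<^sub>R (- k *\<^sub>R z))"
        by (simp add: fun_eq_iff mult.commute)
      ultimately show "((\<lambda>t. N (c t) - v - k *\<^sub>R (c t - x)) has_derivative (\<lambda>t. t *\<^sub>R (- k *\<^sub>R z))) (at 0)"
        by (simp only:)
      show "c 0 - x = 0" "N (c 0) - v - k *\<^sub>R (c 0 - x) = 0" using c(1) N_p uv by auto
      have "\<forall>\<^sub>F t in nhds 0. c t \<in> W"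
        using W(1,2) c(1) has_derivative_continuous[OF c(3)] by (intro topological_tendstoD[OF isCont_tendsto_nhds]) auto
      then have "\<forall>\<^sub>F t in at 0. c t \<in> W" by (simp add: eventually_at_filter eventually_mono)
      then show "\<forall>\<^sub>F t in at 0. (c t - x) \<bullet> (N (c t) - v - k *\<^sub>R (c t - x)) \<ge> 0"
      proof eventually_elim
        case (elim t)
        have cC': "c t \<in> C" using c(2) frontier_sub by blast
        have "(norm (c t - x))\<^sup>2 + 2 * R * ((c t - x) \<bullet> v) \<le> 0" by (rule key[OF cC'])
        then have "k * ((norm (c t - x))\<^sup>2 + 2 * R * ((c t - x) \<bullet> v)) \<le> 0" using k by (simp add: mult_nonneg_nonpos)
        then have 1: "k * ((c t - x) \<bullet> (c t - x)) + (c t - x) \<bullet> v \<le> 0"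
          using R0 by (simp add: k_def power2_norm_eq_inner distrib_left add_divide_distrib)
        have "(x - c t) \<bullet> N (c t) \<le> 0"
          using W(4)[OF elim c(2)] x(1) by (auto simp: supports_def)
        then have 2: "(c t - x) \<bullet> N (c t) \<ge> 0" by (simp add: inner_diff_left)
        have "(c t - x) \<bullet> (N (c t) - v - k *\<^sub>R (c t - x)) = (c t - x) \<bullet> N (c t) - (c t - x) \<bullet> v - k * ((c t - x) \<bullet> (c t - x))"
          by (simp only: inner_diff_right inner_scaleR_right)
        then show ?case using 1 2 by linarith
      qed
    qed
    then have "k * (z \<bullet> z) \<le> 0" by simp
    then have "z \<bullet> z \<le> 0" using k by (simp add: mult_le_0_iff)
    then have "z = 0" using inner_gt_zero_iff[of z] by linarith
    then show False using z(1) by simp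
  qed
  ultimately show ?thesis using v1 by blast
qed

end

section \<open>Rotations\<close>

declare transpose_matrix_vector [simp del]

lemma orthogonal_matrix_mult:
  fixes R :: "real^'n^'n"
  assumes "orthogonal_matrix R"
  shows "(R *v x) \<bullet> (R *v y) = x \<bullet> y" "transpose R *v (R *v x) = x" "R *v (transpose R *v x) = x"
    "norm (R *v x) = norm x" "orthogonal_matrix (transpose R)"
proof -
  have 1: "transpose R ** R = mat 1" "R ** transpose R = mat 1"
    using assms by (simp_all add: orthogonal_matrix_def)
  show 2: "transpose R *v (R *v x) = x" for x by (simp add: matrix_vector_mul_assoc 1)
  show "R *v (transpose R *v x) = x" by (simp add: matrix_vector_mul_assoc 1)
  show 3: "(R *v x) \<bullet> (R *v y) = x \<bullet> y" for x y
  proof -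
    have "(R *v x) \<bullet> (R *v y) = ((R *v x) v* R) \<bullet> y" by (simp add: dot_lmul_matrix)
    also have "(R *v x) v* R = transpose R *v (R *v x)" by (simp add: transpose_matrix_vector)
    finally show ?thesis using 2 by simp
  qed
  then show "norm (R *v x) = norm x" by (simp add: norm_eq_sqrt_inner)
  show "orthogonal_matrix (transpose R)" using 1 by (simp add: orthogonal_matrix_def)
qed

context
  fixes R :: "real^'n^'n" and C :: "(real^'n) set" and r :: regularity and \<alpha> :: real
  assumes R: "orthogonal_matrix R" and \<alpha>: "0 \<le> \<alpha>" "\<alpha> \<le> 1" and r2: "order_ge 2 r"
    and C: "reg_body r \<alpha> C"
begin

lemma rotation_linear: "linear ((*v) R)" "linear ((*v) (transpose R))" "bij ((*v) R)" "inj ((*v) R)"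
proof -
  show "linear ((*v) R)" "linear ((*v) (transpose R))" by simp_all
  show "bij ((*v) R)" by (rule bijI'[of "(*v) R"]) (metis orthogonal_matrix_mult[OF R])+
  then show "inj ((*v) R)" by (rule bij_is_inj)
qed

lemma frontier_rotation: "frontier ((*v) R ` C) = (*v) R ` frontier C"
proof -
  have "closure ((*v) R ` C) = (*v) R ` closure C"
    using closure_injective_linear_image[OF rotation_linear(1,4)] by simp
  moreover have "interior ((*v) R ` C) = (*v) R ` interior C"
    by (rule interior_injective_linear_image[OF rotation_linear(1,4)])
  ultimately show ?thesis
    by (simp add: frontier_def image_set_diff[OF rotation_linear(4)])
qed

lemma mem_rotation_iff: "x \<in> (*v) R ` S \<longleftrightarrow> transpose R *v x \<in> S"
  using orthogonal_matrix_mult(2,3)[OF R] by (metis image_iff)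

lemma supports_rotation:
  assumes "supports C x v" shows "supports ((*v) R ` C) (R *v x) (R *v v)"
proof -
  have "(R *v y - R *v x) \<bullet> (R *v v) \<le> 0" if "y \<in> C" for y
  proof -
    have "(R *v y - R *v x) \<bullet> (R *v v) = (y - x) \<bullet> v"
      unfolding matrix_vector_mult_diff_distrib[symmetric] by (rule orthogonal_matrix_mult(1)[OF R])
    then show ?thesis using assms that by (simp add: supports_def)
  qed
  then show ?thesis by (auto simp: supports_def)
qed

lemma zero_set_rotation:
  assumes "frontier C \<inter> U = {x\<in>U. F x = 0}"
  shows "frontier ((*v) R ` C) \<inter> (*v) R ` U = {x \<in> (*v) R ` U. F (transpose R *v x) = 0}"
proof (rule set_eqI)
  fix x
  have "x \<in> frontier ((*v) R ` C) \<inter> (*v) R ` U \<longleftrightarrow> transpose R *v x \<in> frontier C \<inter> U"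
    by (simp add: frontier_rotation mem_rotation_iff)
  also have "\<dots> \<longleftrightarrow> x \<in> {x \<in> (*v) R ` U. F (transpose R *v x) = 0}"
    unfolding assms by (simp add: mem_rotation_iff)
  finally show "x \<in> frontier ((*v) R ` C) \<inter> (*v) R ` U \<longleftrightarrow> x \<in> {x \<in> (*v) R ` U. F (transpose R *v x) = 0}" .
qed

lemma open_rotation: "open U \<Longrightarrow> open ((*v) R ` U)"
  using open_bijective_linear_image_eq[OF rotation_linear(1,3)] by blast

lemma reg_fun_rotation:
  assumes "open U" "reg_fun r \<alpha> U F"
  shows "reg_fun r \<alpha> ((*v) R ` U) (\<lambda>x. F (transpose R *v x))"
proof (rule reg_fun_compose[OF \<alpha> _ open_rotation[OF assms(1)] assms(1) _ _ assms(2)])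
  show "order_ge 1 r" using order_ge_mono[OF r2] by simp
  show "transpose R *v x \<in> U" if "x \<in> (*v) R ` U" for x using that mem_rotation_iff by blast
  have "linear (\<lambda>x. (transpose R *v x) $ i)" for i
    using linear_compose[OF rotation_linear(2) bounded_linear.linear[OF bounded_linear_vec_nth[of i]]] by (simp add: o_def)
  then show "reg_fun r \<alpha> ((*v) R ` U) (\<lambda>x. (transpose R *v x) $ i)" for i
    by (rule reg_fun_linear[OF \<alpha> open_rotation[OF assms(1)]])
qed

lemma convex_body_rotation: "convex_body ((*v) R ` C)"
proof -
  have "compact C" "convex C" "interior C \<noteq> {}" using C by (auto simp: reg_body_def convex_body_def)
  then show ?thesis
    using interior_injective_linear_image[OF rotation_linear(1,4), of C]
      compact_continuous_image[OF linear_continuous_on[OF matrix_vector_mul_bounded_linear]] convex_linear_image[OF rotation_linear(1)]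
    by (auto simp: convex_body_def linear_linear)
qed

lemma has_derivative_rotation:
  assumes "(F has_derivative L) (at (transpose R *v x))"
  shows "((\<lambda>x. F (transpose R *v x)) has_derivative (\<lambda>h. L (transpose R *v h))) (at x)"
  using has_derivative_compose[OF linear_imp_has_derivative[OF rotation_linear(2)] assms] .

lemma reg_body_rotation: "reg_body r \<alpha> ((*v) R ` C)"
  unfolding reg_body_def
proof (intro conjI convex_body_rotation ballI)
  fix p assume "p \<in> frontier ((*v) R ` C)"
  then have "transpose R *v p \<in> frontier C" by (simp add: frontier_rotation mem_rotation_iff)
  then obtain U F where U: "open U" "transpose R *v p \<in> U" and F: "reg_fun r \<alpha> U F"
    and nz: "\<forall>x\<in>U. \<exists>L. (F has_derivative L) (at x) \<and> L \<noteq> (\<lambda>_. 0)"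
    and fr: "frontier C \<inter> U = {x\<in>U. F x = 0}"
    using C unfolding reg_body_def by blast
  have "\<exists>L. ((\<lambda>x. F (transpose R *v x)) has_derivative L) (at x) \<and> L \<noteq> (\<lambda>_. 0)" if "x \<in> (*v) R ` U" for x
  proof -
    have "transpose R *v x \<in> U" using that mem_rotation_iff by blast
    then obtain L where L: "(F has_derivative L) (at (transpose R *v x))" "L \<noteq> (\<lambda>_. 0)" using nz by blast
    have "(\<lambda>h. L (transpose R *v h)) \<noteq> (\<lambda>_. 0)"
    proof
      assume e: "(\<lambda>h. L (transpose R *v h)) = (\<lambda>_. 0)"
      have "L k = 0" for k using fun_cong[OF e, of "R *v k"] orthogonal_matrix_mult(2)[OF R] by simp
      then show False using L(2) by blast
    qed
    then show ?thesis using has_derivative_rotation[OF L(1)] by blast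
  qed
  then have D: "\<forall>x\<in>(*v) R ` U. \<exists>L. ((\<lambda>x. F (transpose R *v x)) has_derivative L) (at x) \<and> L \<noteq> (\<lambda>_. 0)" by blast
  have "p \<in> (*v) R ` U" using U(2) by (simp add: mem_rotation_iff)
  then show "\<exists>U F. open U \<and> p \<in> U \<and> reg_fun r \<alpha> U F \<and>
      (\<forall>x\<in>U. \<exists>L. (F has_derivative L) (at x) \<and> L \<noteq> (\<lambda>_. 0)) \<and>
      frontier ((*v) R ` C) \<inter> U = {x \<in> U. F x = 0}"
    by (rule_tac exI[of _ "(*v) R ` U"], rule_tac exI[of _ "\<lambda>x. F (transpose R *v x)"])
      (intro conjI open_rotation[OF U(1)] reg_fun_rotation[OF U(1) F] D zero_set_rotation[OF fr])
qed

text \<open>The criterion of \<open>gauss_curv_eq_0_iff\<close> is transported rather than the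
  determinant: composing a chart with the transpose of R turns its gradient by R and conjugates its
  Hessian by R.\<close>

lemma Zset_rotation: "Zset ((*v) R ` C) \<subseteq> (*v) R ` Zset C"
proof
  fix v assume "v \<in> Zset ((*v) R ` C)"
  then obtain x where x: "x \<in> frontier ((*v) R ` C)" "gauss_curv ((*v) R ` C) x = 0"
    "v = gauss_map ((*v) R ` C) x" by (auto simp: Zset_def)
  define y where "y = transpose R *v x"
  have y: "y \<in> frontier C" using x(1) by (simp add: frontier_rotation mem_rotation_iff y_def)
  have xy: "x = R *v y" using orthogonal_matrix_mult(3)[OF R] by (simp add: y_def)
  obtain U F g H where "reg_chart C U F g H r \<alpha> y" using reg_body_chart[OF \<alpha> r2 C y] by blast
  then interpret C: reg_chart C U F g H r \<alpha> y .
  let ?g = "\<lambda>x. R *v g (transpose R *v x)" and ?H = "\<lambda>x h. R *v H (transpose R *v x) (transpose R *v h)"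
  interpret RC: boundary_chart "(*v) R ` C" "(*v) R ` U" "\<lambda>x. F (transpose R *v x)" ?g ?H
  proof
    show "convex_body ((*v) R ` C)" by (rule convex_body_rotation)
    show "open ((*v) R ` U)" by (rule open_rotation[OF C.openU])
    fix x assume "x \<in> (*v) R ` U"
    then have xU: "transpose R *v x \<in> U" using mem_rotation_iff by blast
    have "g (transpose R *v x) \<bullet> (transpose R *v h) = ?g x \<bullet> h" for h
      using orthogonal_matrix_mult(1)[OF R, of "g (transpose R *v x)" "transpose R *v h"]
        orthogonal_matrix_mult(3)[OF R] by simp
    then show "((\<lambda>x. F (transpose R *v x)) has_derivative (\<lambda>h. ?g x \<bullet> h)) (at x)"
      using has_derivative_rotation[OF C.dF[OF xU]] by simp
    show "?g x \<noteq> 0" using C.gnz[OF xU] orthogonal_matrix_mult(4)[OF R, of "g (transpose R *v x)"] by auto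
    show "(?g has_derivative ?H x) (at x)"
      by (rule has_derivative_compose[OF has_derivative_rotation[OF C.dg[OF xU]] linear_imp_has_derivative[OF rotation_linear(1)]])
  next
    show "frontier ((*v) R ` C) \<inter> (*v) R ` U = {x \<in> (*v) R ` U. F (transpose R *v x) = 0}"
      by (rule zero_set_rotation[OF C.fr])
  qed
  have xU: "x \<in> (*v) R ` U" using C.p(1) by (simp add: xy)
  have gy: "gauss_map C y = C.u" by (simp add: C.u_def)
  have "supports ((*v) R ` C) x (R *v C.u)" unfolding xy by (rule supports_rotation[OF C.supports_u])
  moreover have n: "norm (R *v C.u) = 1" using orthogonal_matrix_mult(4)[OF R] C.norm_u by simp
  then have "R *v C.u \<noteq> 0" by auto
  ultimately have vu: "v = R *v C.u" using RC.gauss_map_eq[OF xU x(1)] n x(3) by simp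
  obtain z k where z: "z \<noteq> 0" "?g x \<bullet> z = 0" "?H x z = k *\<^sub>R ?g x"
    using RC.gauss_curv_eq_0_iff[OF xU x(1)] x(2) by blast
  define w where "w = transpose R *v z"
  have zw: "z = R *v w" using orthogonal_matrix_mult(3)[OF R] by (simp add: w_def)
  have "w \<noteq> 0" using z(1) zw by auto
  moreover have "g y \<bullet> w = 0"
    using z(2) orthogonal_matrix_mult(1)[OF R] by (simp add: zw y_def)
  moreover have "H y w = k *\<^sub>R g y"
  proof -
    have "R *v H y w = k *\<^sub>R (R *v g y)" using z(3) by (simp add: w_def y_def)
    then have "R *v H y w = R *v (k *\<^sub>R g y)" by (simp add: linear_scale[OF rotation_linear(1)])
    then show ?thesis using rotation_linear(4) by (simp add: inj_eq)
  qed
  ultimately have "gauss_curv C y = 0" using C.gauss_curv_eq_0_iff[OF C.p] by blast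
  then have "C.u \<in> Zset C" using y gy unfolding Zset_def by force
  then show "v \<in> (*v) R ` Zset C" using vu by blast
qed

end

lemma minkowski_sum_commute: "minkowski_sum A B = minkowski_sum B A"
  by (auto simp: minkowski_sum_def) (metis add.commute)+

text \<open>A boundary point of the sum splits into boundary points with a common normal.
  Disjointness leaves nonzero curvature at one of them at least, and commutativity of the sum lets
  that body play the role of A.\<close>

theorem reg_body_minkowski_sum:
  fixes A B :: "(real^'n) set"
  assumes \<alpha>: "0 \<le> \<alpha>" "\<alpha> \<le> 1" and r2: "order_ge 2 r" and A: "reg_body r \<alpha> A" and B: "reg_body r \<alpha> B"
    and disj: "Zset A \<inter> Zset B = {}"
  shows "reg_body r \<alpha> (minkowski_sum A B)"
  unfolding reg_body_def
proof (intro conjI ballI)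
  have cA: "convex_body A" and cB: "convex_body B" using A B by (auto simp: reg_body_def)
  show body: "convex_body (minkowski_sum A B)" by (rule convex_body_minkowski_sum[OF cA cB])
  fix p assume p: "p \<in> frontier (minkowski_sum A B)"
  obtain v where v: "norm v = 1" "supports (minkowski_sum A B) p v" by (rule frontier_supports[OF body p])
  then have v0: "v \<noteq> 0" by auto
  have "closed (minkowski_sum A B)" using body by (simp add: convex_body_def compact_imp_closed)
  then have "p \<in> minkowski_sum A B" using p frontier_subset_closed by blast
  then obtain a b where ab: "p = a + b" "a \<in> A" "b \<in> B" by (auto simp: minkowski_sum_def)
  have s: "supports A a v" "supports B b v" using supports_summands v(2) ab by blast+
  have f: "a \<in> frontier A" "b \<in> frontier B"
    using supports_frontier[OF s(1) v0 ab(2)] supports_frontier[OF s(2) v0 ab(3)] by auto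
  have ga: "gauss_map A a = v" by (rule reg_body_gauss_map(3)[OF \<alpha> r2 A f(1) s(1) v(1)])
  have gb: "gauss_map B b = v" by (rule reg_body_gauss_map(3)[OF \<alpha> r2 B f(2) s(2) v(1)])
  obtain Ua Fa ga' Ha where ca: "reg_chart A Ua Fa ga' Ha r \<alpha> a" using reg_body_chart[OF \<alpha> r2 A f(1)] by blast
  obtain Ub Fb gb' Hb where cb: "reg_chart B Ub Fb gb' Hb r \<alpha> b" using reg_body_chart[OF \<alpha> r2 B f(2)] by blast
  show "\<exists>U F. open U \<and> p \<in> U \<and> reg_fun r \<alpha> U F \<and>
      (\<forall>x\<in>U. \<exists>L. (F has_derivative L) (at x) \<and> L \<noteq> (\<lambda>_. 0)) \<and>
      frontier (minkowski_sum A B) \<inter> U = {x \<in> U. F x = 0}"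
  proof (cases "gauss_curv A a = 0")
    case False
    show ?thesis unfolding ab(1) by (rule minkowski_sum_chart[OF ca cb _ False]) (simp add: ga gb)
  next
    case True
    then have "v \<in> Zset A" using f(1) ga unfolding Zset_def by blast
    then have "v \<notin> Zset B" using disj by blast
    then have "gauss_curv B b \<noteq> 0" using f(2) gb unfolding Zset_def by blast
    from minkowski_sum_chart[OF cb ca _ this] show ?thesis
      unfolding ab(1) minkowski_sum_commute[of A B] add.commute[of a b] by (simp add: ga gb)
  qed
qed

text \<open>The rotation by the angle between the unit vectors \<open>p\<close> and \<open>w\<close> in their plane: the composite
  of the reflections along \<open>p\<close> and \<open>p + w\<close>.\<close>

definition rot :: "'a::real_inner \<Rightarrow> 'a \<Rightarrow> 'a \<Rightarrow> 'a" where
  "rot p w v = v - ((p + w) \<bullet> v / (1 + p \<bullet> w)) *\<^sub>R (p + w) + (2 * (p \<bullet> v)) *\<^sub>R w"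

lemma linear_rot: "linear (rot p w)"
  by (rule linearI) (simp_all add: rot_def inner_add_right scaleR_add_left add_divide_distrib algebra_simps)

lemma rot_self:
  assumes "norm p = 1" shows "rot p p v = v"
proof -
  have "p \<bullet> p = 1" using assms by (simp add: norm_eq_1)
  then have "rot p p v = v - ((2 * (p \<bullet> v)) / 2) *\<^sub>R (2 *\<^sub>R p) + (2 * (p \<bullet> v)) *\<^sub>R p"
    by (simp add: rot_def inner_add_left scaleR_2)
  then show ?thesis by simp
qed

lemma rot_apply:
  assumes "norm p = 1" "norm w = 1" "1 + p \<bullet> w \<noteq> 0" shows "rot p w p = w"
proof -
  have "p \<bullet> p = 1" using assms by (simp add: norm_eq_1)
  then have "(p + w) \<bullet> p = 1 + p \<bullet> w" by (simp add: inner_add_left inner_commute[of w p])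
  then have "(p + w) \<bullet> p / (1 + p \<bullet> w) = 1" using assms(3) by simp
  then show ?thesis using \<open>p \<bullet> p = 1\<close> by (simp add: rot_def scaleR_2)
qed

lemma norm_rot:
  assumes "norm p = 1" "norm w = 1" "1 + p \<bullet> w \<noteq> 0" shows "norm (rot p w v) = norm v"
proof -
  define D a b e where "D = 1 + p \<bullet> w" and "a = p \<bullet> v" and "b = w \<bullet> v" and "e = (a + b) / D"
  have pp: "p \<bullet> p = 1" "w \<bullet> w = 1" using assms by (simp_all add: norm_eq_1)
  have pw: "p \<bullet> w = D - 1" by (simp add: D_def)
  have D: "D \<noteq> 0" using assms(3) by (simp add: D_def)
  have eD: "e * D = a + b" using D by (simp add: e_def)
  have r: "rot p w v = v - e *\<^sub>R (p + w) + (2 * a) *\<^sub>R w"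
    by (simp add: rot_def e_def D_def a_def b_def inner_add_left)
  have c: "v \<bullet> p = a" "v \<bullet> w = b" "p \<bullet> v = a" "w \<bullet> v = b" "w \<bullet> p = D - 1"
    by (simp_all add: a_def b_def inner_commute D_def)
  \<comment> \<open>Both extra terms contain the factor e D - (a + b), which is 0.\<close>
  have "rot p w v \<bullet> rot p w v = v \<bullet> v + 2 * e * (e * D - (a + b)) + 4 * a * ((a + b) - e * D)"
    unfolding r by (simp add: inner_add_left inner_add_right inner_diff_left inner_diff_right pp pw c algebra_simps power2_eq_square)
  then show ?thesis using eD by (simp add: norm_eq_sqrt_inner)
qed

text \<open>R is followed by the rotation that takes p = R z to a nearby w outside Z. The composite
  depends continuously on w and equals R at w = p, so it stays in N, and its determinant, which is 1
  or -1, stays positive.\<close>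

lemma SO_rot_dense:
  fixes R :: "real^'n^'n" and Z :: "(real^'n) set"
  assumes R: "R \<in> SO" and z: "norm z = 1" and N: "open N" "R \<in> N"
    and Z: "\<And>u \<epsilon>. norm u = 1 \<Longrightarrow> \<epsilon> > 0 \<Longrightarrow> \<exists>v. norm v = 1 \<and> dist v u < \<epsilon> \<and> v \<notin> Z"
  shows "\<exists>S. S \<in> SO \<and> S \<in> N \<and> S *v z \<notin> Z"
proof -
  have oR: "orthogonal_matrix R" "det R = 1" using R by (auto simp: SO_def)
  define p where "p = R *v z"
  have p1: "norm p = 1" using orthogonal_matrix_mult(4)[OF oR(1)] z by (simp add: p_def)
  have pp: "p \<bullet> p = 1" using p1 by (simp add: norm_eq_1)
  define M where "M w = matrix (\<lambda>x. rot p w (R *v x))" for w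
  have lin: "linear (\<lambda>x. rot p w (R *v x))" for w
    using linear_compose[OF _ linear_rot, of "(*v) R" p w] by (simp add: o_def)
  have Mv: "M w *v x = rot p w (R *v x)" for w x
    unfolding M_def using fun_cong[OF matrix_vector_mul(2)[OF lin]] by simp
  have Mp: "M p = R" unfolding M_def by (simp add: rot_self[OF p1])
  \<comment> \<open>The entries are rational in w with denominator 1 + p \<bullet> w, which is 2 at
    w = p.\<close>
  have cont: "(M \<longlongrightarrow> M p) (nhds p)"
  proof (intro vec_tendstoI)
    fix i j
    define q where "q = R *v axis j 1"
    have "isCont (\<lambda>w. q $ i - ((p + w) \<bullet> q / (1 + p \<bullet> w)) * (p $ i + w $ i) + (2 * (p \<bullet> q)) * w $ i) p"
      by (intro continuous_intros isCont_vec_nth) (use pp in auto)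
    then have "isCont (\<lambda>w. M w $ i $ j) p" by (simp add: M_def matrix_def rot_def q_def)
    from isCont_tendsto_nhds[OF this] show "((\<lambda>w. M w $ i $ j) \<longlongrightarrow> M p $ i $ j) (nhds p)" .
  qed
  have "((\<lambda>w. det (M w)) \<longlongrightarrow> det (M p)) (nhds p)"
    unfolding det_def by (intro tendsto_intros cont)
  then have detpos: "\<forall>\<^sub>F w in nhds p. det (M w) > 0"
    using oR(2) Mp by (intro order_tendstoD(1)) auto
  have "isCont (\<lambda>w. 1 + p \<bullet> w) p" by (intro continuous_intros)
  from order_tendstoD(1)[OF isCont_tendsto_nhds[OF this], of 0]
  have pos: "\<forall>\<^sub>F w in nhds p. 1 + p \<bullet> w > 0" using pp by simp
  have inN: "\<forall>\<^sub>F w in nhds p. M w \<in> N" using cont N Mp by (intro topological_tendstoD[OF cont]) auto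
  from detpos pos inN have "\<forall>\<^sub>F w in nhds p. det (M w) > 0 \<and> 1 + p \<bullet> w > 0 \<and> M w \<in> N"
    by eventually_elim simp
  then obtain \<epsilon> where \<epsilon>: "\<epsilon> > 0" "\<And>w. dist w p < \<epsilon> \<Longrightarrow> det (M w) > 0 \<and> 1 + p \<bullet> w > 0 \<and> M w \<in> N"
    unfolding eventually_nhds_metric by blast
  obtain w where w: "norm w = 1" "dist w p < \<epsilon>" "w \<notin> Z" using Z[OF p1 \<epsilon>(1)] by blast
  note e = \<epsilon>(2)[OF w(2)]
  have ne: "1 + p \<bullet> w \<noteq> 0" using e by simp
  have "orthogonal_transformation (\<lambda>x. rot p w (R *v x))"
    unfolding orthogonal_transformation using lin norm_rot[OF p1 w(1) ne] orthogonal_matrix_mult(4)[OF oR(1)] by simp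
  then have "orthogonal_matrix (M w)" unfolding orthogonal_transformation_matrix M_def by blast
  moreover have "det (M w) = 1" using det_orthogonal_matrix[OF \<open>orthogonal_matrix (M w)\<close>] e by auto
  ultimately have "M w \<in> SO" by (simp add: SO_def)
  moreover have "M w *v z = w" using rot_apply[OF p1 w(1) ne] by (simp add: Mv p_def)
  ultimately show ?thesis using e w(3) by metis
qed

section \<open>Open dense conditions on rotations\<close>

lemma transpose_SO: "R \<in> SO \<Longrightarrow> transpose R \<in> SO"
  by (auto simp: SO_def orthogonal_matrix_mult(5) det_transpose)

lemma continuous_mult_vec: "continuous_on UNIV (\<lambda>R::real^'n^'n. R *v z)"
  unfolding matrix_vector_mult_def by (intro continuous_intros)

lemma continuous_transpose: "continuous_on UNIV (transpose :: real^'n^'n \<Rightarrow> real^'n^'n)"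
  unfolding transpose_def[abs_def] by (intro continuous_intros)

lemma open_dense_in_SO:
  fixes f :: "real^'n^'n \<Rightarrow> real^'n"
  assumes f: "continuous_on UNIV f" and Z: "closed Z"
    and dense: "\<forall>R N. R \<in> SO \<longrightarrow> open N \<longrightarrow> R \<in> N \<longrightarrow> (\<exists>S. S \<in> SO \<and> S \<in> N \<and> f S \<notin> Z)"
  shows "openin (top_of_set SO) {R \<in> SO. f R \<notin> Z}"
    "(top_of_set SO) closure_of {R \<in> SO. f R \<notin> Z} = SO"
proof -
  have "open (f -` (- Z))" using f Z by (intro open_vimage) auto
  moreover have "{R \<in> SO. f R \<notin> Z} = SO \<inter> f -` (- Z)" by auto
  ultimately show "openin (top_of_set SO) {R \<in> SO. f R \<notin> Z}" by (auto simp: openin_open)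
  show "(top_of_set SO) closure_of {R \<in> SO. f R \<notin> Z} = SO"
  proof (intro equalityI subsetI)
    fix R assume "R \<in> (top_of_set SO) closure_of {R \<in> SO. f R \<notin> Z}"
    then show "R \<in> SO" by (simp add: in_closure_of)
  next
    fix R :: "real^'n^'n" assume R: "R \<in> SO"
    have "\<exists>S. S \<in> {R \<in> SO. f R \<notin> Z} \<and> S \<in> T" if T: "R \<in> T" "openin (top_of_set SO) T" for T
    proof -
      obtain N where N: "open N" "T = SO \<inter> N" using T(2) by (auto simp: openin_open)
      then have "R \<in> N" using T(1) by auto
      from dense[rule_format, OF R N(1) this] show ?thesis using N by blast
    qed
    then show "R \<in> (top_of_set SO) closure_of {R \<in> SO. f R \<notin> Z}" using R by (auto simp: in_closure_of)
  qed
qed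

theorem theorem1p2:
  fixes A B :: "(real^'n) set" and r :: regularity and \<alpha> :: real
  assumes "\<forall>k. r = Fin k \<longrightarrow> k \<ge> 2"
    and "0 \<le> \<alpha>" and "\<alpha> \<le> 1"
    and "reg_body r \<alpha> A" and "reg_body r \<alpha> B"
    and "countable (Zset A) \<or> countable (Zset B)"
  shows "comeager_in SO {R. reg_body r \<alpha> (minkowski_sum ((\<lambda>x. R *v x) ` A) B)}"
proof -
  note \<alpha> = assms(2,3) and A = assms(4) and B = assms(5)
  have r2: "order_ge 2 r" using assms(1) by (simp add: order_ge_def)
  have good: "reg_body r \<alpha> (minkowski_sum ((*v) R ` A) B)"
    if R: "R \<in> SO" and disj: "\<And>z. z \<in> Zset A \<Longrightarrow> R *v z \<notin> Zset B" for R
  proof -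
    have oR: "orthogonal_matrix R" using R by (simp add: SO_def)
    have "Zset ((*v) R ` A) \<inter> Zset B = {}" using Zset_rotation[OF oR \<alpha> r2 A] disj by blast
    then show ?thesis by (rule reg_body_minkowski_sum[OF \<alpha> r2 reg_body_rotation[OF oR \<alpha> r2 A] B])
  qed
  note clA = compact_imp_closed[OF compact_Zset[OF \<alpha> r2 A]]
    and clB = compact_imp_closed[OF compact_Zset[OF \<alpha> r2 B]]
  from assms(6) show ?thesis
  proof
    assume cA: "countable (Zset A)"
    \<comment> \<open>One condition for each of the countably many z; together they say that R moves
      \<open>Zset A\<close> off \<open>Zset B\<close>.\<close>
    define V where "V z = {R \<in> SO. R *v z \<notin> Zset B}" for z
    have "openin (top_of_set SO) (V z) \<and> (top_of_set SO) closure_of (V z) = SO" if z: "z \<in> Zset A" for z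
    proof -
      have "\<exists>S. S \<in> SO \<and> S \<in> N \<and> S *v z \<notin> Zset B" if "R \<in> SO" "open N" "R \<in> N" for R N
        by (rule SO_rot_dense[OF that(1) Zset_norm[OF \<alpha> r2 A z] that(2,3) Zset_codense[OF \<alpha> r2 B]])
      then have "\<forall>R N. R \<in> SO \<longrightarrow> open N \<longrightarrow> R \<in> N \<longrightarrow> (\<exists>S. S \<in> SO \<and> S \<in> N \<and> S *v z \<notin> Zset B)" by blast
      from open_dense_in_SO[OF continuous_mult_vec clB this] show ?thesis unfolding V_def by blast
    qed
    moreover have "SO \<inter> \<Inter>(V ` Zset A) \<subseteq> {R. reg_body r \<alpha> (minkowski_sum ((*v) R ` A) B)}"
      using good by (auto simp: V_def)
    ultimately show ?thesis unfolding comeager_in_def using cA by (intro exI[of _ "V ` Zset A"]) auto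
  next
    assume cB: "countable (Zset B)"
    \<comment> \<open>The countable set now belongs to B, so the condition is put on the inverse
      rotation, which is the transpose.\<close>
    define V where "V w = {R \<in> SO. transpose R *v w \<notin> Zset A}" for w
    have "openin (top_of_set SO) (V w) \<and> (top_of_set SO) closure_of (V w) = SO" if w: "w \<in> Zset B" for w
    proof -
      have c: "continuous_on UNIV (\<lambda>R::real^'n^'n. transpose R *v w)"
        using continuous_on_compose[OF continuous_transpose
            continuous_on_subset[OF continuous_mult_vec[of w] subset_UNIV]] by (simp add: o_def)
      have "\<exists>S. S \<in> SO \<and> S \<in> N \<and> transpose S *v w \<notin> Zset A"
        if R: "R \<in> SO" and N: "open N" "R \<in> N" for R N
      proof -
        have "open (transpose -` N)" using continuous_transpose N(1) by (intro open_vimage)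
        moreover have "transpose R \<in> transpose -` N" using N(2) by simp
        ultimately obtain S where "S \<in> SO" "S \<in> transpose -` N" "S *v w \<notin> Zset A"
          using SO_rot_dense[OF transpose_SO[OF R] Zset_norm[OF \<alpha> r2 B w] _ _ Zset_codense[OF \<alpha> r2 A]] by blast
        then show ?thesis using transpose_SO by (intro exI[of _ "transpose S"]) simp
      qed
      then have "\<forall>R N. R \<in> SO \<longrightarrow> open N \<longrightarrow> R \<in> N \<longrightarrow> (\<exists>S. S \<in> SO \<and> S \<in> N \<and> transpose S *v w \<notin> Zset A)" by blast
      from open_dense_in_SO[OF c clA this] show ?thesis unfolding V_def by blast
    qed
    moreover have "SO \<inter> \<Inter>(V ` Zset B) \<subseteq> {R. reg_body r \<alpha> (minkowski_sum ((*v) R ` A) B)}"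
    proof
      fix R assume R: "R \<in> SO \<inter> \<Inter>(V ` Zset B)"
      then have oR: "orthogonal_matrix R" by (simp add: SO_def)
      have "R *v z \<notin> Zset B" if "z \<in> Zset A" for z
        using R that orthogonal_matrix_mult(2)[OF oR, of z] by (auto simp: V_def)
      then show "R \<in> {R. reg_body r \<alpha> (minkowski_sum ((*v) R ` A) B)}" using good R by auto
    qed
    ultimately show ?thesis unfolding comeager_in_def using cB by (intro exI[of _ "V ` Zset B"]) auto
  qed
qed

end
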